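(* Let $G$ be a group, let $P\subseteq G$ be a unital subsemigroup and let $\Sigma$ be a finite set of generators for $P$ such that the following conditions hold: (a) $P\subseteq G$ is left quasi-lattice ordered, $P$ is right Ore, and the enveloping group of $P$ is $G$. (b) For all $x,y,z\in G$ with $xP\cap yP=zP$ and for every $s\in\Sigma$, either $xsP\cap yP=zP$ or there exists $t\in\Sigma$ with $xsP\cap yP=ztP$. (c) For every finite subset $F$ of $\Sigma$ and every $s\in\Sigma\setminus F$, we have $sP\cap\bigcap_{t\in F}tP\subsetneq\bigcap_{t\in F}tP$. Then $G$ is of type FL, and the cohomological dimension of $G$ is at most $|\Sigma|$. In particular, $H_i(G,M)=\{0\}$ and $H^i(G,M)=\{0\}$ for every $i>|\Sigma|$ and every $\mathbb ZG$-module $M$.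
   Context: "$P\subseteq G$ is left quasi-lattice ordered" means: $P$ contains no non-trivial units, and for all $x,y\in G$ either $xP\cap yP=\varnothing$ or there exists $z\in G$ with $xP\cap yP=zP$. "$P$ is right Ore" means: $P$ is cancellative and $pP\cap qP\ne\varnothing$ for all $p,q\in P$; its enveloping group (group of right fractions) being $G$ means $G=\{pq^{-1}:p,q\in P\}$. $\Sigma$ generates $P$ as a unital semigroup (monoid). In (c), the intersection over $F=\varnothing$ is understood to be $P$. A group $G$ is of type FL if the trivial $\mathbb ZG$-module $\mathbb Z$ has a finite-length resolution by finitely generated free $\mathbb ZG$-modules. The cohomological dimension of $G$ is the projective dimension of $\mathbb Z$ over $\mathbb ZG$. *)

theory Defs
  imports
    "HOL-Algebra.Module"
    "HOL-Algebra.Free_Abelian_Groups"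
    "HOL-Library.Extended_Nat"
begin

section \<open>Subsemigroups of groups\<close>

definition monoid_generated :: "('g, 'b) monoid_scheme \<Rightarrow> 'g set \<Rightarrow> 'g set" where
  "monoid_generated G S = \<Inter>{H. submonoid H G \<and> S \<subseteq> H}"

text \<open>The first conjunct says that the monoid \<open>P\<close> contains no non-trivial units.\<close>

definition left_quasi_lattice_ordered :: "('g, 'b) monoid_scheme \<Rightarrow> 'g set \<Rightarrow> bool" where
  "left_quasi_lattice_ordered G P \<longleftrightarrow>
     Units (G\<lparr>carrier := P\<rparr>) = {\<one>\<^bsub>G\<^esub>} \<and>
     (\<forall>x\<in>carrier G. \<forall>y\<in>carrier G.
        (x <#\<^bsub>G\<^esub> P) \<inter> (y <#\<^bsub>G\<^esub> P) = {} \<or>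
        (\<exists>z\<in>carrier G. (x <#\<^bsub>G\<^esub> P) \<inter> (y <#\<^bsub>G\<^esub> P) = z <#\<^bsub>G\<^esub> P))"

definition cancellative :: "('g, 'b) monoid_scheme \<Rightarrow> 'g set \<Rightarrow> bool" where
  "cancellative G P \<longleftrightarrow>
     (\<forall>a\<in>P. \<forall>b\<in>P. \<forall>c\<in>P.
        (a \<otimes>\<^bsub>G\<^esub> b = a \<otimes>\<^bsub>G\<^esub> c \<longrightarrow> b = c) \<and>
        (b \<otimes>\<^bsub>G\<^esub> a = c \<otimes>\<^bsub>G\<^esub> a \<longrightarrow> b = c))"

definition right_Ore :: "('g, 'b) monoid_scheme \<Rightarrow> 'g set \<Rightarrow> bool" where
  "right_Ore G P \<longleftrightarrow>
     cancellative G P \<and>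
     (\<forall>p\<in>P. \<forall>q\<in>P. (p <#\<^bsub>G\<^esub> P) \<inter> (q <#\<^bsub>G\<^esub> P) \<noteq> {})"

definition group_of_right_fractions :: "('g, 'b) monoid_scheme \<Rightarrow> 'g set \<Rightarrow> bool" where
  "group_of_right_fractions G P \<longleftrightarrow>
     carrier G = {p \<otimes>\<^bsub>G\<^esub> inv\<^bsub>G\<^esub> q | p q. p \<in> P \<and> q \<in> P}"


section \<open>Left modules over a ring that need not be commutative\<close>

text \<open>
  The record type \<open>module\<close> of HOL-Algebra is reused; its fields \<open>mult\<close> and \<open>one\<close> play no role.
  The locale \<open>module\<close> itself requires a commutative ring.
\<close>

locale left_module = R?: ring R + M?: abelian_group M
    for R :: "('r, 'c) ring_scheme" (structure)
    and M :: "('r, 'm, 'd) module_scheme" (structure) +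
  assumes smult_closed:
      "\<lbrakk>a \<in> carrier R; x \<in> carrier M\<rbrakk> \<Longrightarrow> a \<odot>\<^bsub>M\<^esub> x \<in> carrier M"
    and smult_l_distr:
      "\<lbrakk>a \<in> carrier R; b \<in> carrier R; x \<in> carrier M\<rbrakk>
       \<Longrightarrow> (a \<oplus>\<^bsub>R\<^esub> b) \<odot>\<^bsub>M\<^esub> x = a \<odot>\<^bsub>M\<^esub> x \<oplus>\<^bsub>M\<^esub> b \<odot>\<^bsub>M\<^esub> x"
    and smult_r_distr:
      "\<lbrakk>a \<in> carrier R; x \<in> carrier M; y \<in> carrier M\<rbrakk>
       \<Longrightarrow> a \<odot>\<^bsub>M\<^esub> (x \<oplus>\<^bsub>M\<^esub> y) = a \<odot>\<^bsub>M\<^esub> x \<oplus>\<^bsub>M\<^esub> a \<odot>\<^bsub>M\<^esub> y"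
    and smult_assoc:
      "\<lbrakk>a \<in> carrier R; b \<in> carrier R; x \<in> carrier M\<rbrakk>
       \<Longrightarrow> (a \<otimes>\<^bsub>R\<^esub> b) \<odot>\<^bsub>M\<^esub> x = a \<odot>\<^bsub>M\<^esub> (b \<odot>\<^bsub>M\<^esub> x)"
    and smult_one:
      "x \<in> carrier M \<Longrightarrow> \<one>\<^bsub>R\<^esub> \<odot>\<^bsub>M\<^esub> x = x"

definition left_module_hom ::
    "('r, 'c) ring_scheme \<Rightarrow> ('r, 'm) module \<Rightarrow> ('r, 'n) module \<Rightarrow> ('m \<Rightarrow> 'n) set" where
  "left_module_hom R M N =
     {f \<in> carrier M \<rightarrow> carrier N.
        (\<forall>x\<in>carrier M. \<forall>y\<in>carrier M. f (x \<oplus>\<^bsub>M\<^esub> y) = f x \<oplus>\<^bsub>N\<^esub> f y) \<and>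
        (\<forall>a\<in>carrier R. \<forall>x\<in>carrier M. f (a \<odot>\<^bsub>M\<^esub> x) = a \<odot>\<^bsub>N\<^esub> f x)}"

definition is_basis :: "('r, 'c) ring_scheme \<Rightarrow> ('r, 'm) module \<Rightarrow> 'm set \<Rightarrow> bool" where
  "is_basis R M B \<longleftrightarrow>
     B \<subseteq> carrier M \<and>
     (\<forall>x\<in>carrier M. \<exists>!c. c \<in> B \<rightarrow>\<^sub>E carrier R \<and> finite {b \<in> B. c b \<noteq> \<zero>\<^bsub>R\<^esub>} \<and>
        x = (\<Oplus>\<^bsub>M\<^esub>b\<in>{b \<in> B. c b \<noteq> \<zero>\<^bsub>R\<^esub>}. c b \<odot>\<^bsub>M\<^esub> b))"

definition free_module :: "('r, 'c) ring_scheme \<Rightarrow> ('r, 'm) module \<Rightarrow> bool" where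
  "free_module R M \<longleftrightarrow> left_module R M \<and> (\<exists>B. is_basis R M B)"

definition fg_free_module :: "('r, 'c) ring_scheme \<Rightarrow> ('r, 'm) module \<Rightarrow> bool" where
  "fg_free_module R M \<longleftrightarrow> left_module R M \<and> (\<exists>B. finite B \<and> is_basis R M B)"

text \<open>
  A module is projective if it is a direct summand (equivalently, a retract) of a free module.
  There is no loss in taking the free module on the type \<^typ>\<open>'m \<Rightarrow> 'r\<close>: it contains the free
  module on the set \<open>carrier M\<close>, and \<open>M\<close> is a retract of some free module if and only if the
  canonical surjection from that one splits.
\<close>

definition projective_module :: "('r, 'c) ring_scheme \<Rightarrow> ('r, 'm) module \<Rightarrow> bool" where
  "projective_module R M \<longleftrightarrow>
     left_module R M \<and>
     (\<exists>(L :: ('r, 'm \<Rightarrow> 'r) module) \<iota> \<pi>.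
        free_module R L \<and> \<iota> \<in> left_module_hom R M L \<and> \<pi> \<in> left_module_hom R L M \<and>
        (\<forall>x\<in>carrier M. \<pi> (\<iota> x) = x))"

text \<open>
  \<open>resolution R F d \<epsilon> M\<close> says that
  \<open>\<dots> \<rightarrow> F 2 \<rightarrow> F 1 \<rightarrow> F 0 \<rightarrow> M \<rightarrow> 0\<close>
  is exact, where \<open>d i\<close> maps \<open>F (Suc i)\<close> to \<open>F i\<close> and \<open>\<epsilon>\<close> maps \<open>F 0\<close> to \<open>M\<close>.
  It has length at most \<open>n\<close> if \<open>F i\<close> is zero for all \<open>i > n\<close>.
\<close>

definition resolution ::
    "('r, 'c) ring_scheme \<Rightarrow> (nat \<Rightarrow> ('r, 'f) module) \<Rightarrow> (nat \<Rightarrow> 'f \<Rightarrow> 'f) \<Rightarrow>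
     ('f \<Rightarrow> 'm) \<Rightarrow> ('r, 'm) module \<Rightarrow> bool" where
  "resolution R F d \<epsilon> M \<longleftrightarrow>
     left_module R M \<and> (\<forall>i. left_module R (F i)) \<and>
     (\<forall>i. d i \<in> left_module_hom R (F (Suc i)) (F i)) \<and>
     \<epsilon> \<in> left_module_hom R (F 0) M \<and>
     \<epsilon> ` carrier (F 0) = carrier M \<and>
     d 0 ` carrier (F 1) = {x \<in> carrier (F 0). \<epsilon> x = \<zero>\<^bsub>M\<^esub>} \<and>
     (\<forall>i. d (Suc i) ` carrier (F (Suc (Suc i))) =
        {x \<in> carrier (F (Suc i)). d i x = \<zero>\<^bsub>F i\<^esub>})"

definition length_at_most :: "(nat \<Rightarrow> ('r, 'f) module) \<Rightarrow> nat \<Rightarrow> bool" where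
  "length_at_most F n \<longleftrightarrow> (\<forall>i>n. carrier (F i) = {\<zero>\<^bsub>F i\<^esub>})"

definition projective_resolution ::
    "('r, 'c) ring_scheme \<Rightarrow> (nat \<Rightarrow> ('r, 'f) module) \<Rightarrow> (nat \<Rightarrow> 'f \<Rightarrow> 'f) \<Rightarrow>
     ('f \<Rightarrow> 'm) \<Rightarrow> ('r, 'm) module \<Rightarrow> bool" where
  "projective_resolution R F d \<epsilon> M \<longleftrightarrow>
     resolution R F d \<epsilon> M \<and> (\<forall>i. projective_module R (F i))"


section \<open>The integral group ring\<close>

text \<open>
  The additive group of \<open>\<int>G\<close> is the free abelian group on \<open>carrier G\<close>, and its multiplication
  is the biadditive extension of the multiplication of \<open>G\<close>.
\<close>

definition group_ring :: "('g, 'b) monoid_scheme \<Rightarrow> ('g \<Rightarrow>\<^sub>0 int) ring" where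
  "group_ring G =
     \<lparr>carrier = {a. Poly_Mapping.keys a \<subseteq> carrier G},
      monoid.mult = (\<lambda>a b. frag_extend (\<lambda>g. frag_extend (\<lambda>h. frag_of (g \<otimes>\<^bsub>G\<^esub> h)) b) a),
      monoid.one = frag_of \<one>\<^bsub>G\<^esub>,
      ring.zero = 0,
      ring.add = (+)\<rparr>"

text \<open>The trivial module \<open>\<int>\<close>: the group ring acts through the augmentation map.\<close>

definition trivial_module :: "('g \<Rightarrow>\<^sub>0 int, int) module" where
  "trivial_module =
     \<lparr>carrier = UNIV, monoid.mult = (*), monoid.one = 1, ring.zero = 0, ring.add = (+),
      smult = (\<lambda>a n. (\<Sum>g\<in>Poly_Mapping.keys a. Poly_Mapping.lookup a g) * n)\<rparr>"

text \<open>
  HOL has no quantification over types, so the modules in the existentially quantified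
  resolutions below live on one fixed type. It is large enough to represent every finitely
  generated free module and all terms of the bar resolution of \<open>\<int>\<close> together with their
  submodules. Hence (by Schanuel's lemma, applied to the syzygies of the bar resolution) neither
  definition depends on this choice.
\<close>

type_synonym 'g bar = "'g list \<Rightarrow> ('g \<Rightarrow>\<^sub>0 int)"

definition type_FL :: "('g, 'b) monoid_scheme \<Rightarrow> bool" where
  "type_FL G \<longleftrightarrow>
     (\<exists>(F :: nat \<Rightarrow> ('g \<Rightarrow>\<^sub>0 int, 'g bar) module) d \<epsilon> n.
        resolution (group_ring G) F d \<epsilon> trivial_module \<and>
        (\<forall>i. fg_free_module (group_ring G) (F i)) \<and>
        length_at_most F n)"

text \<open>The infimum of the empty set is \<open>\<infinity>\<close>.\<close>

definition cohomological_dimension :: "('g, 'b) monoid_scheme \<Rightarrow> enat" where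
  "cohomological_dimension G =
     Inf {enat n | n. \<exists>(F :: nat \<Rightarrow> ('g \<Rightarrow>\<^sub>0 int, 'g bar) module) d \<epsilon>.
        projective_resolution (group_ring G) F d \<epsilon> trivial_module \<and> length_at_most F n}"


section \<open>Homology and cohomology of groups\<close>

text \<open>Homology of a chain complex with \<open>d i : C (Suc i) \<rightarrow> C i\<close>, where the term in degree \<open>-1\<close> is zero.\<close>

definition chain_homology ::
    "(nat \<Rightarrow> 'a monoid) \<Rightarrow> (nat \<Rightarrow> 'a \<Rightarrow> 'a) \<Rightarrow> nat \<Rightarrow> 'a set monoid" where
  "chain_homology C d i =
     (C i)\<lparr>carrier := (case i of 0 \<Rightarrow> carrier (C 0) | Suc j \<Rightarrow> kernel (C i) (C j) (d j))\<rparr>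
       Mod (d i ` carrier (C (Suc i)))"

definition cochain_cohomology ::
    "(nat \<Rightarrow> 'a monoid) \<Rightarrow> (nat \<Rightarrow> 'a \<Rightarrow> 'a) \<Rightarrow> nat \<Rightarrow> 'a set monoid" where
  "cochain_cohomology C \<delta> i =
     (C i)\<lparr>carrier := kernel (C i) (C (Suc i)) (\<delta> i)\<rparr>
       Mod (case i of 0 \<Rightarrow> {\<one>\<^bsub>C 0\<^esub>} | Suc j \<Rightarrow> \<delta> j ` carrier (C j))"

text \<open>
  The tensor product \<open>A \<otimes>\<^bsub>\<int>G\<^esub> M\<close> of two left modules, \<open>A\<close> being regarded as a right module by
  \<open>x g = g\<inverse> x\<close>: the quotient of the free abelian group on \<open>A \<times> M\<close> by the biadditivity
  relations and by \<open>x g \<otimes> m = x \<otimes> g m\<close>. Balancedness over \<open>G\<close> suffices as \<open>G\<close> spans \<open>\<int>G\<close>.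
\<close>

definition tensor_relations ::
    "('g, 'b) monoid_scheme \<Rightarrow> ('g \<Rightarrow>\<^sub>0 int, 'a) module \<Rightarrow> ('g \<Rightarrow>\<^sub>0 int, 'm) module \<Rightarrow>
     ('a \<times> 'm \<Rightarrow>\<^sub>0 int) set" where
  "tensor_relations G A M =
     generate (free_Abelian_group (carrier A \<times> carrier M))
      ({frag_of (x \<oplus>\<^bsub>A\<^esub> y, m) - frag_of (x, m) - frag_of (y, m) | x y m.
          x \<in> carrier A \<and> y \<in> carrier A \<and> m \<in> carrier M} \<union>
       {frag_of (x, m \<oplus>\<^bsub>M\<^esub> n) - frag_of (x, m) - frag_of (x, n) | x m n.
          x \<in> carrier A \<and> m \<in> carrier M \<and> n \<in> carrier M} \<union>
       {frag_of (frag_of (inv\<^bsub>G\<^esub> g) \<odot>\<^bsub>A\<^esub> x, m) - frag_of (x, frag_of g \<odot>\<^bsub>M\<^esub> m) | g x m.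
          g \<in> carrier G \<and> x \<in> carrier A \<and> m \<in> carrier M})"

definition tensor ::
    "('g, 'b) monoid_scheme \<Rightarrow> ('g \<Rightarrow>\<^sub>0 int, 'a) module \<Rightarrow> ('g \<Rightarrow>\<^sub>0 int, 'm) module \<Rightarrow>
     ('a \<times> 'm \<Rightarrow>\<^sub>0 int) set monoid" where
  "tensor G A M =
     free_Abelian_group (carrier A \<times> carrier M) Mod tensor_relations G A M"

text \<open>
  The map \<open>f \<otimes> id : A \<otimes> M \<rightarrow> B \<otimes> M\<close>. For a module homomorphism \<open>f : A \<rightarrow> B\<close>, all cosets in the
  union coincide.
\<close>

definition tensor_map ::
    "('g, 'b) monoid_scheme \<Rightarrow> ('g \<Rightarrow>\<^sub>0 int, 'a) module \<Rightarrow> ('g \<Rightarrow>\<^sub>0 int, 'm) module \<Rightarrow> ('c \<Rightarrow> 'a) \<Rightarrow>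
     ('c \<times> 'm \<Rightarrow>\<^sub>0 int) set \<Rightarrow> ('a \<times> 'm \<Rightarrow>\<^sub>0 int) set" where
  "tensor_map G B M f U =
     (\<Union>u\<in>U. tensor_relations G B M
        #>\<^bsub>free_Abelian_group (carrier B \<times> carrier M)\<^esub> frag_extend (\<lambda>(x, m). frag_of (f x, m)) u)"

text \<open>
  The group \<open>Hom\<^bsub>R\<^esub>(A, M)\<close> under pointwise addition. Its elements are extensional so that
  homomorphisms agreeing on \<open>carrier A\<close> are equal.
\<close>

definition hom_group ::
    "('r, 'c) ring_scheme \<Rightarrow> ('r, 'a) module \<Rightarrow> ('r, 'm) module \<Rightarrow> ('a \<Rightarrow> 'm) monoid" where
  "hom_group R A M =
     \<lparr>carrier = left_module_hom R A M \<inter> extensional (carrier A),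
      monoid.mult = (\<lambda>f g. \<lambda>x\<in>carrier A. f x \<oplus>\<^bsub>M\<^esub> g x),
      monoid.one = (\<lambda>x\<in>carrier A. \<zero>\<^bsub>M\<^esub>)\<rparr>"

text \<open>
  \<open>H\<^sub>i(G, M) = H\<^sub>i(F \<otimes>\<^bsub>\<int>G\<^esub> M)\<close> and \<open>H\<^sup>i(G, M) = H\<^sup>i(Hom\<^bsub>\<int>G\<^esub>(F, M))\<close>, computed from a projective
  resolution \<open>(F, d)\<close> of the trivial module. Different resolutions yield isomorphic groups.
\<close>

definition group_homology ::
    "('g, 'b) monoid_scheme \<Rightarrow> (nat \<Rightarrow> ('g \<Rightarrow>\<^sub>0 int, 'f) module) \<Rightarrow> (nat \<Rightarrow> 'f \<Rightarrow> 'f) \<Rightarrow>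
     ('g \<Rightarrow>\<^sub>0 int, 'm) module \<Rightarrow> nat \<Rightarrow> ('f \<times> 'm \<Rightarrow>\<^sub>0 int) set set monoid" where
  "group_homology G F d M =
     chain_homology (\<lambda>i. tensor G (F i) M) (\<lambda>i. tensor_map G (F i) M (d i))"

definition group_cohomology ::
    "('g, 'b) monoid_scheme \<Rightarrow> (nat \<Rightarrow> ('g \<Rightarrow>\<^sub>0 int, 'f) module) \<Rightarrow> (nat \<Rightarrow> 'f \<Rightarrow> 'f) \<Rightarrow>
     ('g \<Rightarrow>\<^sub>0 int, 'm) module \<Rightarrow> nat \<Rightarrow> ('f \<Rightarrow> 'm) set monoid" where
  "group_cohomology G F d M =
     cochain_cohomology (\<lambda>i. hom_group (group_ring G) (F i) M)
       (\<lambda>i f. compose (carrier (F (Suc i))) f (d i))"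

end

theory Submission
  imports Defs "HOL-Library.Sublist"
begin

text \<open>
  Order \<open>G\<close> by \<open>x \<preceq> y \<longleftrightarrow> y \<in> x P\<close>. By (a) this is a left invariant partial order with binary joins.
  Let \<open>\<Delta>\<close> be the join of \<open>\<Sigma>\<close>. By (b), joining with a further generator moves an element by at most one
  generator, and by (c) this happens injectively. It follows that conjugation by \<open>\<Delta>\<close> permutes \<open>\<Sigma>\<close>,
  so that \<open>G\<close> is the increasing union of the sets \<open>\<Delta>\<^sup>-\<^sup>m P\<close>, and that strictly increasing chains from
  \<open>\<one>\<close> to \<open>\<Delta>\<close> have at most \<open>|\<Sigma>|\<close> steps, as every step captures a new generator below it.

  Consider the simplicial complex of finite chains \<open>g\<^sub>0 \<prec> \<dots> \<prec> g\<^sub>k\<close> in \<open>G\<close> with \<open>g\<^sub>k \<preceq> g\<^sub>0 \<Delta>\<close>. The group \<open>G\<close>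
  acts freely on its simplices with finitely many orbits, and its dimension is at most \<open>|\<Sigma>|\<close>. It is
  acyclic: the map \<open>x \<mapsto> x \<or> \<Delta>\<close> retracts the part with vertices in \<open>P\<close> onto the part with vertices in
  \<open>\<Delta> P\<close>, so that a cycle with vertices between \<open>\<one>\<close> and \<open>\<Delta>\<^sup>m\<close> is eventually pushed into a single vertex. Its
  chain complex is the required resolution. Comparing any projective resolution of \<open>\<int>\<close> with this one
  gives a contraction in degrees above \<open>|\<Sigma>|\<close>, which survives tensoring with \<open>M\<close> and mapping into \<open>M\<close>.
\<close>

section \<open>Joins in the group\<close>

text \<open>The order is left invariant, whereas the width condition
  \<open>g_k \<preceq> g_0 \<otimes> \<Delta>\<close> multiplies on the right. That condition cannot
  be dropped: all finite chains of a directed order also form an acyclic complex, but one of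
  unbounded dimension; with it, a chain translated to start at \<open>\<one>\<close> has all its
  vertices between \<open>\<one>\<close> and \<Delta>. The push
  \<open>x \<curlyvee> \<Delta>\<close> respects it only because right multiplication by \<Delta> is
  monotone, which amounts to conjugation by \<Delta> preserving \<open>P\<close>. This is the reason
  why the conjugation argument precedes all topology. A second obstacle is that the push may
  identify vertices, so that images and prisms contain degenerate simplices. Chains are therefore
  computed with arbitrary lists, and degenerate lists are discarded afterwards. The empty list is
  kept as a simplex of dimension -1. The boundary thereby includes the augmentation, and one
  acyclicity statement covers every degree of the resolution.\<close>

locale lattice_submonoid = group G for G (structure) +
  fixes P \<Sigma> :: "'a set"
  assumes submonoid_P: "submonoid P G"
    and finite_\<Sigma>: "finite \<Sigma>"
    and generated: "P = monoid_generated G \<Sigma>"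
    and lattice: "left_quasi_lattice_ordered G P"
    and fractions: "group_of_right_fractions G P"
    and join_step: "\<And>x y z s. \<lbrakk>x \<in> carrier G; y \<in> carrier G; z \<in> carrier G;
          (x <# P) \<inter> (y <# P) = z <# P; s \<in> \<Sigma>\<rbrakk>
        \<Longrightarrow> ((x \<otimes> s) <# P) \<inter> (y <# P) = z <# P \<or>
            (\<exists>t\<in>\<Sigma>. ((x \<otimes> s) <# P) \<inter> (y <# P) = (z \<otimes> t) <# P)"
    and independent: "\<And>F s. \<lbrakk>finite F; F \<subseteq> \<Sigma>; s \<in> \<Sigma> - F\<rbrakk>
        \<Longrightarrow> (s <# P) \<inter> (P \<inter> (\<Inter>t\<in>F. t <# P)) \<subset> P \<inter> (\<Inter>t\<in>F. t <# P)"
begin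

section \<open>The left invariant order and its up-sets\<close>

definition le :: "'a \<Rightarrow> 'a \<Rightarrow> bool" (infix "\<preceq>" 50) where
  "x \<preceq> y \<longleftrightarrow> x \<in> carrier G \<and> y \<in> carrier G \<and> inv x \<otimes> y \<in> P"

lemma P_carrier: "p \<in> P \<Longrightarrow> p \<in> carrier G"
  using submonoid.subset[OF submonoid_P] by blast

lemma one_P: "\<one> \<in> P"
  using submonoid.one_closed[OF submonoid_P] .

lemma mult_P: "p \<in> P \<Longrightarrow> q \<in> P \<Longrightarrow> p \<otimes> q \<in> P"
  using submonoid.m_closed[OF submonoid_P] .

lemma pow_P: "p \<in> P \<Longrightarrow> p [^] (n::nat) \<in> P"
  by (induction n) (auto intro: one_P mult_P)

lemma \<Sigma>_P: "s \<in> \<Sigma> \<Longrightarrow> s \<in> P"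
  unfolding generated monoid_generated_def by blast

lemma le_carrier: "x \<preceq> y \<Longrightarrow> x \<in> carrier G" "x \<preceq> y \<Longrightarrow> y \<in> carrier G"
  by (auto simp: le_def)

lemma le_refl: "x \<in> carrier G \<Longrightarrow> x \<preceq> x"
  by (simp add: le_def one_P)

lemma le_trans: assumes "x \<preceq> y" "y \<preceq> z" shows "x \<preceq> z"
proof -
  have "(inv x \<otimes> y) \<otimes> (inv y \<otimes> z) \<in> P" using assms by (auto simp: le_def intro: mult_P)
  moreover have "(inv x \<otimes> y) \<otimes> (inv y \<otimes> z) = inv x \<otimes> z"
    using assms by (metis le_def inv_closed inv_solve_left m_assoc m_closed)
  ultimately show ?thesis using assms by (simp add: le_def)
qed

lemma le_antisym: assumes "x \<preceq> y" "y \<preceq> x" shows "x = y"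
proof -
  let ?p = "inv x \<otimes> y" and ?q = "inv y \<otimes> x"
  have c: "x \<in> carrier G" "y \<in> carrier G" using assms by (auto simp: le_def)
  have "?q = inv ?p" using c by (simp add: inv_mult_group)
  hence "?p \<otimes> ?q = \<one>" "?q \<otimes> ?p = \<one>" using c by auto
  hence "?p \<in> Units (G\<lparr>carrier := P\<rparr>)" using assms by (auto simp: Units_def le_def)
  hence "?p = \<one>" using lattice unfolding left_quasi_lattice_ordered_def by blast
  hence "x \<otimes> (inv x \<otimes> y) = x" using c by simp
  thus ?thesis using c by (simp add: m_assoc[symmetric])
qed

lemma le_translate:
  assumes "g \<in> carrier G" "x \<preceq> y" shows "g \<otimes> x \<preceq> g \<otimes> y"
proof -
  have "inv (g \<otimes> x) \<otimes> (g \<otimes> y) = inv x \<otimes> y"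
    using assms by (simp add: le_def inv_mult_group m_assoc[symmetric])
      (simp add: m_assoc)
  thus ?thesis using assms by (simp add: le_def)
qed

lemma le_translate_iff:
  assumes "g \<in> carrier G" "x \<in> carrier G" "y \<in> carrier G" shows "g \<otimes> x \<preceq> g \<otimes> y \<longleftrightarrow> x \<preceq> y"
  using le_translate[of g x y] le_translate[of "inv g" "g \<otimes> x" "g \<otimes> y"] assms
  by (auto simp: m_assoc[symmetric])

lemma le_mult_iff: "x \<in> carrier G \<Longrightarrow> y \<in> carrier G \<Longrightarrow> x \<preceq> x \<otimes> y \<longleftrightarrow> y \<in> P"
  by (simp add: le_def m_assoc[symmetric])

lemma one_le_iff: "\<one> \<preceq> x \<longleftrightarrow> x \<in> P"
  by (auto simp: le_def P_carrier)

lemma leE: assumes "x \<preceq> y" obtains p where "p \<in> P" "y = x \<otimes> p"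
proof
  show "inv x \<otimes> y \<in> P" "y = x \<otimes> (inv x \<otimes> y)" using assms by (auto simp: le_def m_assoc[symmetric])
qed

lemma le_multI: "x \<in> carrier G \<Longrightarrow> p \<in> P \<Longrightarrow> x \<preceq> x \<otimes> p"
  by (simp add: le_mult_iff P_carrier)

lemma coset_eq_up: "x \<in> carrier G \<Longrightarrow> x <# P = {y. x \<preceq> y}"
  by (auto simp: l_coset_def P_carrier le_multI elim: leE)

text \<open>The dictionary between cosets and order: the right-hand side is the universal property
  of a least upper bound. Conditions (a) and (b) are read through it.\<close>

lemma coset_Int_eq_iff:
  assumes "x \<in> carrier G" "y \<in> carrier G" "z \<in> carrier G"
  shows "(x <# P) \<inter> (y <# P) = z <# P \<longleftrightarrow> (\<forall>w. x \<preceq> w \<and> y \<preceq> w \<longleftrightarrow> z \<preceq> w)"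
  using assms by (auto simp: coset_eq_up set_eq_iff)

lemma fraction_decomposition:
  assumes "x \<in> carrier G" obtains p q where "p \<in> P" "q \<in> P" "x = p \<otimes> inv q"
  using assms fractions unfolding group_of_right_fractions_def by blast

text \<open>Writing \<open>inv x \<otimes> y\<close> as a right fraction
  \<open>p \<otimes> inv q\<close> produces the common multiple
  \<open>x \<otimes> p = y \<otimes> q\<close>. This rules out the disjoint case of the
  quasi-lattice condition.\<close>

lemma upper_bound_exists:
  assumes "x \<in> carrier G" "y \<in> carrier G"
  obtains w where "x \<preceq> w" "y \<preceq> w"
proof -
  obtain p q where pq: "p \<in> P" "q \<in> P" "inv x \<otimes> y = p \<otimes> inv q"
    using fraction_decomposition[of "inv x \<otimes> y"] assms by auto
  have "y \<otimes> q = x \<otimes> (inv x \<otimes> y) \<otimes> q" using assms pq(2) by (simp add: m_assoc[symmetric])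
  also have "\<dots> = x \<otimes> p" using assms pq by (simp add: m_assoc P_carrier)
  finally have "x \<preceq> x \<otimes> p" "y \<preceq> x \<otimes> p" using assms pq le_multI by metis+
  thus ?thesis by (rule that)
qed

lemma join_exists:
  assumes "x \<in> carrier G" "y \<in> carrier G"
  shows "\<exists>z. \<forall>w. x \<preceq> w \<and> y \<preceq> w \<longleftrightarrow> z \<preceq> w"
proof -
  obtain w where "x \<preceq> w" "y \<preceq> w" using upper_bound_exists[OF assms] .
  hence "(x <# P) \<inter> (y <# P) \<noteq> {}" using assms by (auto simp: coset_eq_up)
  then obtain z where z: "z \<in> carrier G" "(x <# P) \<inter> (y <# P) = z <# P"
    using lattice assms unfolding left_quasi_lattice_ordered_def by blast
  thus ?thesis using coset_Int_eq_iff[of x y z] assms by blast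
qed

section \<open>Joins, and conditions (b) and (c) in terms of the order\<close>

definition join :: "'a \<Rightarrow> 'a \<Rightarrow> 'a" (infixl "\<curlyvee>" 65) where
  "x \<curlyvee> y = (SOME z. \<forall>w. x \<preceq> w \<and> y \<preceq> w \<longleftrightarrow> z \<preceq> w)"

lemma join_le_iff:
  assumes "x \<in> carrier G" "y \<in> carrier G"
  shows "x \<curlyvee> y \<preceq> w \<longleftrightarrow> x \<preceq> w \<and> y \<preceq> w"
  using someI_ex[OF join_exists[OF assms]] unfolding join_def by blast

text \<open>Some \<open>w\<close> lies above both elements, hence above the join, and
  \<open>\<preceq>\<close> relates elements of the group only.\<close>

lemma join_closed:
  assumes "x \<in> carrier G" "y \<in> carrier G" shows "x \<curlyvee> y \<in> carrier G"
proof -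
  obtain w where "x \<preceq> w" "y \<preceq> w" using upper_bound_exists[OF assms] .
  hence "x \<curlyvee> y \<preceq> w" using join_le_iff[OF assms] by blast
  thus ?thesis by (rule le_carrier)
qed

lemma join_upper:
  assumes "x \<in> carrier G" "y \<in> carrier G" shows "x \<preceq> x \<curlyvee> y" "y \<preceq> x \<curlyvee> y"
  using join_le_iff[OF assms, of "x \<curlyvee> y"] le_refl join_closed[OF assms] by auto

lemma join_least: "x \<preceq> w \<Longrightarrow> y \<preceq> w \<Longrightarrow> x \<curlyvee> y \<preceq> w"
  using join_le_iff le_carrier by blast

lemma join_absorb: "x \<preceq> y \<Longrightarrow> x \<curlyvee> y = y"
  by (meson join_least join_upper le_antisym le_carrier le_refl)

lemma join_mono: "x \<preceq> x' \<Longrightarrow> y \<preceq> y' \<Longrightarrow> x \<curlyvee> y \<preceq> x' \<curlyvee> y'"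
  by (meson join_least join_upper le_trans le_carrier)

text \<open>Condition (b) with \<open>\<one>\<close> and \<open>x\<close> for its two elements: as
  \<open>x\<close> lies in \<open>P\<close>, the coset of \<open>x\<close> is contained in that of
  \<open>\<one>\<close>, so the intersection is generated by \<open>x\<close> itself.\<close>

lemma generator_join:
  assumes "x \<in> P" "s \<in> \<Sigma>"
  shows "s \<curlyvee> x = x \<or> (\<exists>t\<in>\<Sigma>. s \<curlyvee> x = x \<otimes> t)"
proof -
  have c: "x \<in> carrier G" "s \<in> carrier G" using assms \<Sigma>_P P_carrier by auto
  have "(\<one> <# P) \<inter> (x <# P) = x <# P"
    using c assms coset_Int_eq_iff[of \<one> x x] le_trans[of \<one> x] one_le_iff by auto
  from join_step[OF _ _ _ this assms(2)] c
  consider "(s <# P) \<inter> (x <# P) = x <# P" | t where "t \<in> \<Sigma>" "(s <# P) \<inter> (x <# P) = (x \<otimes> t) <# P"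
    by auto
  thus ?thesis
  proof cases
    case 1
    hence "s \<preceq> x" using coset_Int_eq_iff[of s x x] c le_refl by blast
    thus ?thesis using join_absorb by blast
  next
    case (2 t)
    have tc: "t \<in> carrier G" using 2 \<Sigma>_P P_carrier by auto
    have "\<forall>w. s \<preceq> w \<and> x \<preceq> w \<longleftrightarrow> x \<otimes> t \<preceq> w" using 2 coset_Int_eq_iff[of s x "x \<otimes> t"] c tc by blast
    hence "\<forall>w. s \<curlyvee> x \<preceq> w \<longleftrightarrow> x \<otimes> t \<preceq> w" using join_le_iff c by blast
    hence "s \<curlyvee> x = x \<otimes> t" by (meson le_antisym le_refl join_closed c tc m_closed)
    thus ?thesis using 2 by blast
  qed
qed

text \<open>The contrapositive of (c), since the intersection there consists of the upper bounds of
  \<open>F\<close> in \<open>P\<close>. With a well-chosen \<open>F\<close> it converts an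
  inequality between joins into a membership.\<close>

lemma generator_independent:
  assumes "F \<subseteq> \<Sigma>" "s \<in> \<Sigma>" "\<And>p. \<lbrakk>p \<in> P; \<And>t. t \<in> F \<Longrightarrow> t \<preceq> p\<rbrakk> \<Longrightarrow> s \<preceq> p"
  shows "s \<in> F"
proof (rule ccontr)
  assume "s \<notin> F"
  hence "(s <# P) \<inter> (P \<inter> (\<Inter>t\<in>F. t <# P)) \<subset> P \<inter> (\<Inter>t\<in>F. t <# P)"
    using independent[of F s] assms finite_subset[OF _ finite_\<Sigma>] by blast
  then obtain p where "p \<in> P" "\<And>t. t \<in> F \<Longrightarrow> p \<in> t <# P" "p \<notin> s <# P" by blast
  moreover have "t \<in> carrier G" if "t \<in> \<Sigma>" for t using that \<Sigma>_P P_carrier by auto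
  ultimately show False using assms by (auto simp: coset_eq_up subset_iff)
qed

text \<open>\<open>Q\<close> itself need not be closed under products. The elements of
  \<open>P\<close> whose right multiplication preserves \<open>Q\<close> on \<open>P\<close> do form
  a submonoid, and it contains \<Sigma>.\<close>

lemma P_induct [consumes 1, case_names one mult]:
  assumes "p \<in> P" "Q \<one>" "\<And>p s. \<lbrakk>p \<in> P; Q p; s \<in> \<Sigma>\<rbrakk> \<Longrightarrow> Q (p \<otimes> s)"
  shows "Q p"
proof -
  let ?H = "{p \<in> P. \<forall>q\<in>P. Q q \<longrightarrow> Q (q \<otimes> p)}"
  have "submonoid ?H G"
    by unfold_locales (auto simp: P_carrier mult_P one_P m_assoc[symmetric])
  moreover have "\<Sigma> \<subseteq> ?H" using assms \<Sigma>_P by auto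
  ultimately have "P \<subseteq> ?H" by (subst generated) (auto simp: monoid_generated_def)
  hence "Q (\<one> \<otimes> p)" using assms one_P by blast
  thus ?thesis using P_carrier assms by simp
qed

lemma generator_below:
  assumes "p \<in> P" "p \<noteq> \<one>" shows "\<exists>t\<in>\<Sigma>. t \<preceq> p"
  using assms
proof (induction rule: P_induct)
  case (mult p s)
  show ?case
  proof (cases "p = \<one>")
    case True
    thus ?thesis using mult \<Sigma>_P P_carrier le_refl by auto
  next
    case False
    then obtain t where "t \<in> \<Sigma>" "t \<preceq> p" using mult by blast
    moreover have "p \<preceq> p \<otimes> s" using mult \<Sigma>_P P_carrier le_multI by auto
    ultimately show ?thesis using le_trans by blast
  qed
qed auto

text \<open>The conjunct \<open>w \<in> P\<close>, which means \<open>\<one> \<preceq> w\<close>,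
  makes the empty set fit in, with \<open>d = \<one>\<close>.\<close>

lemma finite_join_exists:
  assumes "finite F" "F \<subseteq> P"
  shows "\<exists>d\<in>P. \<forall>w. d \<preceq> w \<longleftrightarrow> w \<in> P \<and> (\<forall>s\<in>F. s \<preceq> w)"
  using assms
proof (induction F rule: finite_induct)
  case empty
  thus ?case using one_le_iff one_P by auto
next
  case (insert s F)
  then obtain d where d: "d \<in> P" "\<forall>w. d \<preceq> w \<longleftrightarrow> w \<in> P \<and> (\<forall>s\<in>F. s \<preceq> w)" by auto
  have "\<one> \<preceq> s \<curlyvee> d" using insert d join_upper(2) le_trans one_le_iff P_carrier by (meson insert_subset)
  moreover have "\<forall>w. s \<curlyvee> d \<preceq> w \<longleftrightarrow> s \<preceq> w \<and> d \<preceq> w" using join_le_iff insert d P_carrier by auto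
  ultimately show ?case using d one_le_iff by (intro bexI[of _ "s \<curlyvee> d"]) auto
qed

section \<open>The Garside-like element \<Delta> and conjugation by it\<close>

definition \<Delta> :: 'a where
  "\<Delta> = (SOME d. d \<in> P \<and> (\<forall>w. d \<preceq> w \<longleftrightarrow> w \<in> P \<and> (\<forall>s\<in>\<Sigma>. s \<preceq> w)))"

lemma \<Delta>_spec: "\<Delta> \<in> P \<and> (\<forall>w. \<Delta> \<preceq> w \<longleftrightarrow> w \<in> P \<and> (\<forall>s\<in>\<Sigma>. s \<preceq> w))"
  unfolding \<Delta>_def
  by (rule someI_ex) (use finite_join_exists[OF finite_\<Sigma>] \<Sigma>_P in blast)

lemma \<Delta>_P: "\<Delta> \<in> P" and \<Delta>_le_iff: "\<Delta> \<preceq> w \<longleftrightarrow> w \<in> P \<and> (\<forall>s\<in>\<Sigma>. s \<preceq> w)"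
  using \<Delta>_spec by auto

lemma \<Delta>_carrier [simp]: "\<Delta> \<in> carrier G" using \<Delta>_P P_carrier by auto

lemma generator_le_\<Delta>: "s \<in> \<Sigma> \<Longrightarrow> s \<preceq> \<Delta>"
  using \<Delta>_le_iff[of \<Delta>] le_refl by auto

lemma one_notin_\<Sigma>: "\<one> \<notin> \<Sigma>"
  using generator_independent[of "{}" \<one>] by (auto simp: one_le_iff)

text \<open>Independence with \<open>F = {t}\<close>: whatever lies above \<open>t\<close> lies
  above \<open>s\<close>.\<close>

lemma generator_le_generator: "s \<in> \<Sigma> \<Longrightarrow> t \<in> \<Sigma> \<Longrightarrow> s \<preceq> t \<Longrightarrow> s = t"
  using generator_independent[of "{t}" s] le_trans by auto

text \<open>For each generator \<open>t\<close>, (b) gives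
  \<open>t \<curlyvee> s = s \<otimes> u\<close> with \<open>u\<close> trivial or a generator. In
  both cases \<open>u \<preceq> \<Delta>\<close>, so
  \<open>t \<preceq> s \<otimes> \<Delta>\<close>. It follows that conjugation by \<Delta> takes
  \<open>s\<close> into \<open>P\<close>.\<close>

lemma \<Delta>_le_generator_mult:
  assumes "s \<in> \<Sigma>" shows "\<Delta> \<preceq> s \<otimes> \<Delta>"
proof -
  have sc: "s \<in> carrier G" "s \<in> P" using assms \<Sigma>_P P_carrier by auto
  have "t \<preceq> s \<otimes> \<Delta>" if t: "t \<in> \<Sigma>" for t
  proof -
    have tc: "t \<in> carrier G" using t \<Sigma>_P P_carrier by auto
    obtain u where u: "t \<curlyvee> s = s \<otimes> u" "u \<preceq> \<Delta>"
      using generator_join[OF sc(2) t]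
    proof
      assume "t \<curlyvee> s = s"
      thus ?thesis using that[of \<one>] sc one_le_iff \<Delta>_P by auto
    next
      assume "\<exists>u\<in>\<Sigma>. t \<curlyvee> s = s \<otimes> u"
      thus ?thesis using that generator_le_\<Delta> by blast
    qed
    have "t \<preceq> s \<otimes> u" using join_upper(1)[OF tc sc(1)] u by simp
    thus ?thesis using le_translate[OF sc(1) u(2)] le_trans by blast
  qed
  moreover have "s \<otimes> \<Delta> \<in> P" using sc \<Delta>_P mult_P by auto
  ultimately show ?thesis using \<Delta>_le_iff by blast
qed

text \<open>The elements \<open>s\<inverse> (t \<or> s)\<close> with \<open>t \<noteq> s\<close> are generators with join \<open>s\<inverse> \<Delta>\<close>. They miss just one
  generator \<open>u\<close>, hence a single generator leads from \<open>s\<inverse> \<Delta>\<close> to a multiple of \<open>\<Delta>\<close>.\<close>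

lemma conj_generator:
  assumes s: "s \<in> \<Sigma>" shows "inv \<Delta> \<otimes> (s \<otimes> \<Delta>) \<in> \<Sigma>"
proof -
  have sc: "s \<in> carrier G" "s \<in> P" using s \<Sigma>_P P_carrier by auto
  define r where "r t = inv s \<otimes> (t \<curlyvee> s)" for t
  have rs: "s \<otimes> r t = t \<curlyvee> s" if "t \<in> \<Sigma>" for t
    using that sc join_closed[of t s] \<Sigma>_P P_carrier by (simp add: r_def m_assoc[symmetric])
  have r\<Sigma>: "r t \<in> \<Sigma>" if t: "t \<in> \<Sigma>" "t \<noteq> s" for t
  proof -
    have tc: "t \<in> carrier G" using t \<Sigma>_P P_carrier by auto
    have "t \<curlyvee> s \<noteq> s" using generator_le_generator[OF t(1) s] t join_upper[OF tc sc(1)] by auto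
    then obtain u where u: "u \<in> \<Sigma>" "t \<curlyvee> s = s \<otimes> u" using generator_join[OF sc(2) t(1)] by blast
    hence "r t = u" using sc \<Sigma>_P P_carrier by (simp add: r_def m_assoc[symmetric])
    thus ?thesis using u by simp
  qed
  have inj: "inj_on r (\<Sigma> - {s})"
  proof
    fix t u assume tu: "t \<in> \<Sigma> - {s}" "u \<in> \<Sigma> - {s}" "r t = r u"
    hence eq: "t \<curlyvee> s = u \<curlyvee> s" using rs[of t] rs[of u] by simp
    \<comment> \<open>Since both joins with \<open>s\<close> agree, every upper bound of
      \<open>s\<close> and \<open>u\<close> is above \<open>t\<close>; (c) applies with this
      two-element set.\<close>
    have "t \<in> {s, u}"
    proof (rule generator_independent)
      fix p assume "p \<in> P" and "\<And>v. v \<in> {s,u} \<Longrightarrow> v \<preceq> p"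
      hence "u \<curlyvee> s \<preceq> p" using join_least by blast
      thus "t \<preceq> p" using eq join_upper(1)[of t s] tu \<Sigma>_P P_carrier sc le_trans by (metis DiffD1)
    qed (use tu s in auto)
    thus "t = u" using tu by auto
  qed
  define F where "F = r ` (\<Sigma> - {s})"
  have F: "F \<subseteq> \<Sigma>" using r\<Sigma> by (auto simp: F_def)
  have "card F = card \<Sigma> - 1"
    using card_image[OF inj] s finite_\<Sigma> by (simp add: F_def card_Diff_singleton)
  moreover have "card \<Sigma> > 0" using s finite_\<Sigma> card_gt_0_iff by blast
  ultimately have "card (\<Sigma> - F) = 1" using F finite_\<Sigma> by (simp add: card_Diff_subset finite_subset)
  then obtain u where u: "\<Sigma> - F = {u}" using card_1_singletonE by blast
  define E where "E = inv s \<otimes> \<Delta>"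
  have sE: "s \<otimes> E = \<Delta>" using sc by (simp add: E_def m_assoc[symmetric])
  have EP: "E \<in> P" using generator_le_\<Delta>[OF s] by (simp add: E_def le_def)
  hence Ec: "E \<in> carrier G" using P_carrier by blast
  have uc: "u \<in> \<Sigma>" "u \<in> carrier G" using u \<Sigma>_P P_carrier by auto
  have FE: "f \<preceq> E" if "f \<in> F" for f
  proof -
    obtain t where t: "t \<in> \<Sigma>" "f = r t" using \<open>f \<in> F\<close> F_def by auto
    have "s \<otimes> f \<preceq> s \<otimes> E" unfolding sE t(2) rs[OF t(1)]
      using join_least generator_le_\<Delta> s t by blast
    moreover have "f \<in> carrier G" using \<open>f \<in> F\<close> F \<Sigma>_P P_carrier by blast
    ultimately show ?thesis using le_translate_iff sc Ec by blast
  qed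
  \<comment> \<open>\<open>E\<close> is above all of \<open>F\<close>, and \<open>u\<close> is the
    only other generator. Hence \<open>u \<curlyvee> E\<close> is above \<Delta>, while (b) places
    it at most one generator beyond \<open>E\<close>.\<close>
  have "v \<preceq> u \<curlyvee> E" if "v \<in> \<Sigma>" for v
  proof (cases "v \<in> F")
    case True
    thus ?thesis using FE join_upper[OF uc(2) Ec] le_trans by blast
  next
    case False
    hence "v \<in> {u}" unfolding u[symmetric] using that by blast
    thus ?thesis using join_upper[OF uc(2) Ec] by blast
  qed
  moreover have "u \<curlyvee> E \<in> P"
    using join_upper[OF uc(2) Ec] EP le_trans one_le_iff by blast
  ultimately have "\<Delta> \<preceq> u \<curlyvee> E" using \<Delta>_le_iff by blast
  hence le: "s \<otimes> \<Delta> \<preceq> s \<otimes> (u \<curlyvee> E)" using le_translate sc by blast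
  let ?p = "inv \<Delta> \<otimes> (s \<otimes> \<Delta>)"
  have pP: "?p \<in> P" using \<Delta>_le_generator_mult[OF s] by (simp add: le_def)
  have \<Delta>p: "\<Delta> \<otimes> ?p = s \<otimes> \<Delta>" using sc by (simp add: m_assoc[symmetric])
  have p1: "?p \<noteq> \<one>"
  proof
    assume "?p = \<one>"
    hence "s \<otimes> \<Delta> = \<one> \<otimes> \<Delta>" using \<Delta>p by simp
    hence "s = \<one>" using sc using right_cancel[of \<Delta> s \<one>] by simp
    thus False using one_notin_\<Sigma> s by simp
  qed
  \<comment> \<open>A generator \<open>t\<close> below \<open>?p\<close> will meet a generator
    \<open>v\<close> above \<open>?p\<close>. Distinct generators are incomparable, so
    \<open>t\<close>, \<open>?p\<close> and \<open>v\<close> coincide.\<close>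
  obtain t where t: "t \<in> \<Sigma>" "t \<preceq> ?p" using generator_below[OF pP p1] by blast
  have tc: "t \<in> carrier G" using t \<Sigma>_P P_carrier by auto
  show ?thesis
  proof (cases "u \<curlyvee> E = E")
    case True
    hence "\<Delta> \<otimes> ?p \<preceq> \<Delta> \<otimes> \<one>" using le sE \<Delta>p by simp
    hence "?p \<preceq> \<one>" using le_translate_iff[of \<Delta> ?p \<one>] sc by simp
    hence "?p = \<one>" using le_antisym pP one_le_iff by blast
    thus ?thesis using p1 by simp
  next
    case False
    then obtain v where v: "v \<in> \<Sigma>" "u \<curlyvee> E = E \<otimes> v" using generator_join[OF EP uc(1)] by blast
    have vc: "v \<in> carrier G" using v \<Sigma>_P P_carrier by auto
    have "\<Delta> \<otimes> ?p \<preceq> \<Delta> \<otimes> v"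
      using le v sE sc Ec vc unfolding \<Delta>p by (metis m_assoc)
    hence pv: "?p \<preceq> v" using le_translate_iff[of \<Delta> ?p v] sc vc by simp
    hence "t = v" using t le_trans generator_le_generator v by blast
    hence "?p = v" using pv t le_antisym by blast
    thus ?thesis using v by simp
  qed
qed

text \<open>Conjugation is multiplicative, so generators suffice. For the opposite direction, an
  injective map of the finite set \<Sigma> into itself is onto, so every generator is the conjugate
  of a generator.\<close>

lemma conj_P:
  assumes "p \<in> P" shows "inv \<Delta> \<otimes> (p \<otimes> \<Delta>) \<in> P" "\<Delta> \<otimes> (p \<otimes> inv \<Delta>) \<in> P"
proof -
  have step: "h \<otimes> ((p \<otimes> s) \<otimes> inv h) = (h \<otimes> (p \<otimes> inv h)) \<otimes> (h \<otimes> (s \<otimes> inv h))"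
    if "h \<in> carrier G" "p \<in> carrier G" "s \<in> carrier G" for h p s
  proof -
    have "(h \<otimes> (p \<otimes> inv h)) \<otimes> (h \<otimes> (s \<otimes> inv h)) = h \<otimes> p \<otimes> (inv h \<otimes> h) \<otimes> s \<otimes> inv h"
      using that by (simp only: m_assoc m_closed inv_closed)
    thus ?thesis using that by (simp add: m_assoc)
  qed
  show "inv \<Delta> \<otimes> (p \<otimes> \<Delta>) \<in> P" using assms
  proof (induction rule: P_induct)
    case (mult p s)
    thus ?case using step[of "inv \<Delta>" p s] mult_P conj_generator[of s] \<Sigma>_P P_carrier by simp
  qed (use one_P in simp)
  let ?k = "\<lambda>s. inv \<Delta> \<otimes> (s \<otimes> \<Delta>)"
  have "?k ` \<Sigma> \<subseteq> \<Sigma>" using conj_generator by (rule image_subsetI)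
  moreover have "inj_on ?k \<Sigma>" by (rule inj_onI) (use \<Sigma>_P P_carrier in auto)
  ultimately have surj: "?k ` \<Sigma> = \<Sigma>" by (rule endo_inj_surj[OF finite_\<Sigma>])
  show "\<Delta> \<otimes> (p \<otimes> inv \<Delta>) \<in> P" using assms
  proof (induction rule: P_induct)
    case (mult p t)
    then obtain s where s: "s \<in> \<Sigma>" "t = inv \<Delta> \<otimes> (s \<otimes> \<Delta>)" using surj by blast
    hence sc: "s \<in> carrier G" using \<Sigma>_P P_carrier by auto
    have "\<Delta> \<otimes> (t \<otimes> inv \<Delta>) = (\<Delta> \<otimes> inv \<Delta>) \<otimes> s \<otimes> (\<Delta> \<otimes> inv \<Delta>)"
      unfolding s(2) using sc by (simp only: m_assoc m_closed inv_closed \<Delta>_carrier)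
    hence "\<Delta> \<otimes> (t \<otimes> inv \<Delta>) = s" using sc by simp
    thus ?case using step[of \<Delta> p t] mult mult_P s \<Sigma>_P P_carrier by simp
  qed (use one_P in simp)
qed

text \<open>Moving \<Delta> past \<open>p\<close> in \<open>x \<otimes> p \<otimes> \<Delta>\<close>
  replaces \<open>p\<close> by its conjugate, which is again in \<open>P\<close>. This is the only
  right monotonicity available for the order.\<close>

lemma le_mult_\<Delta>: assumes "x \<preceq> y" shows "x \<otimes> \<Delta> \<preceq> y \<otimes> \<Delta>"
proof -
  obtain p where p: "p \<in> P" "y = x \<otimes> p" using assms leE by blast
  have "y \<otimes> \<Delta> = (x \<otimes> \<Delta>) \<otimes> (inv \<Delta> \<otimes> (p \<otimes> \<Delta>))"
    using p assms le_carrier P_carrier by (simp add: m_assoc[symmetric]) (simp add: m_assoc)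
  thus ?thesis using le_multI conj_P p assms le_carrier by auto
qed

lemma \<Delta>_le_mult: "p \<in> P \<Longrightarrow> \<Delta> \<preceq> p \<otimes> \<Delta>"
  using le_mult_\<Delta>[of \<one> p] one_le_iff by simp

section \<open>Exhaustion of the group by powers of \<Delta>\<close>

lemma le_pow_\<Delta>: "p \<in> P \<Longrightarrow> \<exists>n::nat. p \<preceq> \<Delta> [^] n"
proof (induction rule: P_induct)
  case one
  show ?case by (rule exI[of _ 0]) (simp add: le_refl)
next
  case (mult p s)
  then obtain n where n: "p \<preceq> \<Delta> [^] (n::nat)" by blast
  have "p \<otimes> s \<preceq> p \<otimes> \<Delta>" using le_translate generator_le_\<Delta> mult P_carrier by blast
  also have "p \<otimes> \<Delta> \<preceq> \<Delta> [^] Suc n" using le_mult_\<Delta>[OF n] by simp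
  finally (le_trans) show ?case by blast
qed

lemma pow_\<Delta>_mono: "m \<le> n \<Longrightarrow> \<Delta> [^] (m::nat) \<preceq> \<Delta> [^] (n::nat)"
  using le_multI[of "\<Delta> [^] m" "\<Delta> [^] (n - m)"] by (simp add: nat_pow_mult pow_P \<Delta>_P)

lemma conj_pow_P:
  assumes "p \<in> P" shows "\<Delta> [^] (n::nat) \<otimes> (p \<otimes> inv (\<Delta> [^] n)) \<in> P"
proof (induction n)
  case (Suc n)
  have "\<Delta> [^] Suc n = \<Delta> \<otimes> \<Delta> [^] n" using nat_pow_Suc2 by simp
  hence "\<Delta> [^] Suc n \<otimes> (p \<otimes> inv (\<Delta> [^] Suc n))
      = \<Delta> \<otimes> ((\<Delta> [^] n \<otimes> (p \<otimes> inv (\<Delta> [^] n))) \<otimes> inv \<Delta>)"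
    using assms P_carrier by (simp add: inv_mult_group m_assoc del: nat_pow_Suc)
  thus ?case using Suc conj_P by simp
qed (use assms P_carrier in simp)

text \<open>For \<open>x = p \<otimes> inv q\<close>, a power of \<Delta> above \<open>q\<close> has
  the form \<open>q \<otimes> r\<close>, so \<open>inv q\<close> is \<open>r\<close> times the
  inverse of that power. Multiplying \<open>x\<close> from the left by the same power gives a
  conjugate of \<open>p \<otimes> r\<close>.\<close>

lemma pow_\<Delta>_mult_mem:
  assumes "x \<in> carrier G" shows "\<exists>n::nat. \<Delta> [^] n \<otimes> x \<in> P"
proof -
  obtain p q where pq: "p \<in> P" "q \<in> P" "x = p \<otimes> inv q" using fraction_decomposition assms by blast
  obtain n where "q \<preceq> \<Delta> [^] (n::nat)" using le_pow_\<Delta> pq by blast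
  then obtain r where r: "r \<in> P" "\<Delta> [^] n = q \<otimes> r" using leE by blast
  have c: "p \<in> carrier G" "q \<in> carrier G" "r \<in> carrier G" using pq r P_carrier by auto
  have "inv q = r \<otimes> inv (\<Delta> [^] n)" using c by (simp add: r(2) inv_mult_group m_assoc[symmetric])
  hence "\<Delta> [^] n \<otimes> x = \<Delta> [^] n \<otimes> ((p \<otimes> r) \<otimes> inv (\<Delta> [^] n))"
    using c by (simp add: pq(3) m_assoc)
  thus ?thesis using conj_pow_P[OF mult_P[OF pq(1) r(1)]] by metis
qed

lemma finite_pow_\<Delta>_mult_mem:
  assumes "finite X" "X \<subseteq> carrier G" shows "\<exists>n::nat. \<forall>x\<in>X. \<Delta> [^] n \<otimes> x \<in> P"
  using assms
proof (induction X rule: finite_induct)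
  case (insert x X)
  then obtain n m where nm: "\<forall>x\<in>X. \<Delta> [^] (n::nat) \<otimes> x \<in> P" "\<Delta> [^] (m::nat) \<otimes> x \<in> P"
    using pow_\<Delta>_mult_mem[of x] by auto
  have c: "\<And>y. y \<in> insert x X \<Longrightarrow> y \<in> carrier G" using insert by auto
  have split: "\<Delta> [^] (a + b) \<otimes> y = \<Delta> [^] a \<otimes> (\<Delta> [^] b \<otimes> y)" if "y \<in> carrier G" for a b :: nat and y
    using that by (simp add: nat_pow_mult[symmetric] m_assoc)
  have "\<Delta> [^] (m + n) \<otimes> y \<in> P" if "y \<in> X" for y
    using split[of y m n] c that nm mult_P pow_P \<Delta>_P by simp
  moreover have "\<Delta> [^] (m + n) \<otimes> x \<in> P"
    using split[of x n m] c nm mult_P pow_P \<Delta>_P by (simp add: add.commute)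
  ultimately show ?case by (intro exI[of _ "m + n"]) auto
qed auto

lemma finite_le_pow_\<Delta>:
  assumes "finite X" "X \<subseteq> P" shows "\<exists>n::nat. \<forall>x\<in>X. x \<preceq> \<Delta> [^] n"
  using assms
proof (induction X rule: finite_induct)
  case (insert x X)
  then obtain n m where "\<forall>x\<in>X. x \<preceq> \<Delta> [^] (n::nat)" "x \<preceq> \<Delta> [^] (m::nat)"
    using le_pow_\<Delta>[of x] by auto
  thus ?case using pow_\<Delta>_mono[of n "max m n"] pow_\<Delta>_mono[of m "max m n"] le_trans
    by (intro exI[of _ "max m n"]) (metis insert_iff max.cobounded1 max.cobounded2)
qed auto

section \<open>Generators below an element as a strict rank function up to \<Delta>\<close>

definition atoms :: "'a \<Rightarrow> 'a set" where "atoms x = {t \<in> \<Sigma>. t \<preceq> x}"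

text \<open>Some generator \<open>s\<close> satisfies \<open>x \<otimes> s \<preceq> y\<close>. It
  suffices that \<open>x \<otimes> s\<close> is the join of \<open>x\<close> with a generator
  \<open>t\<close>, since this \<open>t\<close> is then below \<open>y\<close> but not below
  \<open>x\<close>.\<close>

lemma atoms_psubset:
  assumes "x \<in> P" "x \<preceq> y" "x \<noteq> y" "y \<preceq> \<Delta>" shows "atoms x \<subset> atoms y"
proof -
  have xc: "x \<in> carrier G" using assms P_carrier by auto
  obtain p where p: "p \<in> P" "y = x \<otimes> p" using assms leE by blast
  have "p \<noteq> \<one>" using assms p xc by auto
  then obtain s where s: "s \<in> \<Sigma>" "s \<preceq> p" using generator_below p by blast
  have sc: "s \<in> carrier G" using s le_carrier by blast
  have xs: "x \<otimes> s \<preceq> y" using le_translate s xc p by auto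
  \<comment> \<open>Let \<open>q\<close> bound all generators \<open>u\<close> arising from joins
    with \<open>x\<close>. Then \<open>x \<otimes> q\<close> is above every generator, hence above
    \<Delta> and thus above \<open>y\<close> and \<open>x \<otimes> s\<close>. So
    \<open>s \<preceq> q\<close>, and independence applies.\<close>
  have "s \<in> {u \<in> \<Sigma>. \<exists>t\<in>\<Sigma>. t \<curlyvee> x = x \<otimes> u}"
  proof (rule generator_independent)
    fix q assume q: "q \<in> P" and up: "\<And>u. u \<in> {u \<in> \<Sigma>. \<exists>t\<in>\<Sigma>. t \<curlyvee> x = x \<otimes> u} \<Longrightarrow> u \<preceq> q"
    have qc: "q \<in> carrier G" using q P_carrier by auto
    have "t \<preceq> x \<otimes> q" if t: "t \<in> \<Sigma>" for t
    proof -
      have tx: "t \<preceq> t \<curlyvee> x" using join_upper t \<Sigma>_P P_carrier xc by auto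
      have "t \<curlyvee> x \<preceq> x \<otimes> q" using generator_join[OF assms(1) t]
      proof
        assume "t \<curlyvee> x = x" thus ?thesis using le_multI[OF xc q] by simp
      next
        assume "\<exists>u\<in>\<Sigma>. t \<curlyvee> x = x \<otimes> u"
        then obtain u where "u \<in> \<Sigma>" "t \<curlyvee> x = x \<otimes> u" by blast
        thus ?thesis using up[of u] t le_translate[OF xc, of u q] by auto
      qed
      thus ?thesis using tx le_trans by blast
    qed
    moreover have "x \<otimes> q \<in> P" using assms q mult_P by blast
    ultimately have "\<Delta> \<preceq> x \<otimes> q" using \<Delta>_le_iff by blast
    hence "x \<otimes> s \<preceq> x \<otimes> q" using xs assms le_trans by blast
    thus "s \<preceq> q" using le_translate_iff xc qc sc by blast
  qed (use s in auto)
  then obtain t where t: "t \<in> \<Sigma>" "t \<curlyvee> x = x \<otimes> s" by blast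
  have tc: "t \<in> carrier G" using t \<Sigma>_P P_carrier by auto
  have "t \<preceq> y" using t join_upper(1)[OF tc xc] xs le_trans by simp
  moreover have "\<not> t \<preceq> x"
  proof
    assume "t \<preceq> x"
    hence "x \<otimes> s = x \<otimes> \<one>" using join_absorb t xc by simp
    hence "s = \<one>" using xc sc by simp
    thus False using s one_notin_\<Sigma> by simp
  qed
  ultimately have "t \<in> atoms y" "t \<notin> atoms x" using t by (auto simp: atoms_def)
  moreover have "atoms x \<subseteq> atoms y" using le_trans[OF _ assms(2)] by (auto simp: atoms_def)
  ultimately show ?thesis by blast
qed

text \<open>An element below \<Delta> is the join \<open>d\<close> of its atoms: \<open>d\<close>
  has at least these atoms, while an element strictly below would have fewer. So
  \<open>atoms\<close> is injective here.\<close>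

lemma finite_divisors: "finite {x \<in> P. x \<preceq> \<Delta>}"
proof (rule inj_on_finite)
  show "atoms ` {x \<in> P. x \<preceq> \<Delta>} \<subseteq> Pow \<Sigma>" by (auto simp: atoms_def)
  show "finite (Pow \<Sigma>)" using finite_\<Sigma> by simp
  show "inj_on atoms {x \<in> P. x \<preceq> \<Delta>}"
  proof (rule inj_onI)
    fix x y assume xy: "x \<in> {x \<in> P. x \<preceq> \<Delta>}" "y \<in> {x \<in> P. x \<preceq> \<Delta>}" "atoms x = atoms y"
    obtain d where d: "d \<in> P" "\<And>w. d \<preceq> w \<longleftrightarrow> w \<in> P \<and> (\<forall>s\<in>atoms x. s \<preceq> w)"
      using finite_join_exists[of "atoms x"] finite_\<Sigma> \<Sigma>_P by (auto simp: atoms_def)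
    have "d = z" if "z \<in> P" "z \<preceq> \<Delta>" "atoms z = atoms x" for z
    proof (rule ccontr)
      assume "d \<noteq> z"
      moreover have "d \<preceq> z" using d(2)[of z] that by (auto simp: atoms_def)
      ultimately have "atoms d \<subset> atoms z" using atoms_psubset[OF d(1)] that(2) by blast
      moreover have "atoms x \<subseteq> atoms d" using d(2)[of d] le_refl d(1) P_carrier by (auto simp: atoms_def)
      ultimately show False using that by blast
    qed
    from this[of x] this[of y] show "x = y" using xy by auto
  qed
qed

end

section \<open>Chains and their contraction\<close>

lemma keys_diff_subset: "Poly_Mapping.keys a \<subseteq> S \<Longrightarrow> Poly_Mapping.keys b \<subseteq> S \<Longrightarrow> Poly_Mapping.keys (a - b) \<subseteq> S"
  by (rule order.trans[OF keys_diff]) blast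

lemma keys_add_subset: "Poly_Mapping.keys a \<subseteq> S \<Longrightarrow> Poly_Mapping.keys b \<subseteq> S \<Longrightarrow> Poly_Mapping.keys (a + b) \<subseteq> S"
  by (rule order.trans[OF Poly_Mapping.keys_add]) blast

lemma keys_frag_extend_subset:
  assumes "\<And>x. x \<in> Poly_Mapping.keys c \<Longrightarrow> Poly_Mapping.keys (f x) \<subseteq> S"
  shows "Poly_Mapping.keys (frag_extend f c) \<subseteq> S"
  using keys_frag_extend[of f c] assms by blast

text \<open>Additive identities thus need checking only on basis elements. Support
  \<open>UNIV\<close> removes the side condition of \<open>frag_induction\<close>.\<close>

lemma frag_UNIV_induct [case_names zero one diff]:
  assumes "P 0" "\<And>x. P (frag_of x)" "\<And>a b. P a \<Longrightarrow> P b \<Longrightarrow> P (a - b)"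
  shows "P c"
  by (rule frag_induction[of c UNIV]) (use assms in auto)

section \<open>Ordered chains: cones, boundaries, prisms and degenerate lists\<close>

definition cons_chain :: "'a \<Rightarrow> ('a list \<Rightarrow>\<^sub>0 int) \<Rightarrow> ('a list \<Rightarrow>\<^sub>0 int)" where
  "cons_chain x = frag_extend (\<lambda>w. frag_of (x # w))"

definition map_chain :: "('a \<Rightarrow> 'b) \<Rightarrow> ('a list \<Rightarrow>\<^sub>0 int) \<Rightarrow> ('b list \<Rightarrow>\<^sub>0 int)" where
  "map_chain f = frag_extend (\<lambda>w. frag_of (map f w))"

text \<open>Unfolds to the alternating sum of the lists with one entry deleted, without index
  arithmetic. A single vertex has boundary \<open>frag_of []\<close>, so this is the boundary of the
  augmented complex.\<close>

primrec list_boundary :: "'a list \<Rightarrow> ('a list \<Rightarrow>\<^sub>0 int)" where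
  "list_boundary [] = 0"
| "list_boundary (x # w) = frag_of w - cons_chain x (list_boundary w)"

definition boundary :: "('a list \<Rightarrow>\<^sub>0 int) \<Rightarrow> ('a list \<Rightarrow>\<^sub>0 int)" where
  "boundary = frag_extend list_boundary"

text \<open>The classical prism operator: the alternating sum of the lists
  \<open>x_0, .., x_i, T x_i, .., T x_n\<close>.\<close>

primrec list_prism :: "('a \<Rightarrow> 'a) \<Rightarrow> 'a list \<Rightarrow> ('a list \<Rightarrow>\<^sub>0 int)" where
  "list_prism T [] = 0"
| "list_prism T (x # w) = frag_of (x # T x # map T w) - cons_chain x (list_prism T w)"

definition prism :: "('a \<Rightarrow> 'a) \<Rightarrow> ('a list \<Rightarrow>\<^sub>0 int) \<Rightarrow> ('a list \<Rightarrow>\<^sub>0 int)" where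
  "prism T = frag_extend (list_prism T)"

text \<open>Projection to normalised chains: lists with two equal neighbours are sent to zero. For
  increasing lists the survivors are exactly the distinct ones.\<close>

definition nondegenerate :: "('a list \<Rightarrow>\<^sub>0 int) \<Rightarrow> ('a list \<Rightarrow>\<^sub>0 int)" where
  "nondegenerate = frag_extend (\<lambda>w. if distinct_adj w then frag_of w else 0)"

lemmas chain_map_defs = cons_chain_def map_chain_def boundary_def prism_def nondegenerate_def

lemma chain_maps_0 [simp]:
  "cons_chain x 0 = 0" "map_chain f 0 = 0" "boundary 0 = 0" "prism T 0 = 0" "nondegenerate 0 = 0"
  by (simp_all add: chain_map_defs)

lemma chain_maps_of [simp]:
  "cons_chain x (frag_of w) = frag_of (x # w)"
  "map_chain f (frag_of v) = frag_of (map f v)"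
  "boundary (frag_of w) = list_boundary w"
  "prism T (frag_of w) = list_prism T w"
  "nondegenerate (frag_of w) = (if distinct_adj w then frag_of w else 0)"
  by (simp_all add: chain_map_defs)

lemma chain_maps_diff [simp]:
  "cons_chain x (a - b) = cons_chain x a - cons_chain x b"
  "map_chain f (c - d) = map_chain f c - map_chain f d"
  "boundary (a - b) = boundary a - boundary b"
  "prism T (a - b) = prism T a - prism T b"
  "nondegenerate (a - b) = nondegenerate a - nondegenerate b"
  by (simp_all add: chain_map_defs frag_extend_diff)

lemma chain_maps_add [simp]:
  "cons_chain x (a + b) = cons_chain x a + cons_chain x b"
  "map_chain f (c + d) = map_chain f c + map_chain f d"
  "boundary (a + b) = boundary a + boundary b"
  "nondegenerate (a + b) = nondegenerate a + nondegenerate b"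
  by (simp_all add: chain_map_defs frag_extend_add)

lemma boundary_cmul: "boundary (frag_cmul n a) = frag_cmul n (boundary a)"
  by (simp add: boundary_def frag_extend_cmul)

lemma boundary_cons_chain: "boundary (cons_chain x c) = c - cons_chain x (boundary c)"
  by (induction c rule: frag_UNIV_induct) auto

lemma map_cons_chain: "map_chain f (cons_chain x c) = cons_chain (f x) (map_chain f c)"
  by (induction c rule: frag_UNIV_induct) auto

lemma boundary_map_chain: "boundary (map_chain f c) = map_chain f (boundary c)"
proof (induction c rule: frag_UNIV_induct)
  case (one w)
  show ?case by (induction w) (auto simp: map_cons_chain)
qed auto

lemma boundary_boundary: "boundary (boundary c) = 0"
proof (induction c rule: frag_UNIV_induct)
  case (one w)
  show ?case by (induction w) (auto simp: boundary_cons_chain)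
qed auto

lemma prism_cons_chain:
  "prism T (cons_chain x c) = cons_chain x (cons_chain (T x) (map_chain T c)) - cons_chain x (prism T c)"
  by (induction c rule: frag_UNIV_induct) auto

lemma boundary_prism: "boundary (prism T c) + prism T (boundary c) = map_chain T c - c"
proof (induction c rule: frag_UNIV_induct)
  case (one w)
  show ?case
  proof (induction w)
    case (Cons x w)
    have *: "boundary (list_prism T w) = frag_of (map T w) - frag_of w - prism T (list_boundary w)"
      using Cons by (simp add: algebra_simps)
    have **: "list_boundary (map T w) = map_chain T (list_boundary w)"
      using boundary_map_chain[of T "frag_of w"] by simp
    show ?case by (simp add: boundary_cons_chain prism_cons_chain * ** algebra_simps)
  qed auto
next
  case (diff a b)
  have "boundary (prism T (a - b)) + prism T (boundary (a - b))
    = (boundary (prism T a) + prism T (boundary a)) - (boundary (prism T b) + prism T (boundary b))"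
    by simp
  thus ?case unfolding diff by simp
qed auto

lemma map_chain_map_chain: "map_chain f (map_chain g c) = map_chain (\<lambda>x. f (g x)) c"
  by (induction c rule: frag_UNIV_induct) (auto simp: o_def)

lemma map_chain_id:
  "(\<And>w x. w \<in> Poly_Mapping.keys c \<Longrightarrow> x \<in> set w \<Longrightarrow> f x = x) \<Longrightarrow> map_chain f c = c"
  unfolding map_chain_def
  by (subst (2) frag_expansion) (auto intro!: frag_extend_eq simp: map_idI)

lemma nondegenerate_eq: "(\<And>w. w \<in> Poly_Mapping.keys c \<Longrightarrow> distinct_adj w) \<Longrightarrow> nondegenerate c = c"
  unfolding nondegenerate_def
  by (subst (2) frag_expansion) (auto intro!: frag_extend_eq)

text \<open>A vertex in front cannot repair a degenerate list, so only the nondegenerate part of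
  \<open>c\<close> contributes.\<close>

lemma nondegenerate_cons_eq_0:
  assumes "nondegenerate c = 0" shows "nondegenerate (cons_chain x c) = 0"
proof -
  have "nondegenerate (cons_chain x c) = nondegenerate (cons_chain x (nondegenerate c))" for c :: "'a list \<Rightarrow>\<^sub>0 int"
    by (induction c rule: frag_UNIV_induct) (auto simp: distinct_adj_Cons)
  thus ?thesis using assms by (metis chain_maps_0(1,5))
qed

text \<open>The two faces that delete one of two equal neighbours cancel, and every other face still
  contains the pair.\<close>

lemma nondegenerate_list_boundary:
  "\<not> distinct_adj w \<Longrightarrow> nondegenerate (list_boundary w) = 0"
proof (induction w rule: induct_list012)
  case (3 x y v)
  show ?case
  proof (cases "distinct_adj (y # v)")
    case True
    hence xy: "x = y" using 3 by simp
    have "nondegenerate (cons_chain x (cons_chain x c)) = 0" for c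
      by (induction c rule: frag_UNIV_induct) auto
    thus ?thesis by (simp add: xy)
  next
    case False
    hence "nondegenerate (list_boundary (y # v)) = 0" using 3 by blast
    thus ?thesis using False nondegenerate_cons_eq_0[of "list_boundary (y # v)" x] by auto
  qed
qed auto

text \<open>Degenerate chains form a subcomplex, so they may be discarded before or only after
  taking the boundary.\<close>

lemma nondegenerate_boundary: "nondegenerate (boundary (nondegenerate c)) = nondegenerate (boundary c)"
  by (induction c rule: frag_UNIV_induct) (auto simp: nondegenerate_list_boundary)

lemma keys_list_boundary:
  "v \<in> Poly_Mapping.keys (list_boundary w) \<Longrightarrow> subseq v w \<and> length w = Suc (length v)"
proof (induction w arbitrary: v)
  case (Cons x w)
  from Cons.prems consider "v = w" | "v \<in> Poly_Mapping.keys (cons_chain x (list_boundary w))"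
    using keys_diff[of "frag_of w"] by fastforce
  thus ?case
  proof cases
    case 2
    then obtain u where "u \<in> Poly_Mapping.keys (list_boundary w)" "v = x # u"
      unfolding cons_chain_def using keys_frag_extend by fastforce
    thus ?thesis using Cons.IH by simp
  qed (auto intro: subseq_Cons')
qed simp

lemma keys_boundary:
  "v \<in> Poly_Mapping.keys (boundary c) \<Longrightarrow>
    \<exists>w\<in>Poly_Mapping.keys c. subseq v w \<and> length w = Suc (length v)"
  unfolding boundary_def
  using subsetD[OF keys_frag_extend, of v list_boundary c] keys_list_boundary by blast

lemma distinct_adj_if_distinct: "distinct w \<Longrightarrow> distinct_adj w"
  by (induction w rule: induct_list012) auto

lemma subseq_distinct: "subseq v w \<Longrightarrow> distinct w \<Longrightarrow> distinct v"
  by (induction rule: list_emb.induct) (auto dest: list_emb_set)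

lemma sorted_wrt_subseq: "subseq v w \<Longrightarrow> sorted_wrt R w \<Longrightarrow> sorted_wrt R v"
  by (induction rule: list_emb.induct) (auto dest: list_emb_set)

lemma keys_list_prism:
  assumes "v \<in> Poly_Mapping.keys (list_prism T w)"
  shows "length v = Suc (length w) \<and> set v \<subseteq> set w \<union> T ` set w"
  using assms
proof (induction w arbitrary: v)
  case (Cons x w)
  from Cons.prems consider "v = x # T x # map T w" | "v \<in> Poly_Mapping.keys (cons_chain x (list_prism T w))"
    using keys_diff[of "frag_of (x # T x # map T w)"] by fastforce
  thus ?case
  proof cases
    case 2
    then obtain u where "u \<in> Poly_Mapping.keys (list_prism T w)" "v = x # u"
      unfolding cons_chain_def using keys_frag_extend by fastforce
    thus ?thesis using Cons.IH[of u] by auto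
  qed auto
qed simp

text \<open>In \<open>x_0, .., x_i, T x_i, .., T x_n\<close> the first block is increasing, the
  second is so because \<open>T\<close> is monotone, and \<open>x_j\<close> is related to a later
  \<open>T x_l\<close> by transitivity through \<open>x_l\<close>.\<close>

lemma sorted_list_prism:
  assumes "v \<in> Poly_Mapping.keys (list_prism T w)" "sorted_wrt R w"
    and mono: "\<And>x y. x \<in> set w \<Longrightarrow> y \<in> set w \<Longrightarrow> R x y \<Longrightarrow> R (T x) (T y)"
    and "\<And>x. x \<in> set w \<Longrightarrow> R x (T x)" "transp R"
  shows "sorted_wrt R v"
  using assms(1-4)
proof (induction w arbitrary: v)
  case (Cons x w)
  have xw: "R x y" "R x (T y)" if "y \<in> set w" for y
  proof -
    show "R x y" using Cons.prems(2) that by simp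
    moreover have "R y (T y)" using Cons.prems(4) that by simp
    ultimately show "R x (T y)" using \<open>transp R\<close> by (blast dest: transpD)
  qed
  from Cons.prems consider "v = x # T x # map T w" | "v \<in> Poly_Mapping.keys (cons_chain x (list_prism T w))"
    using keys_diff[of "frag_of (x # T x # map T w)"] by fastforce
  thus ?case
  proof cases
    case 1
    have "sorted_wrt R (map T w)" unfolding sorted_wrt_map
      by (rule sorted_wrt_mono_rel[of w R]) (use Cons.prems in auto)
    thus ?thesis using 1 xw Cons.prems by auto
  next
    case 2
    then obtain u where u: "u \<in> Poly_Mapping.keys (list_prism T w)" "v = x # u"
      unfolding cons_chain_def using keys_frag_extend by fastforce
    have "sorted_wrt R u" using Cons.IH[OF u(1)] Cons.prems by auto
    thus ?thesis using keys_list_prism[OF u(1)] u xw by auto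
  qed
qed simp

section \<open>The complex of chains of width at most \<Delta>, its acyclicity and its
  dimension\<close>

context lattice_submonoid
begin

text \<open>The index counts vertices, so it is the dimension plus one. Imposing the width condition
  on all pairs, not only on the two ends, makes it pass to faces at once.\<close>

definition chains :: "nat \<Rightarrow> 'a list set" where
  "chains k = {w. length w = k \<and> set w \<subseteq> carrier G \<and> sorted_wrt (\<preceq>) w \<and> distinct w \<and>
     (\<forall>x\<in>set w. \<forall>y\<in>set w. x \<preceq> y \<otimes> \<Delta>)}"

lemma boundary_chains:
  assumes "Poly_Mapping.keys c \<subseteq> chains (Suc k)" shows "Poly_Mapping.keys (boundary c) \<subseteq> chains k"
proof
  fix v assume "v \<in> Poly_Mapping.keys (boundary c)"
  then obtain w where w: "w \<in> chains (Suc k)" "subseq v w" "length w = Suc (length v)"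
    using keys_boundary assms by blast
  have "set v \<subseteq> set w" using w(2) by (auto dest: list_emb_set)
  thus "v \<in> chains k" using w sorted_wrt_subseq subseq_distinct
    unfolding chains_def by (auto simp: subset_iff)
qed

text \<open>By antisymmetry, a vertex that recurs later equals everything in between, in particular
  its neighbour.\<close>

lemma distinct_of_sorted:
  assumes "sorted_wrt (\<preceq>) w" "distinct_adj w" shows "distinct w"
  using assms
proof (induction w rule: induct_list012)
  case (3 x y v)
  have "x \<noteq> z" if z: "z \<in> set v" for z
  proof
    assume "x = z"
    hence "x \<preceq> y" "y \<preceq> x" using 3 z by auto
    thus False using le_antisym 3 by auto
  qed
  thus ?case using 3 by auto
qed auto

lemma keys_nondegenerate: "Poly_Mapping.keys (nondegenerate c) \<subseteq> {w \<in> Poly_Mapping.keys c. distinct_adj w}"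
  unfolding nondegenerate_def using keys_frag_extend[of _ c] by (fastforce split: if_splits)

lemma map_chains:
  assumes "g \<in> carrier G" "w \<in> chains k" shows "map ((\<otimes>) g) w \<in> chains k"
proof -
  have c: "\<And>x. x \<in> set w \<Longrightarrow> x \<in> carrier G" using assms by (auto simp: chains_def)
  have "sorted_wrt (\<preceq>) (map ((\<otimes>) g) w)" unfolding sorted_wrt_map
    by (rule sorted_wrt_mono_rel[of w "(\<preceq>)"]) (use assms le_translate in \<open>auto simp: chains_def\<close>)
  moreover have "distinct (map ((\<otimes>) g) w)"
    using assms c by (auto simp: chains_def distinct_map inj_on_def)
  moreover have "g \<otimes> x \<preceq> g \<otimes> y \<otimes> \<Delta>" if "x \<in> set w" "y \<in> set w" for x y
    using le_translate[OF assms(1), of x "y \<otimes> \<Delta>"] that assms c by (auto simp: chains_def m_assoc)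
  ultimately show ?thesis using assms c by (auto simp: chains_def)
qed

lemma keys_map_chain_subset:
  "Poly_Mapping.keys (map_chain f c) \<subseteq> map f ` Poly_Mapping.keys c"
  unfolding map_chain_def by (rule keys_frag_extend_subset) auto

text \<open>Pushing the vertices up along \<open>x \<mapsto> x \<or> \<Delta>\<close> is homotopic to the identity on chains with
  vertices in \<open>P\<close>, and moves these into \<open>\<Delta> P\<close>.\<close>

lemma acyclic_bounded:
  assumes "Poly_Mapping.keys c \<subseteq> {w \<in> chains k. set w \<subseteq> {x \<in> P. x \<preceq> \<Delta> [^] (m::nat)}}" "boundary c = 0"
  shows "\<exists>b. Poly_Mapping.keys b \<subseteq> chains (Suc k) \<and> boundary b = c"
  using assms
proof (induction m arbitrary: c)
  case 0
  \<comment> \<open>With \<open>\<one>\<close> as the only vertex, the chains are the empty one and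
    \<open>[\<one>]\<close>. The former is the boundary of the latter, and a multiple of
    \<open>[\<one>]\<close> is a cycle only if it is zero.\<close>
  have "{x \<in> P. x \<preceq> \<one>} = {\<one>}" using le_antisym one_le_iff one_P le_refl by auto
  hence c: "Poly_Mapping.keys c \<subseteq> {w. length w = k \<and> set w \<subseteq> {\<one>} \<and> distinct w}"
    using 0(1) by (auto simp: chains_def)
  have w: "w = [] \<and> k = 0 \<or> w = [\<one>] \<and> k = 1"
    if "length w = k \<and> set w \<subseteq> {\<one>} \<and> distinct w" for w :: "'a list"
    using that by (cases w rule: remdups_adj.cases) auto
  have scalar: "c = frag_cmul (Poly_Mapping.lookup c v) (frag_of v)" if "Poly_Mapping.keys c \<subseteq> {v}" for v
    using that by (intro poly_mapping_eqI) (auto simp: not_in_keys_iff_lookup_eq_zero[symmetric])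
  show ?case
  proof (cases "k = 0")
    case True
    have "Poly_Mapping.keys c \<subseteq> {[]}" using c True by auto
    from scalar[OF this] obtain n where n: "c = frag_cmul n (frag_of [])" by blast
    have "boundary (frag_cmul n (frag_of [\<one>])) = c" by (simp add: boundary_cmul n)
    moreover have "[\<one>] \<in> chains (Suc k)"
      using True \<Delta>_P one_le_iff by (simp add: chains_def)
    ultimately show ?thesis
      by (intro exI[of _ "frag_cmul n (frag_of [\<one>])"]) auto
  next
    case False
    have "Poly_Mapping.keys c \<subseteq> {[\<one>]}" using c w False by blast
    from scalar[OF this] obtain n where n: "c = frag_cmul n (frag_of [\<one>])" by blast
    have "n = 0" using 0(2) by (auto simp: n boundary_cmul)
    thus ?thesis by (intro exI[of _ 0]) (simp add: n)
  qed
next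
  case (Suc m)
  define V where "V = {x \<in> P. x \<preceq> \<Delta> [^] Suc m}"
  let ?T = "\<lambda>x. x \<curlyvee> \<Delta>"
  have V: "x \<in> carrier G" "x \<in> P" "x \<preceq> \<Delta> [^] Suc m" if "x \<in> V" for x
    using that P_carrier by (auto simp: V_def)
  have TV: "?T x \<preceq> \<Delta> [^] Suc m" "\<Delta> \<preceq> ?T x" "x \<preceq> ?T x" "?T x \<in> P" "?T x \<in> carrier G"
    if "x \<in> V" for x
  proof -
    have "\<Delta> \<preceq> \<Delta> [^] Suc m" using pow_\<Delta>_mono[of 1 "Suc m"] by simp
    thus "?T x \<preceq> \<Delta> [^] Suc m" using join_least V(3) that by blast
    show "\<Delta> \<preceq> ?T x" "x \<preceq> ?T x" using join_upper V(1) that by auto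
    hence "\<one> \<preceq> ?T x" using le_trans[of \<one> x] V(2)[OF that] one_le_iff by auto
    thus "?T x \<in> P" by (simp add: one_le_iff)
    thus "?T x \<in> carrier G" by (rule P_carrier)
  qed
  have wk: "length w = k" "set w \<subseteq> V" "sorted_wrt (\<preceq>) w" "distinct w"
      "\<And>x y. x \<in> set w \<Longrightarrow> y \<in> set w \<Longrightarrow> x \<preceq> y \<otimes> \<Delta>"
    if "w \<in> Poly_Mapping.keys c" for w
    using Suc.prems(1) that by (auto simp: chains_def subset_iff V_def)
  \<comment> \<open>The prism stays within the width: \<open>y' \<otimes> \<Delta>\<close> is above
    \<open>x'\<close>, and above \<Delta> because \<open>y'\<close> lies in \<open>P\<close>; hence
    it is above \<open>x' \<curlyvee> \<Delta>\<close>. Passing from \<open>y'\<close> to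
    \<open>y\<close> is monotonicity of right multiplication by \<Delta>.\<close>
  have pair: "x \<preceq> y \<otimes> \<Delta>"
    if w: "w \<in> Poly_Mapping.keys c" and xy: "x \<in> set w \<union> ?T ` set w" "y \<in> set w \<union> ?T ` set w" for w x y
  proof -
    note wV = subsetD[OF wk(2)[OF w]]
    obtain y' where y': "y' \<in> set w" "y' \<preceq> y"
    proof (cases "y \<in> set w")
      case True
      moreover have "y \<preceq> y" using le_refl V(1) wV[OF True] by auto
      ultimately show ?thesis by (rule that)
    next
      case False
      then obtain y0 where "y0 \<in> set w" "y = ?T y0" using xy(2) by auto
      thus ?thesis using that[of y0] TV(3)[OF wV] by simp
    qed
    obtain x' where x': "x' \<in> set w" "x = x' \<or> x = ?T x'" using xy(1) by auto
    have "x' \<preceq> y' \<otimes> \<Delta>" by (rule wk(5)[OF w x'(1) y'(1)])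
    moreover have "\<Delta> \<preceq> y' \<otimes> \<Delta>" by (rule \<Delta>_le_mult[OF V(2)[OF wV[OF y'(1)]]])
    ultimately have "x \<preceq> y' \<otimes> \<Delta>" using x'(2) join_least by auto
    thus ?thesis using le_mult_\<Delta>[OF y'(2)] by (rule le_trans)
  qed
  define c' where "c' = nondegenerate (map_chain ?T c)"
  define h where "h = nondegenerate (prism ?T c)"
  have h: "Poly_Mapping.keys h \<subseteq> chains (Suc k)"
  proof
    fix v assume "v \<in> Poly_Mapping.keys h"
    hence v: "v \<in> Poly_Mapping.keys (prism ?T c)" "distinct_adj v"
      unfolding h_def using keys_nondegenerate by blast+
    obtain w where w: "w \<in> Poly_Mapping.keys c" "v \<in> Poly_Mapping.keys (list_prism ?T w)"
      using subsetD[OF keys_frag_extend v(1)[unfolded prism_def]] by auto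
    have s: "sorted_wrt (\<preceq>) v"
    proof (rule sorted_list_prism[OF w(2) wk(3)[OF w(1)]])
      show "transp (\<preceq>)" using le_trans by (rule transpI)
      show "x \<preceq> ?T x" if "x \<in> set w" for x using TV(3) subsetD[OF wk(2)[OF w(1)] that] by simp
      show "?T x \<preceq> ?T y" if "x \<preceq> y" for x y using join_mono[OF that le_refl] by simp
    qed
    note v' = keys_list_prism[OF w(2)]
    have "set w \<union> ?T ` set w \<subseteq> carrier G" using TV(5) V(1) wk(2)[OF w(1)] by auto
    hence "set v \<subseteq> carrier G" using v' by (metis subset_trans)
    moreover have "x \<preceq> y \<otimes> \<Delta>" if "x \<in> set v" "y \<in> set v" for x y
      by (rule pair[OF w(1)]) (use v' that in auto)
    ultimately show "v \<in> chains (Suc k)"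
      using v' wk(1)[OF w(1)] s distinct_of_sorted[OF s v(2)] by (auto simp: chains_def)
  qed
  have c': "v \<in> chains k \<and> (\<forall>x\<in>set v. \<Delta> \<preceq> x \<and> x \<preceq> \<Delta> [^] Suc m)"
    if "v \<in> Poly_Mapping.keys c'" for v
  proof -
    have v: "v \<in> Poly_Mapping.keys (map_chain ?T c)" "distinct_adj v"
      using that unfolding c'_def using keys_nondegenerate by blast+
    obtain w where w: "w \<in> Poly_Mapping.keys c" "v = map ?T w"
      using subsetD[OF keys_map_chain_subset v(1)] by auto
    have s: "sorted_wrt (\<preceq>) v" unfolding w sorted_wrt_map
      by (rule sorted_wrt_mono_rel[OF _ wk(3)[OF w(1)]]) (simp add: join_mono le_refl)
    have sv: "set v = ?T ` set w" by (simp add: w)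
    have "set v \<subseteq> carrier G" using sv TV(5) wk(2)[OF w(1)] by auto
    moreover have "x \<preceq> y \<otimes> \<Delta>" if "x \<in> set v" "y \<in> set v" for x y
      by (rule pair[OF w(1)]) (use sv that in auto)
    ultimately have "v \<in> chains k"
      using w(2) wk(1)[OF w(1)] s distinct_of_sorted[OF s v(2)] by (auto simp: chains_def)
    moreover have "\<forall>x\<in>set v. \<Delta> \<preceq> x \<and> x \<preceq> \<Delta> [^] Suc m" using sv TV(1,2) wk(2)[OF w(1)] by auto
    ultimately show ?thesis by blast
  qed
  \<comment> \<open>Faces of distinct lists are distinct, so normalising the boundary of
    \<open>c'\<close> changes nothing, and the boundary can be computed from the unnormalised image.
    The same device is used for \<open>h\<close>.\<close>
  have "boundary c' = nondegenerate (boundary c')"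
  proof (rule nondegenerate_eq[symmetric])
    fix v assume "v \<in> Poly_Mapping.keys (boundary c')"
    from keys_boundary[OF this] obtain w where w: "w \<in> Poly_Mapping.keys c'" "subseq v w" by auto
    have "distinct v" using c'[OF w(1)] subseq_distinct[OF w(2)] by (simp add: chains_def)
    thus "distinct_adj v" by (rule distinct_adj_if_distinct)
  qed
  also have "\<dots> = 0" by (simp add: c'_def nondegenerate_boundary boundary_map_chain Suc.prems)
  finally have dc': "boundary c' = 0" .
  have hom: "boundary h = c' - c"
  proof -
    have "boundary h = nondegenerate (boundary h)"
    proof (rule nondegenerate_eq[symmetric])
      fix v assume "v \<in> Poly_Mapping.keys (boundary h)"
      from keys_boundary[OF this] obtain w where w: "w \<in> Poly_Mapping.keys h" "subseq v w" by auto
      have "distinct v" using h w(1) subseq_distinct[OF w(2)] by (auto simp add: chains_def)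
      thus "distinct_adj v" by (rule distinct_adj_if_distinct)
    qed
    also have "\<dots> = nondegenerate (boundary (prism ?T c))" by (simp add: h_def nondegenerate_boundary)
    also have "boundary (prism ?T c) = map_chain ?T c - c"
      using boundary_prism[of ?T c] Suc.prems by simp
    also have "nondegenerate \<dots> = c' - c"
      using nondegenerate_eq[of c] wk(4) distinct_adj_if_distinct by (auto simp: c'_def)
    finally show ?thesis .
  qed
  \<comment> \<open>Left translation is an automorphism of the complex. It moves vertices between
    \<Delta> and the power \<open>Suc m\<close> to vertices between \<open>\<one>\<close> and the
    power \<open>m\<close>, where the induction hypothesis applies.\<close>
  let ?i = "(\<otimes>) (inv \<Delta>)"
  have inv\<Delta>: "inv \<Delta> \<in> carrier G" by simp
  have "\<exists>b. Poly_Mapping.keys b \<subseteq> chains (Suc k) \<and> boundary b = map_chain ?i c'"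
  proof (rule Suc.IH)
    show "boundary (map_chain ?i c') = 0" by (simp add: boundary_map_chain dc')
    show "Poly_Mapping.keys (map_chain ?i c') \<subseteq> {w \<in> chains k. set w \<subseteq> {x \<in> P. x \<preceq> \<Delta> [^] m}}"
    proof
      fix v assume "v \<in> Poly_Mapping.keys (map_chain ?i c')"
      then obtain w where w: "w \<in> Poly_Mapping.keys c'" "v = map ?i w"
        using subsetD[OF keys_map_chain_subset] by blast
      have "inv \<Delta> \<otimes> x \<in> P" "inv \<Delta> \<otimes> x \<preceq> \<Delta> [^] m" if "x \<in> set w" for x
      proof -
        have x: "\<Delta> \<preceq> x" "x \<preceq> \<Delta> [^] Suc m" using c' w that by blast+
        show "inv \<Delta> \<otimes> x \<in> P" using x by (simp add: le_def)
        have "inv \<Delta> \<otimes> \<Delta> [^] Suc m = \<Delta> [^] m"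
          unfolding nat_pow_Suc2[OF \<Delta>_carrier] by (simp add: m_assoc[symmetric])
        thus "inv \<Delta> \<otimes> x \<preceq> \<Delta> [^] m" using le_translate[OF inv\<Delta> x(2)] by simp
      qed
      thus "v \<in> {w \<in> chains k. set w \<subseteq> {x \<in> P. x \<preceq> \<Delta> [^] m}}"
        using map_chains[OF inv\<Delta>] c' w by auto
    qed
  qed
  then obtain b where b: "Poly_Mapping.keys b \<subseteq> chains (Suc k)" "boundary b = map_chain ?i c'" by blast
  let ?b = "map_chain ((\<otimes>) \<Delta>) b"
  have "Poly_Mapping.keys ?b \<subseteq> chains (Suc k)"
    using b(1) map_chains[OF \<Delta>_carrier] keys_map_chain_subset by blast
  moreover have "boundary ?b = c'"
    unfolding boundary_map_chain b map_chain_map_chain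
    by (rule map_chain_id) (use c' in \<open>auto simp: chains_def m_assoc[symmetric] subset_iff\<close>)
  \<comment> \<open>As \<open>boundary h = c' - c\<close>, subtracting \<open>h\<close> from a
    filling of \<open>c'\<close> gives a filling of \<open>c\<close>.\<close>
  ultimately show ?case using hom h keys_diff_subset
    by (intro exI[of _ "?b - h"]) simp
qed

text \<open>A cycle has finitely many vertices. One power of \<Delta> translates them into
  \<open>P\<close>, another power bounds them, and the filling obtained there is translated
  back.\<close>

lemma acyclic:
  assumes "Poly_Mapping.keys c \<subseteq> chains k" "boundary c = 0"
  shows "\<exists>b. Poly_Mapping.keys b \<subseteq> chains (Suc k) \<and> boundary b = c"
proof -
  define V where "V = (\<Union>w\<in>Poly_Mapping.keys c. set w)"
  have V: "finite V" "V \<subseteq> carrier G" using assms(1) by (auto simp: V_def chains_def)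
  obtain n where n: "\<And>x. x \<in> V \<Longrightarrow> \<Delta> [^] (n::nat) \<otimes> x \<in> P" using finite_pow_\<Delta>_mult_mem[OF V] by blast
  let ?g = "\<Delta> [^] n"
  have g: "?g \<in> carrier G" "inv ?g \<in> carrier G" by auto
  obtain m where m: "\<And>x. x \<in> V \<Longrightarrow> ?g \<otimes> x \<preceq> \<Delta> [^] (m::nat)"
    using finite_le_pow_\<Delta>[of "(\<otimes>) ?g ` V"] V n by (auto simp: image_subset_iff)
  have "\<exists>b. Poly_Mapping.keys b \<subseteq> chains (Suc k) \<and> boundary b = map_chain ((\<otimes>) ?g) c"
  proof (rule acyclic_bounded)
    show "boundary (map_chain ((\<otimes>) ?g) c) = 0" by (simp add: boundary_map_chain assms)
    show "Poly_Mapping.keys (map_chain ((\<otimes>) ?g) c) \<subseteq> {w \<in> chains k. set w \<subseteq> {x \<in> P. x \<preceq> \<Delta> [^] m}}"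
    proof
      fix v assume "v \<in> Poly_Mapping.keys (map_chain ((\<otimes>) ?g) c)"
      then obtain w where w: "w \<in> Poly_Mapping.keys c" "v = map ((\<otimes>) ?g) w"
        using keys_map_chain_subset by blast
      have "set w \<subseteq> V" using w by (auto simp: V_def)
      thus "v \<in> {w \<in> chains k. set w \<subseteq> {x \<in> P. x \<preceq> \<Delta> [^] m}}"
        using map_chains[OF g(1), of w k] w assms n m by auto
    qed
  qed
  then obtain b where b: "Poly_Mapping.keys b \<subseteq> chains (Suc k)" "boundary b = map_chain ((\<otimes>) ?g) c" by blast
  let ?b = "map_chain ((\<otimes>) (inv ?g)) b"
  have "Poly_Mapping.keys ?b \<subseteq> chains (Suc k)"
    using b(1) map_chains[OF g(2)] keys_map_chain_subset by blast
  moreover have "boundary ?b = c"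
    unfolding boundary_map_chain b map_chain_map_chain
    by (rule map_chain_id) (use assms(1) in \<open>auto simp: chains_def m_assoc[symmetric] subset_iff\<close>)
  ultimately show ?thesis by blast
qed

text \<open>Every further vertex acquires a new atom. Counting the atoms of the first vertex carries
  the induction; the extra one accounts for vertices against steps.\<close>

lemma chain_length_bound:
  assumes "sorted_wrt (\<preceq>) w" "distinct w" "set w \<subseteq> {x \<in> P. x \<preceq> \<Delta>}" "w \<noteq> []"
  shows "card (atoms (hd w)) + length w \<le> Suc (card \<Sigma>)"
  using assms
proof (induction w rule: induct_list012)
  case (2 x)
  have "atoms x \<subseteq> \<Sigma>" by (auto simp: atoms_def)
  thus ?case using finite_\<Sigma> card_mono by auto
next
  case (3 x y w)
  have "atoms x \<subset> atoms y" using atoms_psubset[of x y] 3 by auto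
  moreover have "finite (atoms y)" using finite_\<Sigma> by (auto simp: atoms_def)
  ultimately have "card (atoms x) < card (atoms y)" by (simp add: psubset_card_mono)
  thus ?case using 3 by auto
qed simp

text \<open>Representatives of the orbits of the group on nonempty chains, obtained by translating
  the first vertex to \<open>\<one>\<close>.\<close>

definition based_chains :: "nat \<Rightarrow> 'a list set" where
  "based_chains k = {w \<in> chains k. w \<noteq> [] \<and> hd w = \<one>}"

lemma set_based_chain:
  assumes "w \<in> based_chains k" shows "set w \<subseteq> {x \<in> P. x \<preceq> \<Delta>}"
proof
  fix x assume x: "x \<in> set w"
  obtain v where v: "w = \<one> # v" using assms by (cases w) (auto simp: based_chains_def)
  have "\<one> \<preceq> x" using assms x v le_refl by (auto simp: based_chains_def chains_def)
  moreover have "x \<preceq> \<one> \<otimes> \<Delta>" using assms x v unfolding based_chains_def chains_def by auto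
  ultimately show "x \<in> {x \<in> P. x \<preceq> \<Delta>}" using one_le_iff by simp
qed

lemma finite_based_chains: "finite (based_chains k)"
proof (rule finite_subset)
  show "based_chains k \<subseteq> {w. set w \<subseteq> {x \<in> P. x \<preceq> \<Delta>} \<and> length w = k}"
    using set_based_chain by (auto simp: based_chains_def chains_def)
  show "finite {w. set w \<subseteq> {x \<in> P. x \<preceq> \<Delta>} \<and> length w = k}"
    using finite_lists_length_eq[OF finite_divisors] by simp
qed

lemma based_chains_empty:
  assumes "k > Suc (card \<Sigma>)" shows "based_chains k = {}"
proof (rule ccontr)
  assume "based_chains k \<noteq> {}"
  then obtain w where w: "w \<in> based_chains k" by blast
  thus False using chain_length_bound[of w] set_based_chain[OF w] assms
    by (auto simp: based_chains_def chains_def)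
qed

lemma chain_orbit:
  assumes "w \<in> chains k" "w \<noteq> []"
  shows "hd w \<in> carrier G" "map ((\<otimes>) (inv (hd w))) w \<in> based_chains k"
    "map ((\<otimes>) (hd w)) (map ((\<otimes>) (inv (hd w))) w) = w"
proof -
  show h: "hd w \<in> carrier G" using assms by (cases w) (auto simp: chains_def)
  show "map ((\<otimes>) (inv (hd w))) w \<in> based_chains k"
    using map_chains[of "inv (hd w)" w k] assms h by (simp add: based_chains_def hd_map)
  show "map ((\<otimes>) (hd w)) (map ((\<otimes>) (inv (hd w))) w) = w"
    using assms h by (auto intro!: map_idI simp: chains_def m_assoc[symmetric] subset_iff)
qed

end

section \<open>Modules and bases\<close>

context left_module
begin

lemma smult_l_null: "x \<in> carrier M \<Longrightarrow> \<zero>\<^bsub>R\<^esub> \<odot>\<^bsub>M\<^esub> x = \<zero>\<^bsub>M\<^esub>"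
  using smult_l_distr[of "\<zero>\<^bsub>R\<^esub>" "\<zero>\<^bsub>R\<^esub>" x] smult_closed[of "\<zero>\<^bsub>R\<^esub>" x] M.add.r_cancel_one'
  by (metis R.zero_closed R.l_zero)

lemma smult_r_null: "a \<in> carrier R \<Longrightarrow> a \<odot>\<^bsub>M\<^esub> \<zero>\<^bsub>M\<^esub> = \<zero>\<^bsub>M\<^esub>"
  using smult_r_distr[of a "\<zero>\<^bsub>M\<^esub>" "\<zero>\<^bsub>M\<^esub>"] smult_closed[of a "\<zero>\<^bsub>M\<^esub>"] M.add.r_cancel_one'
  by (metis M.zero_closed M.l_zero)

lemma smult_finsum:
  assumes "finite A" "f \<in> A \<rightarrow> carrier M" "a \<in> carrier R"
  shows "a \<odot>\<^bsub>M\<^esub> finsum M f A = finsum M (\<lambda>i. a \<odot>\<^bsub>M\<^esub> f i) A"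
  using assms(1,2)
proof (induction A rule: finite_induct)
  case (insert x A)
  have "(\<lambda>i. a \<odot>\<^bsub>M\<^esub> f i) \<in> A \<rightarrow> carrier M" using insert assms smult_closed by auto
  thus ?case using insert assms smult_closed smult_r_distr M.finsum_closed by simp
qed (use assms smult_r_null in simp)

end

section \<open>Homomorphisms, linear combinations and bases\<close>

lemma left_module_homD:
  assumes "f \<in> left_module_hom R M N"
  shows "x \<in> carrier M \<Longrightarrow> f x \<in> carrier N"
    and "x \<in> carrier M \<Longrightarrow> y \<in> carrier M \<Longrightarrow> f (x \<oplus>\<^bsub>M\<^esub> y) = f x \<oplus>\<^bsub>N\<^esub> f y"
    and "a \<in> carrier R \<Longrightarrow> x \<in> carrier M \<Longrightarrow> f (a \<odot>\<^bsub>M\<^esub> x) = a \<odot>\<^bsub>N\<^esub> f x"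
  using assms by (auto simp: left_module_hom_def)

lemma left_module_homI:
  assumes "\<And>x. x \<in> carrier M \<Longrightarrow> f x \<in> carrier N"
    and "\<And>x y. x \<in> carrier M \<Longrightarrow> y \<in> carrier M \<Longrightarrow> f (x \<oplus>\<^bsub>M\<^esub> y) = f x \<oplus>\<^bsub>N\<^esub> f y"
    and "\<And>a x. a \<in> carrier R \<Longrightarrow> x \<in> carrier M \<Longrightarrow> f (a \<odot>\<^bsub>M\<^esub> x) = a \<odot>\<^bsub>N\<^esub> f x"
  shows "f \<in> left_module_hom R M N"
  using assms by (auto simp: left_module_hom_def)

lemma left_module_hom_comp:
  assumes "f \<in> left_module_hom R M N" "g \<in> left_module_hom R N L"
  shows "(\<lambda>x. g (f x)) \<in> left_module_hom R M L"
  by (rule left_module_homI) (simp_all add: left_module_homD[OF assms(1)] left_module_homD[OF assms(2)])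

lemma left_module_hom_zero:
  assumes "f \<in> left_module_hom R M N" "left_module R M" "left_module R N"
  shows "f \<zero>\<^bsub>M\<^esub> = \<zero>\<^bsub>N\<^esub>"
proof -
  interpret M: left_module R M by fact
  interpret N: left_module R N by fact
  have "f (\<zero>\<^bsub>R\<^esub> \<odot>\<^bsub>M\<^esub> \<zero>\<^bsub>M\<^esub>) = \<zero>\<^bsub>R\<^esub> \<odot>\<^bsub>N\<^esub> f \<zero>\<^bsub>M\<^esub>"
    using left_module_homD(3)[OF assms(1)] by simp
  thus ?thesis using M.smult_l_null N.smult_l_null left_module_homD(1)[OF assms(1)] by simp
qed

lemma left_module_hom_minus:
  assumes "f \<in> left_module_hom R M N" "left_module R M" "left_module R N" "x \<in> carrier M" "y \<in> carrier M"
  shows "f (x \<ominus>\<^bsub>M\<^esub> y) = f x \<ominus>\<^bsub>N\<^esub> f y"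
proof -
  interpret M: left_module R M by fact
  interpret N: left_module R N by fact
  note h = left_module_homD[OF assms(1)]
  have "f (x \<ominus>\<^bsub>M\<^esub> y) \<oplus>\<^bsub>N\<^esub> f y = f x"
    using h(2)[of "x \<ominus>\<^bsub>M\<^esub> y" y] assms by (simp add: M.M.minus_eq M.M.add.m_assoc M.M.l_neg)
  hence "f x \<ominus>\<^bsub>N\<^esub> f y = f (x \<ominus>\<^bsub>M\<^esub> y)"
    using N.M.add.inv_solve_right'[of "f (x \<ominus>\<^bsub>M\<^esub> y)" "f x" "f y"] h(1) assms
    by (simp add: N.M.minus_eq)
  thus ?thesis by simp
qed

lemma left_module_hom_finsum:
  assumes "f \<in> left_module_hom R M N" "left_module R M" "left_module R N" "finite A" "g \<in> A \<rightarrow> carrier M"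
  shows "f (finsum M g A) = finsum N (\<lambda>i. f (g i)) A"
proof -
  interpret M: left_module R M by fact
  interpret N: left_module R N by fact
  note h = left_module_homD[OF assms(1)]
  show ?thesis using assms(4,5)
  proof (induction A rule: finite_induct)
    case (insert x A)
    have "(\<lambda>i. f (g i)) \<in> A \<rightarrow> carrier N" using insert h(1) by auto
    thus ?case using insert h M.M.finsum_closed by simp
  qed (use left_module_hom_zero[OF assms(1-3)] in simp)
qed

lemma left_module_hom_add:
  assumes "f \<in> left_module_hom R M N" "g \<in> left_module_hom R M N" "left_module R M" "left_module R N"
  shows "(\<lambda>x. f x \<oplus>\<^bsub>N\<^esub> g x) \<in> left_module_hom R M N"
proof -
  interpret N: left_module R N by fact
  note f = left_module_homD[OF assms(1)] and g = left_module_homD[OF assms(2)]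
  show ?thesis
    by (rule left_module_homI) (simp_all add: f g N.smult_r_distr N.M.a_ac)
qed

lemma left_module_hom_diff:
  assumes "f \<in> left_module_hom R M N" "g \<in> left_module_hom R M N" "left_module R M" "left_module R N"
  shows "(\<lambda>x. f x \<ominus>\<^bsub>N\<^esub> g x) \<in> left_module_hom R M N"
proof -
  interpret N: left_module R N by fact
  note f = left_module_homD[OF assms(1)] and g = left_module_homD[OF assms(2)]
  have smult_minus: "a \<odot>\<^bsub>N\<^esub> (\<ominus>\<^bsub>N\<^esub> y) = \<ominus>\<^bsub>N\<^esub> (a \<odot>\<^bsub>N\<^esub> y)" if "a \<in> carrier R" "y \<in> carrier N" for a y
    using N.smult_r_distr[of a "\<ominus>\<^bsub>N\<^esub> y" y] that N.smult_closed N.smult_r_null[of a]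
    by (metis N.M.a_inv_closed N.M.l_neg N.M.minus_equality)
  show ?thesis
    by (rule left_module_homI)
      (simp_all add: f g N.smult_r_distr N.M.a_ac N.M.minus_eq smult_minus N.M.minus_add N.smult_closed)
qed

lemma left_module_hom_id: "(\<lambda>x. x) \<in> left_module_hom R M M"
  by (rule left_module_homI) auto

text \<open>Replaces the basis in the sum of \<open>is_basis\<close> by a family \<open>y\<close>,
  so that the image of a combination under a homomorphism is again of this form.\<close>

definition lin_comb :: "('r, 'c) ring_scheme \<Rightarrow> ('r, 'm) module \<Rightarrow> ('b \<Rightarrow> 'm) \<Rightarrow> ('b \<Rightarrow> 'r) \<Rightarrow> 'b set \<Rightarrow> 'm" where
  "lin_comb R M y c A = (\<Oplus>\<^bsub>M\<^esub>b\<in>{b \<in> A. c b \<noteq> \<zero>\<^bsub>R\<^esub>}. c b \<odot>\<^bsub>M\<^esub> y b)"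

text \<open>Terms with coefficient zero vanish, so combinations with different supports can be
  written over one common finite set.\<close>

lemma lin_comb_eq:
  assumes "left_module R M" "finite S" "{b \<in> A. c b \<noteq> \<zero>\<^bsub>R\<^esub>} \<subseteq> S" "S \<subseteq> A"
    "c \<in> A \<rightarrow> carrier R" "y \<in> A \<rightarrow> carrier M"
  shows "lin_comb R M y c A = (\<Oplus>\<^bsub>M\<^esub>b\<in>S. c b \<odot>\<^bsub>M\<^esub> y b)"
proof -
  interpret left_module R M by fact
  show ?thesis unfolding lin_comb_def
    by (rule M.add.finprod_mono_neutral_cong_left)
      (use assms smult_closed smult_l_null in \<open>auto simp: subset_iff Pi_iff\<close>)
qed

lemma lin_comb_closed:
  assumes "left_module R M" "c \<in> A \<rightarrow> carrier R" "y \<in> A \<rightarrow> carrier M"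
  shows "lin_comb R M y c A \<in> carrier M"
proof -
  interpret left_module R M by fact
  show ?thesis unfolding lin_comb_def
    by (rule M.finsum_closed) (use assms smult_closed in auto)
qed

lemma left_module_hom_lin_comb:
  assumes f: "f \<in> left_module_hom R M N" "left_module R M" "left_module R N"
    and c: "finite {b \<in> A. c b \<noteq> \<zero>\<^bsub>R\<^esub>}" "c \<in> A \<rightarrow> carrier R" "y \<in> A \<rightarrow> carrier M"
  shows "f (lin_comb R M y c A) = lin_comb R N (\<lambda>b. f (y b)) c A"
proof -
  interpret M: left_module R M by fact
  interpret N: left_module R N by fact
  have "f (lin_comb R M y c A) = (\<Oplus>\<^bsub>N\<^esub>b\<in>{b \<in> A. c b \<noteq> \<zero>\<^bsub>R\<^esub>}. f (c b \<odot>\<^bsub>M\<^esub> y b))"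
    unfolding lin_comb_def
    by (rule left_module_hom_finsum[OF f c(1)]) (use c M.smult_closed in auto)
  also have "\<dots> = lin_comb R N (\<lambda>b. f (y b)) c A" unfolding lin_comb_def
    by (rule N.M.finsum_cong') (use c left_module_homD[OF f(1)] N.smult_closed in \<open>auto simp: Pi_iff\<close>)
  finally show ?thesis .
qed

lemma lin_comb_add:
  assumes M: "left_module R M" and y: "y \<in> A \<rightarrow> carrier M"
    and c: "finite {b \<in> A. c b \<noteq> \<zero>\<^bsub>R\<^esub>}" "c \<in> A \<rightarrow> carrier R"
    and d: "finite {b \<in> A. d b \<noteq> \<zero>\<^bsub>R\<^esub>}" "d \<in> A \<rightarrow> carrier R"
  shows "lin_comb R M y c A \<oplus>\<^bsub>M\<^esub> lin_comb R M y d A = lin_comb R M y (\<lambda>b. c b \<oplus>\<^bsub>R\<^esub> d b) A"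
proof -
  interpret left_module R M by fact
  let ?S = "{b \<in> A. c b \<noteq> \<zero>\<^bsub>R\<^esub>} \<union> {b \<in> A. d b \<noteq> \<zero>\<^bsub>R\<^esub>}"
  have S: "finite ?S" "?S \<subseteq> A" using c d by auto
  have "lin_comb R M y (\<lambda>b. c b \<oplus>\<^bsub>R\<^esub> d b) A = (\<Oplus>\<^bsub>M\<^esub>b\<in>?S. (c b \<oplus>\<^bsub>R\<^esub> d b) \<odot>\<^bsub>M\<^esub> y b)"
    by (rule lin_comb_eq[OF M S(1)]) (use c d y in auto)
  also have "\<dots> = (\<Oplus>\<^bsub>M\<^esub>b\<in>?S. c b \<odot>\<^bsub>M\<^esub> y b \<oplus>\<^bsub>M\<^esub> d b \<odot>\<^bsub>M\<^esub> y b)"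
    by (rule M.finsum_cong') (use c d y smult_l_distr smult_closed in \<open>auto simp: Pi_iff\<close>)
  also have "\<dots> = (\<Oplus>\<^bsub>M\<^esub>b\<in>?S. c b \<odot>\<^bsub>M\<^esub> y b) \<oplus>\<^bsub>M\<^esub> (\<Oplus>\<^bsub>M\<^esub>b\<in>?S. d b \<odot>\<^bsub>M\<^esub> y b)"
    by (rule M.finsum_addf) (use c d y smult_closed in \<open>auto simp: Pi_iff\<close>)
  also have "(\<Oplus>\<^bsub>M\<^esub>b\<in>?S. c b \<odot>\<^bsub>M\<^esub> y b) = lin_comb R M y c A"
    by (rule lin_comb_eq[OF M S(1), symmetric]) (use c d y in auto)
  also have "(\<Oplus>\<^bsub>M\<^esub>b\<in>?S. d b \<odot>\<^bsub>M\<^esub> y b) = lin_comb R M y d A"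
    by (rule lin_comb_eq[OF M S(1), symmetric]) (use c d y in auto)
  finally show ?thesis by simp
qed

lemma lin_comb_smult:
  assumes M: "left_module R M" and y: "y \<in> A \<rightarrow> carrier M" and a: "a \<in> carrier R"
    and c: "finite {b \<in> A. c b \<noteq> \<zero>\<^bsub>R\<^esub>}" "c \<in> A \<rightarrow> carrier R"
  shows "a \<odot>\<^bsub>M\<^esub> lin_comb R M y c A = lin_comb R M y (\<lambda>b. a \<otimes>\<^bsub>R\<^esub> c b) A"
proof -
  interpret left_module R M by fact
  let ?S = "{b \<in> A. c b \<noteq> \<zero>\<^bsub>R\<^esub>}"
  have "lin_comb R M y (\<lambda>b. a \<otimes>\<^bsub>R\<^esub> c b) A = (\<Oplus>\<^bsub>M\<^esub>b\<in>?S. (a \<otimes>\<^bsub>R\<^esub> c b) \<odot>\<^bsub>M\<^esub> y b)"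
    by (rule lin_comb_eq[OF M c(1)]) (use a c y in auto)
  also have "\<dots> = (\<Oplus>\<^bsub>M\<^esub>b\<in>?S. a \<odot>\<^bsub>M\<^esub> (c b \<odot>\<^bsub>M\<^esub> y b))"
    by (rule M.finsum_cong') (use a c y smult_assoc smult_closed in \<open>auto simp: Pi_iff\<close>)
  also have "\<dots> = a \<odot>\<^bsub>M\<^esub> lin_comb R M y c A" unfolding lin_comb_def
    by (rule smult_finsum[OF c(1) _ a, symmetric]) (use c y smult_closed in auto)
  finally show ?thesis by simp
qed

lemma is_basis_lin_comb:
  "is_basis R M B \<longleftrightarrow> B \<subseteq> carrier M \<and>
     (\<forall>x\<in>carrier M. \<exists>!c. c \<in> B \<rightarrow>\<^sub>E carrier R \<and> finite {b \<in> B. c b \<noteq> \<zero>\<^bsub>R\<^esub>} \<and>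
        x = lin_comb R M (\<lambda>b. b) c B)"
  by (simp add: is_basis_def lin_comb_def)

lemma lin_comb_cong:
  assumes "\<And>b. b \<in> A \<Longrightarrow> c b = d b" "left_module R M" "y \<in> A \<rightarrow> carrier M" "c \<in> A \<rightarrow> carrier R"
  shows "lin_comb R M y c A = lin_comb R M y d A"
proof -
  interpret left_module R M by fact
  have e: "{b \<in> A. c b \<noteq> \<zero>\<^bsub>R\<^esub>} = {b \<in> A. d b \<noteq> \<zero>\<^bsub>R\<^esub>}" using assms by auto
  show ?thesis unfolding lin_comb_def e
    by (rule M.finsum_cong') (use assms smult_closed in \<open>auto simp: Pi_iff\<close>)
qed

text \<open>The universal property of a free module. The map is defined by the unique coordinates,
  and it is linear because sums and multiples of coordinates are again coordinates.\<close>

lemma basis_extension: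
  assumes L: "left_module R L" and B: "is_basis R L B" and N: "left_module R N" and y: "y \<in> B \<rightarrow> carrier N"
  shows "\<exists>f \<in> left_module_hom R L N. \<forall>b\<in>B. f b = y b"
proof -
  interpret L: left_module R L by fact
  interpret N: left_module R N by fact
  have BL: "B \<subseteq> carrier L" "(\<lambda>b. b) \<in> B \<rightarrow> carrier L" using B by (auto simp: is_basis_def)
  define rep where "rep x c \<longleftrightarrow> c \<in> B \<rightarrow>\<^sub>E carrier R \<and> finite {b \<in> B. c b \<noteq> \<zero>\<^bsub>R\<^esub>} \<and>
        x = lin_comb R L (\<lambda>b. b) c B" for x c
  have ex1: "\<exists>!c. rep x c" if "x \<in> carrier L" for x
    using B that unfolding is_basis_lin_comb rep_def by blast
  define coef where "coef x = (THE c. rep x c)" for x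
  have coef: "rep x (coef x)" if "x \<in> carrier L" for x
    unfolding coef_def using theI'[OF ex1[OF that]] .
  have cD: "coef x \<in> B \<rightarrow> carrier R" "finite {b \<in> B. coef x b \<noteq> \<zero>\<^bsub>R\<^esub>}"
      "x = lin_comb R L (\<lambda>b. b) (coef x) B" if "x \<in> carrier L" for x
    using coef[OF that] by (auto simp: rep_def)
  \<comment> \<open>Uniqueness in \<open>is_basis\<close> concerns extensional functions, so an
    arbitrary coefficient family is first restricted to \<open>B\<close>.\<close>
  have coefI: "lin_comb R N y (coef x) B = lin_comb R N y c B"
    if "x \<in> carrier L" "c \<in> B \<rightarrow> carrier R" "finite {b \<in> B. c b \<noteq> \<zero>\<^bsub>R\<^esub>}" "x = lin_comb R L (\<lambda>b. b) c B" for x c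
  proof -
    have "{b \<in> B. restrict c B b \<noteq> \<zero>\<^bsub>R\<^esub>} = {b \<in> B. c b \<noteq> \<zero>\<^bsub>R\<^esub>}" by auto
    hence "rep x (restrict c B)" unfolding rep_def
      using that lin_comb_cong[OF _ L BL(2) that(2), of "restrict c B"] by auto
    hence "coef x = restrict c B" using ex1[OF that(1)] coef[OF that(1)] by blast
    thus ?thesis using lin_comb_cong[OF _ N y that(2), of "restrict c B"] by simp
  qed
  define f where "f x = lin_comb R N y (coef x) B" for x
  have "f \<in> left_module_hom R L N"
  proof (rule left_module_homI)
    show "f x \<in> carrier N" if "x \<in> carrier L" for x
      unfolding f_def using lin_comb_closed[OF N cD(1)[OF that] y] .
    show "f (x \<oplus>\<^bsub>L\<^esub> z) = f x \<oplus>\<^bsub>N\<^esub> f z" if xz: "x \<in> carrier L" "z \<in> carrier L" for x z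
    proof -
      note c = cD[OF xz(1)] and d = cD[OF xz(2)]
      have fin: "finite {b \<in> B. coef x b \<oplus>\<^bsub>R\<^esub> coef z b \<noteq> \<zero>\<^bsub>R\<^esub>}"
        by (rule finite_subset[OF _ finite_UnI[OF c(2) d(2)]]) auto
      have "f (x \<oplus>\<^bsub>L\<^esub> z) = lin_comb R N y (\<lambda>b. coef x b \<oplus>\<^bsub>R\<^esub> coef z b) B" unfolding f_def
      proof (rule coefI)
        show "x \<oplus>\<^bsub>L\<^esub> z = lin_comb R L (\<lambda>b. b) (\<lambda>b. coef x b \<oplus>\<^bsub>R\<^esub> coef z b) B"
          using lin_comb_add[OF L BL(2) c(2,1) d(2,1)] c(3) d(3) by simp
      qed (use xz c d fin in \<open>auto simp: Pi_iff\<close>)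
      thus ?thesis unfolding f_def using lin_comb_add[OF N y c(2,1) d(2,1)] by simp
    qed
    show "f (a \<odot>\<^bsub>L\<^esub> x) = a \<odot>\<^bsub>N\<^esub> f x" if ax: "a \<in> carrier R" "x \<in> carrier L" for a x
    proof -
      note c = cD[OF ax(2)]
      have fin: "finite {b \<in> B. a \<otimes>\<^bsub>R\<^esub> coef x b \<noteq> \<zero>\<^bsub>R\<^esub>}"
        by (rule finite_subset[OF _ c(2)]) (use ax in auto)
      have "f (a \<odot>\<^bsub>L\<^esub> x) = lin_comb R N y (\<lambda>b. a \<otimes>\<^bsub>R\<^esub> coef x b) B" unfolding f_def
      proof (rule coefI)
        show "a \<odot>\<^bsub>L\<^esub> x = lin_comb R L (\<lambda>b. b) (\<lambda>b. a \<otimes>\<^bsub>R\<^esub> coef x b) B"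
          using lin_comb_smult[OF L BL(2) ax(1) c(2,1)] c(3) by simp
      qed (use ax c fin L.smult_closed in \<open>auto simp: Pi_iff\<close>)
      thus ?thesis unfolding f_def using lin_comb_smult[OF N y ax(1) c(2,1)] by simp
    qed
  qed
  moreover have "f b = y b" if b: "b \<in> B" for b
  proof -
    let ?c = "\<lambda>b'. if b' = b then \<one>\<^bsub>R\<^esub> else \<zero>\<^bsub>R\<^esub>"
    have fin: "finite {b' \<in> B. ?c b' \<noteq> \<zero>\<^bsub>R\<^esub>}" by (rule finite_subset[of _ "{b}"]) auto
    have lc: "lin_comb R K z ?c B = z b" if "left_module R K" "z \<in> B \<rightarrow> carrier K"
      for K :: "('a, 'x) module" and z
    proof -
      interpret K: left_module R K by fact
      have "lin_comb R K z ?c B = (\<Oplus>\<^bsub>K\<^esub>b'\<in>{b}. ?c b' \<odot>\<^bsub>K\<^esub> z b')"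
        by (rule lin_comb_eq) (use that b in auto)
      thus ?thesis using that b K.smult_one by (simp add: Pi_iff)
    qed
    have "f b = lin_comb R N y ?c B" unfolding f_def
      by (rule coefI) (use b BL fin lc[OF L BL(2)] in auto)
    thus ?thesis using lc[OF N y] by simp
  qed
  ultimately show ?thesis by blast
qed

lemma left_module_hom_eq_on_basis:
  assumes "left_module R L" "is_basis R L B" "left_module R N"
    and f: "f \<in> left_module_hom R L N" and g: "g \<in> left_module_hom R L N"
    and eq: "\<And>b. b \<in> B \<Longrightarrow> f b = g b" and x: "x \<in> carrier L"
  shows "f x = g x"
proof -
  obtain c where "c \<in> B \<rightarrow>\<^sub>E carrier R \<and> finite {b \<in> B. c b \<noteq> \<zero>\<^bsub>R\<^esub>} \<and> x = lin_comb R L (\<lambda>b. b) c B"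
    using assms(2)[unfolded is_basis_lin_comb, THEN conjunct2, rule_format, OF x] by (rule ex1E)
  hence c: "c \<in> B \<rightarrow> carrier R" "finite {b \<in> B. c b \<noteq> \<zero>\<^bsub>R\<^esub>}" "x = lin_comb R L (\<lambda>b. b) c B"
    by auto
  have B: "(\<lambda>b. b) \<in> B \<rightarrow> carrier L" using assms(2) by (auto simp: is_basis_def)
  interpret N: left_module R N by fact
  have "lin_comb R N f c B = lin_comb R N g c B" unfolding lin_comb_def
    by (rule N.M.finsum_cong')
      (use eq c B left_module_homD(1)[OF g] N.smult_closed in \<open>auto simp: Pi_iff\<close>)
  thus ?thesis
    using left_module_hom_lin_comb[OF f assms(1,3) c(2,1) B]
      left_module_hom_lin_comb[OF g assms(1,3) c(2,1) B] c(3) by simp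
qed

text \<open>The composite of \<alpha> with the retraction is lifted on a basis of the free module
  and then restricted along \<iota>. Requiring an inclusion of images instead of surjectivity of
  \<beta> lets exactness be plugged in directly.\<close>

lemma projective_lift:
  fixes R :: "('r, 'c) ring_scheme" and P :: "('r, 'm) module"
  assumes P: "projective_module R P" and N: "left_module R N" and N': "left_module R N'"
    and \<alpha>: "\<alpha> \<in> left_module_hom R P N'" and \<beta>: "\<beta> \<in> left_module_hom R N N'"
    and sub: "\<alpha> ` carrier P \<subseteq> \<beta> ` carrier N"
  shows "\<exists>\<gamma> \<in> left_module_hom R P N. \<forall>x\<in>carrier P. \<beta> (\<gamma> x) = \<alpha> x"
proof -
  obtain L :: "('r, 'm \<Rightarrow> 'r) module" and \<iota> \<pi> where L: "free_module R L" and \<iota>: "\<iota> \<in> left_module_hom R P L"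
    and \<pi>: "\<pi> \<in> left_module_hom R L P" and r: "\<And>x. x \<in> carrier P \<Longrightarrow> \<pi> (\<iota> x) = x"
    using P unfolding projective_module_def by auto
  obtain B where LM: "left_module R L" and B: "is_basis R L B"
    using L unfolding free_module_def by blast
  have BL: "B \<subseteq> carrier L" using B by (simp add: is_basis_def)
  have "\<exists>z. z \<in> carrier N \<and> \<beta> z = \<alpha> (\<pi> b)" if "b \<in> B" for b
  proof -
    have "\<pi> b \<in> carrier P" using left_module_homD(1)[OF \<pi>] subsetD[OF BL that] by simp
    hence "\<alpha> (\<pi> b) \<in> \<beta> ` carrier N" by (intro subsetD[OF sub] imageI)
    thus ?thesis by auto
  qed
  then obtain y where y: "\<And>b. b \<in> B \<Longrightarrow> y b \<in> carrier N \<and> \<beta> (y b) = \<alpha> (\<pi> b)" by metis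
  obtain f where f: "f \<in> left_module_hom R L N" "\<And>b. b \<in> B \<Longrightarrow> f b = y b"
    using basis_extension[OF LM B N, of y] y by blast
  have "\<beta> (f x) = \<alpha> (\<pi> x)" if "x \<in> carrier L" for x
    by (rule left_module_hom_eq_on_basis[OF LM B N' left_module_hom_comp[OF f(1) \<beta>]
          left_module_hom_comp[OF \<pi> \<alpha>] _ that]) (simp add: f y)
  hence "\<forall>x\<in>carrier P. \<beta> (f (\<iota> x)) = \<alpha> x" using left_module_homD(1)[OF \<iota>] r by simp
  thus ?thesis by (rule bexI[OF _ left_module_hom_comp[OF \<iota> f(1)]])
qed

text \<open>For finite \<open>B\<close> all sums may run over \<open>B\<close> instead of a support,
  and unique coordinates split into spanning and independence.\<close>

lemma is_basis_finiteI:
  assumes M: "left_module R M" and B: "finite B" "B \<subseteq> carrier M"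
    and span: "\<And>x. x \<in> carrier M \<Longrightarrow> \<exists>c \<in> B \<rightarrow> carrier R. x = (\<Oplus>\<^bsub>M\<^esub>b\<in>B. c b \<odot>\<^bsub>M\<^esub> b)"
    and indep: "\<And>c b. c \<in> B \<rightarrow> carrier R \<Longrightarrow> (\<Oplus>\<^bsub>M\<^esub>b\<in>B. c b \<odot>\<^bsub>M\<^esub> b) = \<zero>\<^bsub>M\<^esub> \<Longrightarrow> b \<in> B \<Longrightarrow> c b = \<zero>\<^bsub>R\<^esub>"
  shows "is_basis R M B"
  unfolding is_basis_lin_comb
proof (intro conjI ballI ex_ex1I)
  interpret left_module R M by fact
  have Bid: "(\<lambda>b. b) \<in> B \<rightarrow> carrier M" using B by auto
  have lc: "lin_comb R M (\<lambda>b. b) c B = (\<Oplus>\<^bsub>M\<^esub>b\<in>B. c b \<odot>\<^bsub>M\<^esub> b)" if "c \<in> B \<rightarrow> carrier R" for c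
    by (rule lin_comb_eq[OF M B(1) _ _ that Bid]) auto
  show "B \<subseteq> carrier M" by fact
  fix x assume x: "x \<in> carrier M"
  obtain c where c: "c \<in> B \<rightarrow> carrier R" "x = (\<Oplus>\<^bsub>M\<^esub>b\<in>B. c b \<odot>\<^bsub>M\<^esub> b)" using span[OF x] by blast
  have "x = lin_comb R M (\<lambda>b. b) (restrict c B) B"
    using lin_comb_cong[OF _ M Bid c(1), of "restrict c B"] lc[OF c(1)] c(2) by simp
  moreover have "restrict c B \<in> B \<rightarrow>\<^sub>E carrier R" using c(1) by (simp add: restrict_PiE_iff Pi_iff)
  ultimately show "\<exists>c. c \<in> B \<rightarrow>\<^sub>E carrier R \<and> finite {b \<in> B. c b \<noteq> \<zero>\<^bsub>R\<^esub>} \<and> x = lin_comb R M (\<lambda>b. b) c B"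
    using B(1) by (intro exI[of _ "restrict c B"]) auto
  fix c d
  assume A1: "c \<in> B \<rightarrow>\<^sub>E carrier R \<and> finite {b \<in> B. c b \<noteq> \<zero>\<^bsub>R\<^esub>} \<and> x = lin_comb R M (\<lambda>b. b) c B"
    and A2: "d \<in> B \<rightarrow>\<^sub>E carrier R \<and> finite {b \<in> B. d b \<noteq> \<zero>\<^bsub>R\<^esub>} \<and> x = lin_comb R M (\<lambda>b. b) d B"
  have c: "c \<in> B \<rightarrow>\<^sub>E carrier R" "x = lin_comb R M (\<lambda>b. b) c B" using A1 by simp_all
  have d: "d \<in> B \<rightarrow>\<^sub>E carrier R" "x = lin_comb R M (\<lambda>b. b) d B" using A2 by simp_all
  have c': "c \<in> B \<rightarrow> carrier R" and d': "d \<in> B \<rightarrow> carrier R" using c d by auto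
  \<comment> \<open>The difference of two representations, written as a sum with the multiple of
    \<open>d\<close> by minus one, so that \<open>lin_comb_add\<close> and
    \<open>lin_comb_smult\<close> evaluate it.\<close>
  let ?m = "\<lambda>b. \<ominus>\<^bsub>R\<^esub> \<one>\<^bsub>R\<^esub> \<otimes>\<^bsub>R\<^esub> d b"
  have m: "?m \<in> B \<rightarrow> carrier R" using d' by auto
  have fin: "finite {b \<in> B. e b \<noteq> \<zero>\<^bsub>R\<^esub>}" for e using B(1) by simp
  have "lin_comb R M (\<lambda>b. b) (\<lambda>b. c b \<oplus>\<^bsub>R\<^esub> ?m b) B = x \<oplus>\<^bsub>M\<^esub> (\<ominus>\<^bsub>R\<^esub> \<one>\<^bsub>R\<^esub> \<odot>\<^bsub>M\<^esub> x)"
    using lin_comb_add[OF M Bid fin c' fin m] lin_comb_smult[OF M Bid _ fin d', of "\<ominus>\<^bsub>R\<^esub> \<one>\<^bsub>R\<^esub>"] c(2) d(2)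
    by simp
  also have "\<dots> = (\<one>\<^bsub>R\<^esub> \<oplus>\<^bsub>R\<^esub> \<ominus>\<^bsub>R\<^esub> \<one>\<^bsub>R\<^esub>) \<odot>\<^bsub>M\<^esub> x" using x smult_l_distr[of "\<one>\<^bsub>R\<^esub>" "\<ominus>\<^bsub>R\<^esub> \<one>\<^bsub>R\<^esub>" x] smult_one by simp
  also have "\<dots> = \<zero>\<^bsub>M\<^esub>" using x smult_l_null by (simp add: R.r_neg)
  finally have "lin_comb R M (\<lambda>b. b) (\<lambda>b. c b \<oplus>\<^bsub>R\<^esub> ?m b) B = \<zero>\<^bsub>M\<^esub>" .
  moreover have cm: "(\<lambda>b. c b \<oplus>\<^bsub>R\<^esub> ?m b) \<in> B \<rightarrow> carrier R" using c' m by auto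
  ultimately have z: "c b \<oplus>\<^bsub>R\<^esub> ?m b = \<zero>\<^bsub>R\<^esub>" if "b \<in> B" for b
    using indep[OF cm _ that] lc[OF cm] by simp
  show "c = d"
  proof (rule PiE_ext[OF c(1) d(1)])
    fix b assume b: "b \<in> B"
    have cb: "c b \<in> carrier R" "d b \<in> carrier R" using c' d' b by auto
    hence "c b \<oplus>\<^bsub>R\<^esub> \<ominus>\<^bsub>R\<^esub> d b = \<zero>\<^bsub>R\<^esub>" using z[OF b] by (simp add: R.l_minus)
    thus "c b = d b" using cb R.minus_equality[of "c b" "\<ominus>\<^bsub>R\<^esub> d b"] by simp
  qed
qed

lemma is_basis_finiteD:
  assumes M: "left_module R M" and B: "finite B" "is_basis R M B"
  shows "x \<in> carrier M \<Longrightarrow> \<exists>c \<in> B \<rightarrow> carrier R. x = (\<Oplus>\<^bsub>M\<^esub>b\<in>B. c b \<odot>\<^bsub>M\<^esub> b)"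
    and "c \<in> B \<rightarrow> carrier R \<Longrightarrow> (\<Oplus>\<^bsub>M\<^esub>b\<in>B. c b \<odot>\<^bsub>M\<^esub> b) = \<zero>\<^bsub>M\<^esub> \<Longrightarrow> b \<in> B \<Longrightarrow> c b = \<zero>\<^bsub>R\<^esub>"
proof -
  interpret left_module R M by fact
  have BM: "B \<subseteq> carrier M" using B by (simp add: is_basis_def)
  have Bid: "(\<lambda>b. b) \<in> B \<rightarrow> carrier M" using BM by auto
  have lc: "lin_comb R M (\<lambda>b. b) c B = (\<Oplus>\<^bsub>M\<^esub>b\<in>B. c b \<odot>\<^bsub>M\<^esub> b)" if "c \<in> B \<rightarrow> carrier R" for c
    by (rule lin_comb_eq[OF M B(1) _ _ that Bid]) auto
  note ex1 = B(2)[unfolded is_basis_lin_comb, THEN conjunct2, rule_format]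
  show "\<exists>c \<in> B \<rightarrow> carrier R. x = (\<Oplus>\<^bsub>M\<^esub>b\<in>B. c b \<odot>\<^bsub>M\<^esub> b)" if x: "x \<in> carrier M"
  proof -
    obtain c where "c \<in> B \<rightarrow>\<^sub>E carrier R \<and> finite {b \<in> B. c b \<noteq> \<zero>\<^bsub>R\<^esub>} \<and> x = lin_comb R M (\<lambda>b. b) c B"
      using ex1[OF x] by (rule ex1E)
    thus ?thesis using lc[of c] by (intro bexI[of _ c]) auto
  qed
  assume c: "c \<in> B \<rightarrow> carrier R" "(\<Oplus>\<^bsub>M\<^esub>b\<in>B. c b \<odot>\<^bsub>M\<^esub> b) = \<zero>\<^bsub>M\<^esub>" and b: "b \<in> B"
  have "restrict c B \<in> B \<rightarrow>\<^sub>E carrier R" "\<zero>\<^bsub>M\<^esub> = lin_comb R M (\<lambda>b. b) (restrict c B) B"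
    using c lc[OF c(1)] lin_comb_cong[OF _ M Bid c(1), of "restrict c B"] by auto
  moreover have "(\<lambda>b\<in>B. \<zero>\<^bsub>R\<^esub>) \<in> B \<rightarrow>\<^sub>E carrier R" "\<zero>\<^bsub>M\<^esub> = lin_comb R M (\<lambda>b. b) (\<lambda>b\<in>B. \<zero>\<^bsub>R\<^esub>) B"
  proof -
    have "{b \<in> B. (\<lambda>b\<in>B. \<zero>\<^bsub>R\<^esub>) b \<noteq> \<zero>\<^bsub>R\<^esub>} = {}" by auto
    thus "\<zero>\<^bsub>M\<^esub> = lin_comb R M (\<lambda>b. b) (\<lambda>b\<in>B. \<zero>\<^bsub>R\<^esub>) B" unfolding lin_comb_def by (simp only: M.finsum_empty)
  qed auto
  ultimately have "restrict c B = (\<lambda>b\<in>B. \<zero>\<^bsub>R\<^esub>)"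
    using ex1[OF M.zero_closed] finite_subset[OF _ B(1)] by (elim ex1E) (metis (no_types, lifting) mem_Collect_eq subsetI)
  thus "c b = \<zero>\<^bsub>R\<^esub>" using b by (metis restrict_apply')
qed

section \<open>Permutation modules over the group ring\<close>

text \<open>The common shape of the product in the group ring and of its action on a permutation
  module, so that both inherit their laws from the same lemmas.\<close>

definition frag_bilinear :: "('g \<Rightarrow> 'x \<Rightarrow> 'y) \<Rightarrow> ('g \<Rightarrow>\<^sub>0 int) \<Rightarrow> ('x \<Rightarrow>\<^sub>0 int) \<Rightarrow> ('y \<Rightarrow>\<^sub>0 int)" where
  "frag_bilinear act a c = frag_extend (\<lambda>g. frag_extend (\<lambda>x. frag_of (act g x)) c) a"

lemma frag_bilinear_simps [simp]:
  "frag_bilinear act 0 c = 0"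
  "frag_bilinear act a 0 = 0"
  "frag_bilinear act (frag_of g) (frag_of x) = frag_of (act g x)"
  "frag_bilinear act (a - b) c = frag_bilinear act a c - frag_bilinear act b c"
  "frag_bilinear act a (c - d) = frag_bilinear act a c - frag_bilinear act a d"
proof -
  show "frag_bilinear act a 0 = 0" by (simp add: frag_bilinear_def frag_extend_eq_0)
  show "frag_bilinear act a (c - d) = frag_bilinear act a c - frag_bilinear act a d"
    unfolding frag_bilinear_def
    by (induction a rule: frag_UNIV_induct) (auto simp: frag_extend_diff)
qed (simp_all add: frag_bilinear_def frag_extend_diff)

lemma frag_bilinear_add:
  "frag_bilinear act (a + b) c = frag_bilinear act a c + frag_bilinear act b c"
  "frag_bilinear act a (c + d) = frag_bilinear act a c + frag_bilinear act a d"
proof -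
  show "frag_bilinear act a (c + d) = frag_bilinear act a c + frag_bilinear act a d"
    unfolding frag_bilinear_def
    by (induction a rule: frag_UNIV_induct) (auto simp: frag_extend_add frag_extend_diff)
qed (simp add: frag_bilinear_def frag_extend_add)

lemma keys_frag_bilinear:
  assumes "\<And>g x. g \<in> Poly_Mapping.keys a \<Longrightarrow> x \<in> Poly_Mapping.keys c \<Longrightarrow> act g x \<in> S"
  shows "Poly_Mapping.keys (frag_bilinear act a c) \<subseteq> S"
  unfolding frag_bilinear_def
  by (intro keys_frag_extend_subset) (use assms in auto)

text \<open>By trilinearity it is enough to compare basis elements. Four independent operations
  cover both associativity of the ring and its compatibility with an action.\<close>

lemma frag_bilinear_assoc:
  assumes "Poly_Mapping.keys a \<subseteq> A" "Poly_Mapping.keys b \<subseteq> B" "Poly_Mapping.keys c \<subseteq> C"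
    and "\<And>g h x. g \<in> A \<Longrightarrow> h \<in> B \<Longrightarrow> x \<in> C \<Longrightarrow> act1 (act2 g h) x = act3 g (act4 h x)"
  shows "frag_bilinear act1 (frag_bilinear act2 a b) c = frag_bilinear act3 a (frag_bilinear act4 b c)"
  using assms(1)
proof (induction a rule: frag_induction)
  case (one g)
  show ?case using assms(2)
  proof (induction b rule: frag_induction)
    case (one h)
    show ?case using assms(3)
      by (induction c rule: frag_induction) (use assms(4) \<open>g \<in> A\<close> one in auto)
  qed auto
qed auto

lemma frag_bilinear_unit:
  assumes "Poly_Mapping.keys c \<subseteq> C"
  shows "(\<And>x. x \<in> C \<Longrightarrow> act e x = x) \<Longrightarrow> frag_bilinear act (frag_of e) c = c"
    and "(\<And>x. x \<in> C \<Longrightarrow> act' x e' = x) \<Longrightarrow> frag_bilinear act' c (frag_of e') = c"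
  using assms by (induction c rule: frag_induction) auto

section \<open>The integral group ring\<close>

lemma group_ring_simps [simp]:
  "a \<in> carrier (group_ring G) \<longleftrightarrow> Poly_Mapping.keys a \<subseteq> carrier G"
  "\<zero>\<^bsub>group_ring G\<^esub> = 0"
  "\<one>\<^bsub>group_ring G\<^esub> = frag_of \<one>\<^bsub>G\<^esub>"
  "a \<oplus>\<^bsub>group_ring G\<^esub> b = a + b"
  "a \<otimes>\<^bsub>group_ring G\<^esub> b = frag_bilinear (\<otimes>\<^bsub>G\<^esub>) a b"
  by (simp_all add: group_ring_def frag_bilinear_def)

lemma (in group) ring_group_ring: "ring (group_ring G)"
proof (rule ringI)
  show "abelian_group (group_ring G)"
  proof (rule abelian_groupI)
    fix x assume "x \<in> carrier (group_ring G)"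
    thus "\<exists>y\<in>carrier (group_ring G). y \<oplus>\<^bsub>group_ring G\<^esub> x = \<zero>\<^bsub>group_ring G\<^esub>"
      by (intro bexI[of _ "- x"]) auto
  qed (auto simp: add_ac intro: subsetD[OF keys_add_subset])
  show "monoid (group_ring G)"
  proof (rule monoidI)
    fix x y z :: "'a \<Rightarrow>\<^sub>0 int"
    assume c: "x \<in> carrier (group_ring G)" "y \<in> carrier (group_ring G)" "z \<in> carrier (group_ring G)"
    thus "x \<otimes>\<^bsub>group_ring G\<^esub> y \<in> carrier (group_ring G)"
      by (auto intro!: keys_frag_bilinear)
    show "x \<otimes>\<^bsub>group_ring G\<^esub> y \<otimes>\<^bsub>group_ring G\<^esub> z = x \<otimes>\<^bsub>group_ring G\<^esub> (y \<otimes>\<^bsub>group_ring G\<^esub> z)"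
      using c unfolding group_ring_simps
      by (rule frag_bilinear_assoc) (simp add: m_assoc)
  qed (auto intro!: frag_bilinear_unit[where C = "carrier G"])
qed (simp_all add: frag_bilinear_add)

section \<open>Permutation modules and free actions\<close>

definition permutation_module :: "('g \<Rightarrow> 'x \<Rightarrow> 'x) \<Rightarrow> 'x set \<Rightarrow> ('g \<Rightarrow>\<^sub>0 int, 'x \<Rightarrow>\<^sub>0 int) module" where
  "permutation_module act X = \<lparr>carrier = {c. Poly_Mapping.keys c \<subseteq> X}, monoid.mult = (\<lambda>_ _. 0),
     monoid.one = 0, ring.zero = 0, ring.add = (+), smult = frag_bilinear act\<rparr>"

lemma permutation_module_simps [simp]:
  "c \<in> carrier (permutation_module act X) \<longleftrightarrow> Poly_Mapping.keys c \<subseteq> X"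
  "\<zero>\<^bsub>permutation_module act X\<^esub> = 0"
  "c \<oplus>\<^bsub>permutation_module act X\<^esub> d = c + d"
  "a \<odot>\<^bsub>permutation_module act X\<^esub> c = frag_bilinear act a c"
  by (simp_all add: permutation_module_def)

locale group_set = group G for G (structure) +
  fixes act :: "'a \<Rightarrow> 'x \<Rightarrow> 'x" and X :: "'x set"
  assumes act_closed: "g \<in> carrier G \<Longrightarrow> x \<in> X \<Longrightarrow> act g x \<in> X"
    and act_one: "x \<in> X \<Longrightarrow> act \<one> x = x"
    and act_mult: "g \<in> carrier G \<Longrightarrow> h \<in> carrier G \<Longrightarrow> x \<in> X \<Longrightarrow> act (g \<otimes> h) x = act g (act h x)"
begin

lemma left_module_permutation_module: "left_module (group_ring G) (permutation_module act X)"
proof (intro left_module.intro left_module_axioms.intro ring_group_ring)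
  show "abelian_group (permutation_module act X)"
  proof (rule abelian_groupI)
    fix x assume "x \<in> carrier (permutation_module act X)"
    thus "\<exists>y\<in>carrier (permutation_module act X). y \<oplus>\<^bsub>permutation_module act X\<^esub> x = \<zero>\<^bsub>permutation_module act X\<^esub>"
      by (intro bexI[of _ "- x"]) auto
  qed (auto simp: add_ac intro: subsetD[OF keys_add_subset])
  fix a b :: "'a \<Rightarrow>\<^sub>0 int" and x :: "'x \<Rightarrow>\<^sub>0 int"
  assume c: "a \<in> carrier (group_ring G)" "b \<in> carrier (group_ring G)" "x \<in> carrier (permutation_module act X)"
  show "(a \<otimes>\<^bsub>group_ring G\<^esub> b) \<odot>\<^bsub>permutation_module act X\<^esub> x
      = a \<odot>\<^bsub>permutation_module act X\<^esub> (b \<odot>\<^bsub>permutation_module act X\<^esub> x)"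
    using c unfolding group_ring_simps permutation_module_simps
    by (rule frag_bilinear_assoc) (simp add: act_mult)
qed (auto simp: frag_bilinear_add act_one intro!: frag_bilinear_unit[where C = X] keys_frag_bilinear
      intro: act_closed)

lemma finsum_permutation_module:
  assumes "finite A" "f \<in> A \<rightarrow> carrier (permutation_module act X)"
  shows "finsum (permutation_module act X) f A = sum f A"
proof -
  interpret left_module "group_ring G" "permutation_module act X" by (rule left_module_permutation_module)
  show ?thesis using assms by (induction A rule: finite_induct) auto
qed

text \<open>\<open>W\<close> represents the orbits of a free action, so each element of
  \<open>X\<close> is \<open>act g w\<close> for exactly one pair. Existence of the pair gives
  spanning, its uniqueness gives independence.\<close>

lemma fg_free_permutation_module:
  assumes "finite W" "W \<subseteq> X"
    and orbits: "\<And>x. x \<in> X \<Longrightarrow> \<exists>g\<in>carrier G. \<exists>w\<in>W. x = act g w"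
    and free: "\<And>g h v w. g \<in> carrier G \<Longrightarrow> h \<in> carrier G \<Longrightarrow> v \<in> W \<Longrightarrow> w \<in> W \<Longrightarrow>
      act g v = act h w \<Longrightarrow> g = h \<and> v = w"
  shows "fg_free_module (group_ring G) (permutation_module act X)"
proof -
  let ?M = "permutation_module act X" and ?B = "frag_of ` W"
  interpret left_module "group_ring G" "permutation_module act X" by (rule left_module_permutation_module)
  have inj: "inj_on frag_of W" by (auto simp: inj_on_def frag_of_eq)
  have lc: "(\<Oplus>\<^bsub>?M\<^esub>b\<in>?B. c b \<odot>\<^bsub>?M\<^esub> b) = (\<Sum>w\<in>W. frag_bilinear act (c (frag_of w)) (frag_of w))"
    if "c \<in> ?B \<rightarrow> carrier (group_ring G)" for c
  proof -
    have "(\<Oplus>\<^bsub>?M\<^esub>b\<in>?B. c b \<odot>\<^bsub>?M\<^esub> b) = (\<Sum>b\<in>?B. frag_bilinear act (c b) b)"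
    proof (subst finsum_permutation_module)
      show "(\<lambda>b. c b \<odot>\<^bsub>?M\<^esub> b) \<in> ?B \<rightarrow> carrier ?M"
        by (rule funcsetI, rule smult_closed) (use that assms(2) in \<open>auto simp: Pi_iff\<close>)
    qed (use assms(1) in auto)
    thus ?thesis by (simp add: sum.reindex[OF inj])
  qed
  have span: "\<exists>c. (\<forall>w. c w \<in> carrier (group_ring G)) \<and> x = (\<Sum>w\<in>W. frag_bilinear act (c w) (frag_of w))"
    if "Poly_Mapping.keys x \<subseteq> X" for x
    using that
  proof (induction x rule: frag_induction)
    case zero
    show ?case by (rule exI[of _ "\<lambda>_. 0"]) simp
  next
    case (one x)
    obtain g w where gw: "g \<in> carrier G" "w \<in> W" "x = act g w" using orbits[OF one] by blast
    have "(\<Sum>v\<in>W. frag_bilinear act (if v = w then frag_of g else 0) (frag_of v))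
        = (\<Sum>v\<in>W. if v = w then frag_of x else 0)"
      by (rule sum.cong) (auto simp: gw)
    also have "\<dots> = frag_of x" using gw assms(1) by simp
    finally show ?case using gw by (intro exI[of _ "\<lambda>v. if v = w then frag_of g else 0"]) auto
  next
    case (diff a b)
    then obtain c d where cd: "\<forall>w. c w \<in> carrier (group_ring G)" "a = (\<Sum>w\<in>W. frag_bilinear act (c w) (frag_of w))"
      "\<forall>w. d w \<in> carrier (group_ring G)" "b = (\<Sum>w\<in>W. frag_bilinear act (d w) (frag_of w))" by blast
    have "\<forall>w. c w - d w \<in> carrier (group_ring G)"
      unfolding group_ring_simps by (intro allI keys_diff_subset) (use cd in simp_all)
    thus ?case using cd by (intro exI[of _ "\<lambda>w. c w - d w"]) (simp add: sum_subtractf)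
  qed
  \<comment> \<open>The coefficient of \<open>act g w\<close> isolates a single integer: it sees
    only the summand of \<open>w\<close>, and in it only the coefficient of
    \<open>g\<close>.\<close>
  have coeff: "Poly_Mapping.lookup (frag_bilinear act a (frag_of v)) (act g w) = (if v = w then Poly_Mapping.lookup a g else 0)"
    if "Poly_Mapping.keys a \<subseteq> carrier G" "v \<in> W" "w \<in> W" "g \<in> carrier G" for a v w g
    using that(1)
  proof (induction a rule: frag_induction)
    case (one h)
    thus ?case using free[of g h w v] that by auto
  next
    case (diff a b)
    thus ?case by (simp add: lookup_minus)
  qed auto
  have "is_basis (group_ring G) ?M ?B"
  proof (rule is_basis_finiteI[OF left_module_permutation_module])
    show "finite ?B" "?B \<subseteq> carrier ?M" using assms(1,2) by auto
    fix x assume x: "x \<in> carrier ?M"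
    then obtain c where c: "\<forall>w. c w \<in> carrier (group_ring G)" "x = (\<Sum>w\<in>W. frag_bilinear act (c w) (frag_of w))"
      using span[of x] by auto
    let ?c = "\<lambda>b. c (the_inv_into W frag_of b)"
    have "?c \<in> ?B \<rightarrow> carrier (group_ring G)" using c by auto
    moreover from lc[OF this] have "x = (\<Oplus>\<^bsub>?M\<^esub>b\<in>?B. ?c b \<odot>\<^bsub>?M\<^esub> b)"
      using c(2) by (simp add: the_inv_into_f_f[OF inj])
    ultimately show "\<exists>c\<in>?B \<rightarrow> carrier (group_ring G). x = (\<Oplus>\<^bsub>?M\<^esub>b\<in>?B. c b \<odot>\<^bsub>?M\<^esub> b)"
      by (intro bexI[of _ ?c])
  next
    fix c b
    assume c: "c \<in> ?B \<rightarrow> carrier (group_ring G)" "(\<Oplus>\<^bsub>?M\<^esub>b\<in>?B. c b \<odot>\<^bsub>?M\<^esub> b) = \<zero>\<^bsub>?M\<^esub>" and b: "b \<in> ?B"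
    obtain w where w: "w \<in> W" "b = frag_of w" using b by blast
    have cw: "Poly_Mapping.keys (c (frag_of v)) \<subseteq> carrier G" if "v \<in> W" for v
      using funcset_mem[OF c(1) imageI[OF that]] by simp
    have "Poly_Mapping.lookup (c b) g = 0" for g
    proof (cases "g \<in> carrier G")
      case True
      have "0 = Poly_Mapping.lookup (\<Sum>v\<in>W. frag_bilinear act (c (frag_of v)) (frag_of v)) (act g w)"
        using lc[OF c(1)] c(2) by simp
      also have "\<dots> = (\<Sum>v\<in>W. if v = w then Poly_Mapping.lookup (c (frag_of v)) g else 0)"
        unfolding lookup_sum by (rule sum.cong) (use coeff[OF cw] w True in auto)
      also have "\<dots> = Poly_Mapping.lookup (c b) g" using w assms(1) by simp
      finally show ?thesis by simp
    next
      case False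
      thus ?thesis using cw[OF w(1)] w(2) by (auto simp: not_in_keys_iff_lookup_eq_zero[symmetric])
    qed
    thus "c b = \<zero>\<^bsub>group_ring G\<^esub>" by (simp add: poly_mapping_eqI)
  qed
  thus ?thesis unfolding fg_free_module_def
    using left_module_permutation_module assms(1) by blast
qed

end

section \<open>The augmentation and the trivial module\<close>

definition augmentation :: "('g \<Rightarrow>\<^sub>0 int) \<Rightarrow> int" where
  "augmentation a = (\<Sum>g\<in>Poly_Mapping.keys a. Poly_Mapping.lookup a g)"

text \<open>Seen as the map induced by collapsing the group to a point, the augmentation is visibly
  additive, which a sum over a varying support is not.\<close>

lemma augmentation_eq: "augmentation a = Poly_Mapping.lookup (frag_extend (\<lambda>_. frag_of ()) a) ()"
  unfolding augmentation_def frag_extend_def lookup_sum by simp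

lemma augmentation_simps [simp]:
  "augmentation 0 = 0" "augmentation (frag_of g) = 1"
  "augmentation (a - b) = augmentation a - augmentation b"
  "augmentation (a + b) = augmentation a + augmentation b"
  by (simp_all add: augmentation_eq frag_extend_diff frag_extend_add lookup_minus lookup_add)

lemma augmentation_mult: "augmentation (frag_bilinear act a b) = augmentation a * augmentation b"
proof (induction a rule: frag_UNIV_induct)
  case (one g)
  show ?case by (induction b rule: frag_UNIV_induct) auto
qed (auto simp: algebra_simps)

lemma trivial_module_simps [simp]:
  "carrier trivial_module = UNIV" "\<zero>\<^bsub>trivial_module\<^esub> = 0"
  "m \<oplus>\<^bsub>trivial_module\<^esub> n = m + n" "a \<odot>\<^bsub>trivial_module\<^esub> n = augmentation a * n"
  by (simp_all add: trivial_module_def augmentation_def)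

lemma (in group) left_module_trivial_module: "left_module (group_ring G) trivial_module"
proof (intro left_module.intro left_module_axioms.intro ring_group_ring)
  show "abelian_group (trivial_module :: ('a \<Rightarrow>\<^sub>0 int, int) module)"
  proof (rule abelian_groupI)
    fix x :: int
    show "\<exists>y\<in>carrier trivial_module. y \<oplus>\<^bsub>trivial_module\<^esub> x = \<zero>\<^bsub>trivial_module\<^esub>"
      by (intro bexI[of _ "- x"]) auto
  qed auto
qed (simp_all add: algebra_simps augmentation_mult)

text \<open>A copy of \<open>M\<close> on another type. It serves to reach the types prescribed by
  \<open>type_FL\<close> and by \<open>projective_module\<close>.\<close>

definition transport_module :: "('m \<Rightarrow> 'n) \<Rightarrow> ('r, 'm) module \<Rightarrow> ('r, 'n) module" where
  "transport_module J M = \<lparr>carrier = J ` carrier M, monoid.mult = (\<lambda>_ _. J \<zero>\<^bsub>M\<^esub>), monoid.one = J \<zero>\<^bsub>M\<^esub>,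
     ring.zero = J \<zero>\<^bsub>M\<^esub>, ring.add = (\<lambda>x y. J (the_inv J x \<oplus>\<^bsub>M\<^esub> the_inv J y)),
     smult = (\<lambda>a x. J (a \<odot>\<^bsub>M\<^esub> the_inv J x))\<rparr>"

lemma transport_module_simps [simp]:
  "carrier (transport_module J M) = J ` carrier M" "\<zero>\<^bsub>transport_module J M\<^esub> = J \<zero>\<^bsub>M\<^esub>"
  by (simp_all add: transport_module_def)

lemma transport_module_ops [simp]:
  assumes "inj J"
  shows "J x \<oplus>\<^bsub>transport_module J M\<^esub> J y = J (x \<oplus>\<^bsub>M\<^esub> y)"
    "a \<odot>\<^bsub>transport_module J M\<^esub> J x = J (a \<odot>\<^bsub>M\<^esub> x)"
  by (simp_all add: transport_module_def the_inv_f_f[OF assms])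

lemma left_module_transport:
  assumes "left_module R M" "inj J" shows "left_module R (transport_module J M)"
proof -
  interpret left_module R M by fact
  show ?thesis
  proof (intro left_module.intro left_module_axioms.intro R.ring_axioms)
    show "abelian_group (transport_module J M)"
    proof (rule abelian_groupI)
      fix x assume "x \<in> carrier (transport_module J M)"
      then obtain u where "u \<in> carrier M" "x = J u" by auto
      thus "\<exists>y\<in>carrier (transport_module J M). y \<oplus>\<^bsub>transport_module J M\<^esub> x = \<zero>\<^bsub>transport_module J M\<^esub>"
        using assms(2) by (intro bexI[of _ "J (\<ominus>\<^bsub>M\<^esub> u)"]) (auto simp: M.l_neg)
    qed (use assms(2) in \<open>auto simp: M.a_ac\<close>)
  qed (use assms(2) smult_closed smult_l_distr smult_r_distr smult_assoc smult_one in auto)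
qed

lemma transport_hom: "inj J \<Longrightarrow> J \<in> left_module_hom R M (transport_module J M)"
  by (rule left_module_homI) auto

lemma transport_inv_hom: "inj J \<Longrightarrow> the_inv J \<in> left_module_hom R (transport_module J M) M"
  by (rule left_module_homI) (auto simp: the_inv_f_f)

lemma fg_free_transport:
  assumes "fg_free_module R M" "inj J" shows "fg_free_module R (transport_module J M)"
proof -
  obtain B where M: "left_module R M" and B: "finite B" "is_basis R M B"
    using assms(1) unfolding fg_free_module_def by blast
  let ?N = "transport_module J M"
  interpret M: left_module R M by fact
  interpret N: left_module R ?N by (rule left_module_transport) fact+
  note J = assms(2) and JN = left_module_transport[OF M assms(2)]
  have BM: "B \<subseteq> carrier M" using B(2) by (simp add: is_basis_def)
  have injB: "inj_on J B" using J by (rule inj_on_subset) simp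
  have lc: "(\<Oplus>\<^bsub>?N\<^esub>b\<in>J ` B. c b \<odot>\<^bsub>?N\<^esub> b) = J (\<Oplus>\<^bsub>M\<^esub>b\<in>B. c (J b) \<odot>\<^bsub>M\<^esub> b)"
    if c: "c \<in> J ` B \<rightarrow> carrier R" for c
  proof -
    have m: "(\<lambda>b. c (J b) \<odot>\<^bsub>M\<^esub> b) \<in> B \<rightarrow> carrier M" using c BM M.smult_closed by auto
    have "(\<Oplus>\<^bsub>?N\<^esub>b\<in>J ` B. c b \<odot>\<^bsub>?N\<^esub> b) = (\<Oplus>\<^bsub>?N\<^esub>b\<in>B. c (J b) \<odot>\<^bsub>?N\<^esub> J b)"
      by (rule N.M.add.finprod_reindex[OF _ injB]) (use m J in auto)
    also have "\<dots> = J (\<Oplus>\<^bsub>M\<^esub>b\<in>B. c (J b) \<odot>\<^bsub>M\<^esub> b)"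
      using left_module_hom_finsum[OF transport_hom[OF J] M JN B(1) m] J by simp
    finally show ?thesis .
  qed
  have "is_basis R ?N (J ` B)"
  proof (rule is_basis_finiteI[OF JN])
    show "finite (J ` B)" "J ` B \<subseteq> carrier ?N" using B BM by auto
    fix y assume "y \<in> carrier ?N"
    then obtain x where x: "x \<in> carrier M" "y = J x" by auto
    obtain c where c: "c \<in> B \<rightarrow> carrier R" "x = (\<Oplus>\<^bsub>M\<^esub>b\<in>B. c b \<odot>\<^bsub>M\<^esub> b)"
      using is_basis_finiteD(1)[OF M B x(1)] by (rule bexE)
    let ?c = "\<lambda>b. c (the_inv J b)"
    have c': "?c \<in> J ` B \<rightarrow> carrier R" using c J by (auto simp: the_inv_f_f)
    have "y = (\<Oplus>\<^bsub>?N\<^esub>b\<in>J ` B. ?c b \<odot>\<^bsub>?N\<^esub> b)" unfolding lc[OF c'] using c x J by (simp add: the_inv_f_f)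
    thus "\<exists>c \<in> J ` B \<rightarrow> carrier R. y = (\<Oplus>\<^bsub>?N\<^esub>b\<in>J ` B. c b \<odot>\<^bsub>?N\<^esub> b)" using c' by (rule bexI)
  next
    fix c b assume c: "c \<in> J ` B \<rightarrow> carrier R" "(\<Oplus>\<^bsub>?N\<^esub>b\<in>J ` B. c b \<odot>\<^bsub>?N\<^esub> b) = \<zero>\<^bsub>?N\<^esub>" and b: "b \<in> J ` B"
    obtain w where w: "w \<in> B" "b = J w" using b by blast
    have "J (\<Oplus>\<^bsub>M\<^esub>b\<in>B. c (J b) \<odot>\<^bsub>M\<^esub> b) = J \<zero>\<^bsub>M\<^esub>" using lc[OF c(1)] c(2) by simp
    hence "(\<Oplus>\<^bsub>M\<^esub>b\<in>B. c (J b) \<odot>\<^bsub>M\<^esub> b) = \<zero>\<^bsub>M\<^esub>" using J by (simp add: inj_eq)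
    thus "c b = \<zero>\<^bsub>R\<^esub>" using is_basis_finiteD(2)[OF M B, of "\<lambda>b. c (J b)" w] c(1) w by auto
  qed
  thus ?thesis unfolding fg_free_module_def using JN B(1) by blast
qed

text \<open>A free module is a retract of itself, but \<open>projective_module\<close> asks for a
  free module on a function type. Two distinct elements of the ring type give indicator functions of
  points, along which the module is copied.\<close>

lemma fg_free_imp_projective:
  fixes R :: "('r, 'c) ring_scheme" and M :: "('r, 'm) module"
  assumes "fg_free_module R M" "(a :: 'r) \<noteq> b"
  shows "projective_module R M"
proof -
  define J :: "'m \<Rightarrow> 'm \<Rightarrow> 'r" where "J x = (\<lambda>y. if y = x then a else b)" for x
  have J: "inj J" by (rule injI) (metis J_def assms(2))
  have "free_module R (transport_module J M)"
    using fg_free_transport[OF assms(1) J] by (auto simp: fg_free_module_def free_module_def)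
  thus ?thesis using assms(1) transport_hom[OF J] transport_inv_hom[OF J] the_inv_f_f[OF J]
    unfolding projective_module_def fg_free_module_def by blast
qed

lemma transport_resolution:
  assumes F: "resolution R F d \<epsilon> M" and J: "inj J"
  shows "resolution R (\<lambda>i. transport_module J (F i)) (\<lambda>i x. J (d i (the_inv J x))) (\<lambda>x. \<epsilon> (the_inv J x)) M"
proof -
  note F' = F[unfolded resolution_def]
  have d: "d i \<in> left_module_hom R (F (Suc i)) (F i)" for i using F' by blast
  have e: "\<epsilon> \<in> left_module_hom R (F 0) M" using F' by blast
  have inv: "the_inv J (J x) = x" for x using J by (rule the_inv_f_f)
  have im: "(\<lambda>x. J (d i (the_inv J x))) ` J ` A = J ` d i ` A" for i A by (auto simp: inv image_image)
  have J0: "J x = J y \<longleftrightarrow> x = y" for x y using J by (rule inj_eq)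
  show ?thesis unfolding resolution_def transport_module_simps im
  proof (intro conjI allI)
    show "left_module R M" "left_module R (transport_module J (F i))" for i
      using F' left_module_transport J by auto
    show "(\<lambda>x. J (d i (the_inv J x))) \<in> left_module_hom R (transport_module J (F (Suc i))) (transport_module J (F i))" for i
      by (intro left_module_hom_comp[OF left_module_hom_comp[OF transport_inv_hom[OF J] d] transport_hom[OF J]])
    show "(\<lambda>x. \<epsilon> (the_inv J x)) \<in> left_module_hom R (transport_module J (F 0)) M"
      by (intro left_module_hom_comp[OF transport_inv_hom[OF J] e])
    show "(\<lambda>x. \<epsilon> (the_inv J x)) ` J ` carrier (F 0) = carrier M" using F' by (simp add: image_image inv)
    have "d 0 ` carrier (F 1) = {x \<in> carrier (F 0). \<epsilon> x = \<zero>\<^bsub>M\<^esub>}" using F' by blast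
    thus "J ` d 0 ` carrier (F 1) = {x \<in> J ` carrier (F 0). \<epsilon> (the_inv J x) = \<zero>\<^bsub>M\<^esub>}"
      by (auto simp: inv)
    have "d (Suc i) ` carrier (F (Suc (Suc i))) = {x \<in> carrier (F (Suc i)). d i x = \<zero>\<^bsub>F i\<^esub>}" for i
      using F' by blast
    thus "J ` d (Suc i) ` carrier (F (Suc (Suc i))) =
      {x \<in> J ` carrier (F (Suc i)). J (d i (the_inv J x)) = J \<zero>\<^bsub>F i\<^esub>}" for i
      by (auto simp: inv J0)
  qed
qed

section \<open>Comparison of resolutions and cohomology\<close>

text \<open>Degree 0 uses the augmentation, so that exactness reads the same in all degrees: the
  image of \<open>d i\<close> is the set of cycles of degree \<open>i\<close>.\<close>

definition cycles :: "(nat \<Rightarrow> ('r, 'f) module) \<Rightarrow> (nat \<Rightarrow> 'f \<Rightarrow> 'f) \<Rightarrow> ('f \<Rightarrow> 'm) \<Rightarrow> ('r, 'm) module \<Rightarrow> nat \<Rightarrow> 'f set" where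
  "cycles F d \<epsilon> M n = {x \<in> carrier (F n). case n of 0 \<Rightarrow> \<epsilon> x = \<zero>\<^bsub>M\<^esub> | Suc m \<Rightarrow> d m x = \<zero>\<^bsub>F m\<^esub>}"

lemma resolutionD:
  assumes "resolution R F d \<epsilon> M"
  shows "left_module R M" "left_module R (F i)" "d i \<in> left_module_hom R (F (Suc i)) (F i)"
    "\<epsilon> \<in> left_module_hom R (F 0) M" "\<epsilon> ` carrier (F 0) = carrier M"
    "d i ` carrier (F (Suc i)) = cycles F d \<epsilon> M i"
proof -
  note A = assms[unfolded resolution_def]
  show "left_module R M" using A by (elim conjE)
  show "left_module R (F i)" using A by (elim conjE allE)
  show "d i \<in> left_module_hom R (F (Suc i)) (F i)" using A by (elim conjE) (erule spec)
  show "\<epsilon> \<in> left_module_hom R (F 0) M" using A by (elim conjE)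
  show "\<epsilon> ` carrier (F 0) = carrier M" using A by (elim conjE)
  have "d 0 ` carrier (F 1) = {x \<in> carrier (F 0). \<epsilon> x = \<zero>\<^bsub>M\<^esub>}" using A by (elim conjE)
  moreover have "\<forall>i. d (Suc i) ` carrier (F (Suc (Suc i))) = {x \<in> carrier (F (Suc i)). d i x = \<zero>\<^bsub>F i\<^esub>}"
    using A by (elim conjE)
  ultimately show "d i ` carrier (F (Suc i)) = cycles F d \<epsilon> M i"
    by (cases i) (simp_all add: cycles_def)
qed

lemma resolution_square_zero:
  assumes "resolution R F d \<epsilon> M" "x \<in> carrier (F (Suc (Suc i)))"
  shows "d i (d (Suc i) x) = \<zero>\<^bsub>F i\<^esub>"
  using resolutionD(6)[OF assms(1), of "Suc i"] assms(2) by (auto simp: cycles_def)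

text \<open>The existence half of the comparison theorem. Each stage keeps the invariant that cycles
  go to cycles, which by exactness of \<open>C\<close> puts the next map to be lifted into the image
  of \<open>d'\<close>.\<close>

lemma comparison_map:
  assumes F: "projective_resolution R F d \<epsilon> M" and C: "resolution R C d' \<epsilon>' M"
  shows "\<exists>\<phi>. (\<forall>i. \<phi> i \<in> left_module_hom R (F i) (C i)) \<and>
    (\<forall>x\<in>carrier (F 0). \<epsilon>' (\<phi> 0 x) = \<epsilon> x) \<and>
    (\<forall>i. \<forall>x\<in>carrier (F (Suc i)). d' i (\<phi> (Suc i) x) = \<phi> i (d i x))"
proof -
  have F': "resolution R F d \<epsilon> M" and proj: "\<And>i. projective_module R (F i)"
    using F by (auto simp: projective_resolution_def)
  note f = resolutionD[OF F'] and c = resolutionD[OF C]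
  define P where "P n \<phi> \<longleftrightarrow> \<phi> \<in> left_module_hom R (F n) (C n) \<and>
    \<phi> ` cycles F d \<epsilon> M n \<subseteq> cycles C d' \<epsilon>' M n \<and>
    (n = 0 \<longrightarrow> (\<forall>x\<in>carrier (F 0). \<epsilon>' (\<phi> x) = \<epsilon> x))" for n \<phi>
  define Q where "Q n \<phi> \<psi> \<longleftrightarrow> (\<forall>x\<in>carrier (F (Suc n)). d' n (\<psi> x) = \<phi> (d n x))" for n \<phi> \<psi>
  have "\<exists>\<phi>. P 0 \<phi>"
  proof -
    obtain \<phi> where p: "\<phi> \<in> left_module_hom R (F 0) (C 0)" "\<forall>x\<in>carrier (F 0). \<epsilon>' (\<phi> x) = \<epsilon> x"
    proof (rule bexE[OF projective_lift[OF proj c(2) c(1) f(4) c(4)]])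
      show "\<epsilon> ` carrier (F 0) \<subseteq> \<epsilon>' ` carrier (C 0)" by (simp add: f(5) c(5))
    qed
    have "P 0 \<phi>" unfolding P_def using p left_module_homD(1)[OF p(1)] by (auto simp: cycles_def)
    thus ?thesis by blast
  qed
  moreover have "\<exists>\<psi>. P (Suc n) \<psi> \<and> Q n \<phi> \<psi>" if P: "P n \<phi>" for n \<phi>
  proof -
    have p: "\<phi> \<in> left_module_hom R (F n) (C n)" "\<phi> ` cycles F d \<epsilon> M n \<subseteq> cycles C d' \<epsilon>' M n"
      using P by (auto simp: P_def)
    obtain \<psi> where q: "\<psi> \<in> left_module_hom R (F (Suc n)) (C (Suc n))"
      "\<forall>x\<in>carrier (F (Suc n)). d' n (\<psi> x) = \<phi> (d n x)"
    proof (rule bexE[OF projective_lift[OF proj c(2) c(2) left_module_hom_comp[OF f(3) p(1)] c(3)]])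
      show "(\<lambda>x. \<phi> (d n x)) ` carrier (F (Suc n)) \<subseteq> d' n ` carrier (C (Suc n))"
        using p(2) unfolding f(6)[symmetric] c(6)[symmetric] by auto
    qed
    have "P (Suc n) \<psi>" unfolding P_def
      using q left_module_homD(1)[OF q(1)] left_module_hom_zero[OF p(1) f(2) c(2)] by (auto simp: cycles_def)
    moreover have "Q n \<phi> \<psi>" unfolding Q_def by (rule q(2))
    ultimately show ?thesis by blast
  qed
  ultimately obtain \<phi> where \<phi>: "\<And>n. P n (\<phi> n) \<and> Q n (\<phi> n) (\<phi> (Suc n))"
    using dependent_nat_choice[of P Q] by metis
  show ?thesis
    by (intro exI[of _ \<phi>]) (use \<phi> in \<open>auto simp: P_def Q_def\<close>)
qed

text \<open>The uniqueness half of the comparison theorem: the next homotopy lifts \<theta> minus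
  the previous homotopy after \<open>d\<close>, a map with values in cycles.\<close>

lemma null_homotopy:
  assumes F: "projective_resolution R F d \<epsilon> M"
    and \<theta>: "\<And>i. \<theta> i \<in> left_module_hom R (F i) (F i)"
      "\<And>x. x \<in> carrier (F 0) \<Longrightarrow> \<epsilon> (\<theta> 0 x) = \<zero>\<^bsub>M\<^esub>"
      "\<And>i x. x \<in> carrier (F (Suc i)) \<Longrightarrow> d i (\<theta> (Suc i) x) = \<theta> i (d i x)"
  shows "\<exists>h. (\<forall>i. h i \<in> left_module_hom R (F i) (F (Suc i))) \<and>
    (\<forall>i. \<forall>x\<in>carrier (F (Suc i)). \<theta> (Suc i) x = d (Suc i) (h (Suc i) x) \<oplus>\<^bsub>F (Suc i)\<^esub> h i (d i x))"
proof -
  have F': "resolution R F d \<epsilon> M" and proj: "\<And>i. projective_module R (F i)"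
    using F by (auto simp: projective_resolution_def)
  note f = resolutionD[OF F']
  \<comment> \<open>On cycles the term with the previous homotopy vanishes. So \<open>P n\<close>
    can speak of a single map, and dependent choice along one sequence suffices.\<close>
  define P where "P n h \<longleftrightarrow> h \<in> left_module_hom R (F n) (F (Suc n)) \<and>
    (\<forall>x\<in>cycles F d \<epsilon> M n. d n (h x) = \<theta> n x)" for n h
  define Q where "Q n h k \<longleftrightarrow> (\<forall>x\<in>carrier (F (Suc n)). d (Suc n) (k x) = \<theta> (Suc n) x \<ominus>\<^bsub>F (Suc n)\<^esub> h (d n x))" for n h k
  have "\<exists>h. P 0 h"
  proof -
    obtain h where h: "h \<in> left_module_hom R (F 0) (F (Suc 0))" "\<forall>x\<in>carrier (F 0). d 0 (h x) = \<theta> 0 x"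
    proof (rule bexE[OF projective_lift[OF proj f(2) f(2) \<theta>(1) f(3)]])
      show "\<theta> 0 ` carrier (F 0) \<subseteq> d 0 ` carrier (F (Suc 0))"
        unfolding f(6) using \<theta>(2) left_module_homD(1)[OF \<theta>(1)] by (auto simp: cycles_def)
    qed
    hence "P 0 h" by (auto simp: P_def cycles_def)
    thus ?thesis by blast
  qed
  moreover have "\<exists>k. P (Suc n) k \<and> Q n h k" if P: "P n h" for n h
  proof -
    have h: "h \<in> left_module_hom R (F n) (F (Suc n))" "\<And>x. x \<in> cycles F d \<epsilon> M n \<Longrightarrow> d n (h x) = \<theta> n x"
      using P by (auto simp: P_def)
    let ?\<alpha> = "\<lambda>x. \<theta> (Suc n) x \<ominus>\<^bsub>F (Suc n)\<^esub> h (d n x)"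
    interpret N: left_module R "F n" by (rule f(2))
    interpret S: left_module R "F (Suc n)" by (rule f(2))
    have \<alpha>: "?\<alpha> \<in> left_module_hom R (F (Suc n)) (F (Suc n))"
      by (rule left_module_hom_diff[OF \<theta>(1) left_module_hom_comp[OF f(3) h(1)] f(2) f(2)])
    obtain k where k: "k \<in> left_module_hom R (F (Suc n)) (F (Suc (Suc n)))"
      "\<forall>x\<in>carrier (F (Suc n)). d (Suc n) (k x) = ?\<alpha> x"
    proof (rule bexE[OF projective_lift[OF proj f(2) f(2) \<alpha> f(3)]])
      show "?\<alpha> ` carrier (F (Suc n)) \<subseteq> d (Suc n) ` carrier (F (Suc (Suc n)))"
        unfolding f(6)
      proof (rule image_subsetI)
        fix x assume x: "x \<in> carrier (F (Suc n))"
        have dx: "d n x \<in> cycles F d \<epsilon> M n" using f(6)[of n] x by blast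
        hence dxc: "d n x \<in> carrier (F n)" by (simp add: cycles_def)
        have c: "\<theta> (Suc n) x \<in> carrier (F (Suc n))" "h (d n x) \<in> carrier (F (Suc n))"
          using left_module_homD(1)[OF \<theta>(1)] left_module_homD(1)[OF h(1)] x dxc by auto
        have "d n (?\<alpha> x) = \<theta> n (d n x) \<ominus>\<^bsub>F n\<^esub> \<theta> n (d n x)"
          using left_module_hom_minus[OF f(3) f(2) f(2) c] \<theta>(3)[OF x] h(2)[OF dx] by simp
        also have "\<dots> = \<zero>\<^bsub>F n\<^esub>" using left_module_homD(1)[OF \<theta>(1) dxc] by (simp add: N.M.minus_eq N.M.r_neg)
        finally show "?\<alpha> x \<in> cycles F d \<epsilon> M (Suc n)"
          using left_module_homD(1)[OF \<alpha> x] by (simp add: cycles_def)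
      qed
    qed
    have "P (Suc n) k" unfolding P_def
    proof (intro conjI ballI k(1))
      fix x assume "x \<in> cycles F d \<epsilon> M (Suc n)"
      hence x: "x \<in> carrier (F (Suc n))" "d n x = \<zero>\<^bsub>F n\<^esub>" by (auto simp: cycles_def)
      thus "d (Suc n) (k x) = \<theta> (Suc n) x"
        using k(2) left_module_hom_zero[OF h(1) f(2) f(2)] left_module_homD(1)[OF \<theta>(1) x(1)]
        by (simp add: S.M.minus_eq)
    qed
    moreover have "Q n h k" unfolding Q_def by (rule k(2))
    ultimately show ?thesis by blast
  qed
  ultimately obtain h where h: "\<And>n. P n (h n) \<and> Q n (h n) (h (Suc n))"
    using dependent_nat_choice[of P Q] by metis
  have "\<theta> (Suc i) x = d (Suc i) (h (Suc i) x) \<oplus>\<^bsub>F (Suc i)\<^esub> h i (d i x)" if x: "x \<in> carrier (F (Suc i))" for i x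
  proof -
    interpret S: left_module R "F (Suc i)" by (rule f(2))
    have hi: "h i \<in> left_module_hom R (F i) (F (Suc i))" using h by (simp add: P_def)
    have c: "\<theta> (Suc i) x \<in> carrier (F (Suc i))" "h i (d i x) \<in> carrier (F (Suc i))"
      using left_module_homD(1)[OF \<theta>(1) x] left_module_homD(1)[OF hi left_module_homD(1)[OF f(3) x]] by auto
    have "d (Suc i) (h (Suc i) x) = \<theta> (Suc i) x \<ominus>\<^bsub>F (Suc i)\<^esub> h i (d i x)"
      using h x by (simp add: Q_def)
    thus ?thesis using c by (simp add: S.M.minus_eq S.M.a_assoc S.M.l_neg)
  qed
  thus ?thesis using h by (intro exI[of _ h]) (auto simp: P_def)
qed

text \<open>The round trip from \<open>F\<close> through \<open>C\<close> is compatible with the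
  augmentation, so its difference to the identity is null-homotopic. In degrees above
  \<open>n\<close> it factors through zero, and the difference is the identity.\<close>

lemma contraction_above_length:
  assumes F: "projective_resolution R F d \<epsilon> M" and C: "projective_resolution R C d' \<epsilon>' M"
    and len: "length_at_most C n"
  shows "\<exists>h. (\<forall>i. h i \<in> left_module_hom R (F i) (F (Suc i))) \<and>
    (\<forall>i\<ge>n. \<forall>x\<in>carrier (F (Suc i)). x = d (Suc i) (h (Suc i) x) \<oplus>\<^bsub>F (Suc i)\<^esub> h i (d i x))"
proof -
  have F': "resolution R F d \<epsilon> M" and C': "resolution R C d' \<epsilon>' M"
    using F C by (auto simp: projective_resolution_def)
  note f = resolutionD[OF F'] and c = resolutionD[OF C']
  obtain \<phi> where \<phi>': "(\<forall>i. \<phi> i \<in> left_module_hom R (F i) (C i)) \<and>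
    (\<forall>x\<in>carrier (F 0). \<epsilon>' (\<phi> 0 x) = \<epsilon> x) \<and>
    (\<forall>i. \<forall>x\<in>carrier (F (Suc i)). d' i (\<phi> (Suc i) x) = \<phi> i (d i x))"
    using comparison_map[OF F C'] by (rule exE)
  have \<phi>: "\<And>i. \<phi> i \<in> left_module_hom R (F i) (C i)"
    "\<And>x. x \<in> carrier (F 0) \<Longrightarrow> \<epsilon>' (\<phi> 0 x) = \<epsilon> x"
    "\<And>i x. x \<in> carrier (F (Suc i)) \<Longrightarrow> d' i (\<phi> (Suc i) x) = \<phi> i (d i x)"
    using \<phi>' by simp_all
  obtain \<psi> where \<psi>': "(\<forall>i. \<psi> i \<in> left_module_hom R (C i) (F i)) \<and>
    (\<forall>x\<in>carrier (C 0). \<epsilon> (\<psi> 0 x) = \<epsilon>' x) \<and>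
    (\<forall>i. \<forall>x\<in>carrier (C (Suc i)). d i (\<psi> (Suc i) x) = \<psi> i (d' i x))"
    using comparison_map[OF C F'] by (rule exE)
  have \<psi>: "\<And>i. \<psi> i \<in> left_module_hom R (C i) (F i)"
    "\<And>x. x \<in> carrier (C 0) \<Longrightarrow> \<epsilon> (\<psi> 0 x) = \<epsilon>' x"
    "\<And>i x. x \<in> carrier (C (Suc i)) \<Longrightarrow> d i (\<psi> (Suc i) x) = \<psi> i (d' i x)"
    using \<psi>' by simp_all
  have \<phi>c: "\<phi> i x \<in> carrier (C i)" if "x \<in> carrier (F i)" for i x by (rule left_module_homD(1)[OF \<phi>(1) that])
  have \<psi>c: "\<psi> i x \<in> carrier (F i)" if "x \<in> carrier (C i)" for i x by (rule left_module_homD(1)[OF \<psi>(1) that])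
  define \<theta> where "\<theta> i x = x \<ominus>\<^bsub>F i\<^esub> \<psi> i (\<phi> i x)" for i x
  have \<theta>: "\<theta> i \<in> left_module_hom R (F i) (F i)" for i
    unfolding \<theta>_def
    by (rule left_module_hom_diff[OF left_module_hom_id left_module_hom_comp[OF \<phi>(1) \<psi>(1)] f(2) f(2)])
  have "\<exists>h. (\<forall>i. h i \<in> left_module_hom R (F i) (F (Suc i))) \<and>
    (\<forall>i. \<forall>x\<in>carrier (F (Suc i)). \<theta> (Suc i) x = d (Suc i) (h (Suc i) x) \<oplus>\<^bsub>F (Suc i)\<^esub> h i (d i x))"
  proof (rule null_homotopy[OF F \<theta>])
    fix x assume x: "x \<in> carrier (F 0)"
    interpret M: left_module R M by (rule f(1))
    have "\<epsilon> (\<theta> 0 x) = \<epsilon> x \<ominus>\<^bsub>M\<^esub> \<epsilon> x" unfolding \<theta>_def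
      using left_module_hom_minus[OF f(4) f(2) f(1) x \<psi>c[OF \<phi>c[OF x]]] \<psi>(2)[OF \<phi>c[OF x]] \<phi>(2)[OF x] by simp
    thus "\<epsilon> (\<theta> 0 x) = \<zero>\<^bsub>M\<^esub>" using left_module_homD(1)[OF f(4) x] by (simp add: M.M.minus_eq M.M.r_neg)
  next
    fix i x assume x: "x \<in> carrier (F (Suc i))"
    show "d i (\<theta> (Suc i) x) = \<theta> i (d i x)" unfolding \<theta>_def
      using left_module_hom_minus[OF f(3) f(2) f(2) x \<psi>c[OF \<phi>c[OF x]]] \<psi>(3)[OF \<phi>c[OF x]] \<phi>(3)[OF x] by simp
  qed
  then obtain h where h': "(\<forall>i. h i \<in> left_module_hom R (F i) (F (Suc i))) \<and>
    (\<forall>i. \<forall>x\<in>carrier (F (Suc i)). \<theta> (Suc i) x = d (Suc i) (h (Suc i) x) \<oplus>\<^bsub>F (Suc i)\<^esub> h i (d i x))"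
    by (rule exE)
  have h: "\<And>i. h i \<in> left_module_hom R (F i) (F (Suc i))"
    "\<And>i x. x \<in> carrier (F (Suc i)) \<Longrightarrow> \<theta> (Suc i) x = d (Suc i) (h (Suc i) x) \<oplus>\<^bsub>F (Suc i)\<^esub> h i (d i x)"
    using h' by simp_all
  have "\<theta> (Suc i) x = x" if i: "i \<ge> n" and x: "x \<in> carrier (F (Suc i))" for i x
  proof -
    interpret S: left_module R "F (Suc i)" by (rule f(2))
    have "carrier (C (Suc i)) = {\<zero>\<^bsub>C (Suc i)\<^esub>}" using len i by (simp add: length_at_most_def)
    hence "\<phi> (Suc i) x = \<zero>\<^bsub>C (Suc i)\<^esub>" using \<phi>c[OF x] by simp
    thus ?thesis unfolding \<theta>_def using left_module_hom_zero[OF \<psi>(1) c(2) f(2)] x by (simp add: S.M.minus_eq)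
  qed
  thus ?thesis using h by (intro exI[of _ h]) metis
qed

text \<open>The form that homology and cohomology take once kernel and image have been shown to be
  the same set.\<close>

lemma trivial_group_self_quotient:
  assumes "group K" "subgroup H K"
  shows "trivial_group (K\<lparr>carrier := H\<rparr> Mod H)"
proof -
  interpret K: group K by fact
  let ?H = "K\<lparr>carrier := H\<rparr>"
  interpret H: group ?H by (rule subgroup.subgroup_is_group[OF assms(2,1)])
  have sub: "subgroup H ?H" using H.subgroup_self by simp
  have coset: "H #>\<^bsub>?H\<^esub> x = H" if "x \<in> H" for x
    using H.coset_join2[OF _ sub] that by simp
  have "H \<lhd> ?H"
  proof (rule H.normalI[OF sub], rule ballI)
    fix x assume "x \<in> carrier ?H"
    hence x: "x \<in> H" by simp
    have "x <#\<^bsub>?H\<^esub> H = H"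
    proof
      show "x <#\<^bsub>?H\<^esub> H \<subseteq> H" using H.m_closed x by (auto simp: l_coset_def)
      show "H \<subseteq> x <#\<^bsub>?H\<^esub> H"
      proof
        fix y assume y: "y \<in> H"
        have "y = x \<otimes>\<^bsub>?H\<^esub> (inv\<^bsub>?H\<^esub> x \<otimes>\<^bsub>?H\<^esub> y)"
          using x y H.m_assoc[of x "inv\<^bsub>?H\<^esub> x" y] H.inv_closed[of x] H.r_inv[of x] H.l_one[of y] by simp
        moreover have "inv\<^bsub>?H\<^esub> x \<otimes>\<^bsub>?H\<^esub> y \<in> H" using H.m_closed[of "inv\<^bsub>?H\<^esub> x" y] H.inv_closed[of x] x y by simp
        ultimately show "y \<in> x <#\<^bsub>?H\<^esub> H" unfolding l_coset_def by blast
      qed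
    qed
    thus "H #>\<^bsub>?H\<^esub> x = x <#\<^bsub>?H\<^esub> H" using coset[OF x] by simp
  qed
  hence "group (?H Mod H)" by (rule normal.factorgroup_is_group)
  moreover have "carrier (?H Mod H) = {H}"
    using coset subgroup.one_closed[OF assms(2)] by (auto simp: FactGroup_def RCOSETS_def)
  ultimately show ?thesis by (simp add: trivial_group_def FactGroup_def)
qed

section \<open>Homomorphism groups and vanishing of cohomology\<close>

lemma group_hom_group:
  assumes "left_module R A" "left_module R M"
  shows "group (hom_group R A M)"
proof -
  interpret M: left_module R M by fact
  have zero: "(\<lambda>x. \<zero>\<^bsub>M\<^esub>) \<in> left_module_hom R A M"
    by (rule left_module_homI) (use M.smult_r_null in auto)
  have restrict: "restrict f (carrier A) \<in> left_module_hom R A M" if "f \<in> left_module_hom R A M" for f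
  proof -
    interpret A: left_module R A by fact
    show ?thesis
      by (rule left_module_homI) (use that A.smult_closed in \<open>auto simp: left_module_homD[OF that]\<close>)
  qed
  show ?thesis
  proof (rule groupI)
    show "x \<otimes>\<^bsub>hom_group R A M\<^esub> y \<in> carrier (hom_group R A M)"
      if "x \<in> carrier (hom_group R A M)" "y \<in> carrier (hom_group R A M)" for x y
      using that restrict[OF left_module_hom_add[OF _ _ assms]] by (auto simp: hom_group_def)
    show "\<one>\<^bsub>hom_group R A M\<^esub> \<in> carrier (hom_group R A M)"
      using restrict[OF zero] by (simp add: hom_group_def)
    fix x assume x: "x \<in> carrier (hom_group R A M)"
    hence xh: "x \<in> left_module_hom R A M" "x \<in> extensional (carrier A)" by (auto simp: hom_group_def)
    note xc = left_module_homD(1)[OF xh(1)]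
    show "\<one>\<^bsub>hom_group R A M\<^esub> \<otimes>\<^bsub>hom_group R A M\<^esub> x = x"
      using xh xc by (auto simp: hom_group_def extensional_def)
    show "\<exists>y\<in>carrier (hom_group R A M). y \<otimes>\<^bsub>hom_group R A M\<^esub> x = \<one>\<^bsub>hom_group R A M\<^esub>"
    proof (rule bexI)
      show "(\<lambda>z\<in>carrier A. \<zero>\<^bsub>M\<^esub> \<ominus>\<^bsub>M\<^esub> x z) \<in> carrier (hom_group R A M)"
        using restrict[OF left_module_hom_diff[OF zero xh(1) assms]] by (simp add: hom_group_def)
      show "(\<lambda>z\<in>carrier A. \<zero>\<^bsub>M\<^esub> \<ominus>\<^bsub>M\<^esub> x z) \<otimes>\<^bsub>hom_group R A M\<^esub> x = \<one>\<^bsub>hom_group R A M\<^esub>"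
        using xc by (auto simp: hom_group_def M.M.minus_eq M.M.l_neg)
    qed
    fix y z assume "y \<in> carrier (hom_group R A M)" "z \<in> carrier (hom_group R A M)"
    hence yz: "y \<in> left_module_hom R A M" "z \<in> left_module_hom R A M" by (auto simp: hom_group_def)
    note yc = left_module_homD(1)[OF yz(1)] and zc = left_module_homD(1)[OF yz(2)]
    show "x \<otimes>\<^bsub>hom_group R A M\<^esub> y \<otimes>\<^bsub>hom_group R A M\<^esub> z = x \<otimes>\<^bsub>hom_group R A M\<^esub> (y \<otimes>\<^bsub>hom_group R A M\<^esub> z)"
      unfolding hom_group_def by (auto intro!: restrict_ext simp: M.M.a_assoc xc yc zc)
  qed
qed

lemma hom_group_pullback:
  assumes f: "f \<in> left_module_hom R A B" and "left_module R A"
  shows "(\<lambda>u. compose (carrier A) u f) \<in> hom (hom_group R B M) (hom_group R A M)"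
proof (rule homI)
  note fc = left_module_homD(1)[OF f]
  interpret A: left_module R A by fact
  show "compose (carrier A) u f \<in> carrier (hom_group R A M)" if "u \<in> carrier (hom_group R B M)" for u
  proof -
    have "(\<lambda>x. u (f x)) \<in> left_module_hom R A M"
      by (rule left_module_hom_comp[OF f]) (use that in \<open>simp add: hom_group_def\<close>)
    hence "compose (carrier A) u f \<in> left_module_hom R A M"
      unfolding left_module_hom_def compose_def using A.smult_closed by auto
    thus ?thesis by (simp add: hom_group_def)
  qed
  show "compose (carrier A) (u \<otimes>\<^bsub>hom_group R B M\<^esub> v) f =
      compose (carrier A) u f \<otimes>\<^bsub>hom_group R A M\<^esub> compose (carrier A) v f" for u v
    using fc by (auto simp: hom_group_def compose_def)
qed

text \<open>Apply a cocycle \<open>u\<close> to the homotopy identity: the term \<open>u d h\<close>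
  vanishes and \<open>u = (u h) d\<close> remains, so \<open>u\<close> after \<open>h i\<close> is a
  preimage of \<open>u\<close>.\<close>

lemma cohomology_vanishes:
  assumes F: "resolution (group_ring G) F d \<epsilon> Z" and M: "left_module (group_ring G) M"
    and h: "\<And>i. h i \<in> left_module_hom (group_ring G) (F i) (F (Suc i))"
      "\<And>x. x \<in> carrier (F (Suc i)) \<Longrightarrow> x = d (Suc i) (h (Suc i) x) \<oplus>\<^bsub>F (Suc i)\<^esub> h i (d i x)"
  shows "trivial_group (group_cohomology G F d M (Suc i))"
proof -
  let ?C = "\<lambda>i. hom_group (group_ring G) (F i) M" and ?\<delta> = "\<lambda>i f. compose (carrier (F (Suc i))) f (d i)"
  note f = resolutionD[OF F]
  have grp: "group (?C j)" for j by (rule group_hom_group[OF f(2) M])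
  have hom: "?\<delta> j \<in> hom (?C j) (?C (Suc j))" for j by (rule hom_group_pullback[OF f(3) f(2)])
  interpret M: left_module "group_ring G" M by fact
  let ?K = "kernel (?C (Suc i)) (?C (Suc (Suc i))) (?\<delta> (Suc i))"
  have "?\<delta> i ` carrier (?C i) = ?K"
  proof (intro subset_antisym subsetI)
    fix u assume "u \<in> ?\<delta> i ` carrier (?C i)"
    then obtain v where v: "v \<in> carrier (?C i)" "u = ?\<delta> i v" by blast
    have vh: "v \<in> left_module_hom (group_ring G) (F i) M" using v by (simp add: hom_group_def)
    have "?\<delta> (Suc i) u = \<one>\<^bsub>?C (Suc (Suc i))\<^esub>"
      using resolution_square_zero[OF F] left_module_homD(1)[OF f(3)] left_module_hom_zero[OF vh f(2) M]
      by (auto simp: v(2) compose_def hom_group_def)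
    thus "u \<in> ?K" using v hom_in_carrier[OF hom] by (simp add: kernel_def)
  next
    fix u assume "u \<in> ?K"
    hence u: "u \<in> carrier (?C (Suc i))" "?\<delta> (Suc i) u = \<one>\<^bsub>?C (Suc (Suc i))\<^esub>" by (auto simp: kernel_def)
    have uh: "u \<in> left_module_hom (group_ring G) (F (Suc i)) M" "u \<in> extensional (carrier (F (Suc i)))"
      using u by (auto simp: hom_group_def)
    have u0: "u (d (Suc i) y) = \<zero>\<^bsub>M\<^esub>" if "y \<in> carrier (F (Suc (Suc i)))" for y
      using fun_cong[OF u(2), of y] that by (simp add: compose_def hom_group_def)
    let ?v = "compose (carrier (F i)) u (h i)"
    have v: "?v \<in> carrier (?C i)"
      using hom_in_carrier[OF hom_group_pullback[OF h(1) f(2)] u(1)] .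
    have "u = ?\<delta> i ?v"
    proof
      fix x show "u x = ?\<delta> i ?v x"
      proof (cases "x \<in> carrier (F (Suc i))")
        case True
        have dx: "d i x \<in> carrier (F i)" by (rule left_module_homD(1)[OF f(3) True])
        have c: "h (Suc i) x \<in> carrier (F (Suc (Suc i)))" "h i (d i x) \<in> carrier (F (Suc i))"
          using left_module_homD(1)[OF h(1)] True dx by auto
        have "u x = u (d (Suc i) (h (Suc i) x)) \<oplus>\<^bsub>M\<^esub> u (h i (d i x))"
          using left_module_homD(2)[OF uh(1) left_module_homD(1)[OF f(3) c(1)] c(2)] h(2)[OF True] by simp
        thus ?thesis using u0[OF c(1)] left_module_homD(1)[OF uh(1) c(2)] True dx by (simp add: compose_def)
      next
        case False
        thus ?thesis using uh(2) by (simp add: compose_def extensional_def)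
      qed
    qed
    thus "u \<in> ?\<delta> i ` carrier (?C i)" using v by blast
  qed
  moreover have "subgroup ?K (?C (Suc i))"
    using group_hom.subgroup_kernel[of "?C (Suc i)" "?C (Suc (Suc i))" "?\<delta> (Suc i)"] grp hom
    by (simp add: group_hom_def group_hom_axioms_def)
  ultimately show ?thesis
    using trivial_group_self_quotient[OF grp, of ?K "Suc i"]
    by (simp add: group_cohomology_def cochain_cohomology_def)
qed

section \<open>Homology\<close>

text \<open>The map underlying \<open>tensor_map\<close>, on formal sums before relations are
  imposed.\<close>

definition tensor_push :: "('a \<Rightarrow> 'b) \<Rightarrow> ('a \<times> 'm \<Rightarrow>\<^sub>0 int) \<Rightarrow> ('b \<times> 'm \<Rightarrow>\<^sub>0 int)" where
  "tensor_push f = frag_extend (\<lambda>(x, m). frag_of (f x, m))"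

lemma tensor_push_simps [simp]:
  "tensor_push f 0 = 0" "tensor_push f (frag_of (x, m)) = frag_of (f x, m)"
  "tensor_push f (u - v) = tensor_push f u - tensor_push f v"
  "tensor_push f (u + v) = tensor_push f u + tensor_push f v"
  "tensor_push f (- u) = - tensor_push f u"
  by (simp_all add: tensor_push_def frag_extend_diff frag_extend_add frag_extend_minus)

lemma tensor_push_push: "tensor_push g (tensor_push f u) = tensor_push (\<lambda>x. g (f x)) u"
  by (induction u rule: frag_UNIV_induct) auto

lemma tensor_push_id:
  "(\<And>x m. (x, m) \<in> Poly_Mapping.keys u \<Longrightarrow> f x = x) \<Longrightarrow> tensor_push f u = u"
  unfolding tensor_push_def
  by (subst (2) frag_expansion) (auto intro!: frag_extend_eq)

lemma keys_tensor_push: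
  assumes "Poly_Mapping.keys u \<subseteq> A \<times> M" "\<And>x. x \<in> A \<Longrightarrow> f x \<in> B"
  shows "Poly_Mapping.keys (tensor_push f u) \<subseteq> B \<times> M"
  unfolding tensor_push_def by (rule keys_frag_extend_subset) (use assms in auto)

lemma keys_tensor_push_hom:
  assumes "f \<in> left_module_hom R A B" "Poly_Mapping.keys u \<subseteq> carrier A \<times> M"
  shows "Poly_Mapping.keys (tensor_push f u) \<subseteq> carrier B \<times> M"
  by (rule keys_tensor_push[OF assms(2)]) (rule left_module_homD(1)[OF assms(1)])

section \<open>Tensor products with a fixed module\<close>

locale tensor_module = group G for G (structure) +
  fixes M :: "('a \<Rightarrow>\<^sub>0 int, 'm) module"
  assumes module_M: "left_module (group_ring G) M"
begin

sublocale M: left_module "group_ring G" M by (rule module_M)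

definition relators :: "('a \<Rightarrow>\<^sub>0 int, 'x) module \<Rightarrow> ('x \<times> 'm \<Rightarrow>\<^sub>0 int) set" where
  "relators A = {frag_of (x \<oplus>\<^bsub>A\<^esub> y, m) - frag_of (x, m) - frag_of (y, m) | x y m.
          x \<in> carrier A \<and> y \<in> carrier A \<and> m \<in> carrier M} \<union>
       {frag_of (x, m \<oplus>\<^bsub>M\<^esub> n) - frag_of (x, m) - frag_of (x, n) | x m n.
          x \<in> carrier A \<and> m \<in> carrier M \<and> n \<in> carrier M} \<union>
       {frag_of (frag_of (inv g) \<odot>\<^bsub>A\<^esub> x, m) - frag_of (x, frag_of g \<odot>\<^bsub>M\<^esub> m) | g x m.
          g \<in> carrier G \<and> x \<in> carrier A \<and> m \<in> carrier M}"

abbreviation "free_on A \<equiv> free_Abelian_group (carrier A \<times> carrier M)"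

abbreviation "relations A \<equiv> tensor_relations G A M"

lemma relations_eq: "relations A = generate (free_on A) (relators A)"
  by (simp add: tensor_relations_def relators_def)

lemma relators_carrier:
  assumes "left_module (group_ring G) A" shows "relators A \<subseteq> carrier (free_on A)"
proof
  interpret A: left_module "group_ring G" A by fact
  fix u assume "u \<in> relators A"
  moreover have "frag_of g \<odot>\<^bsub>M\<^esub> m \<in> carrier M" if "g \<in> carrier G" "m \<in> carrier M" for g m
    using M.smult_closed[of "frag_of g" m] that by simp
  moreover have "frag_of (inv g) \<odot>\<^bsub>A\<^esub> x \<in> carrier A" if "g \<in> carrier G" "x \<in> carrier A" for g x
    using A.smult_closed[of "frag_of (inv g)" x] that by simp
  ultimately show "u \<in> carrier (free_on A)"
    unfolding relators_def carrier_free_Abelian_group_iff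
    by (elim UnE CollectE exE conjE; hypsubst; intro keys_diff_subset) auto
qed

lemma subgroup_relations:
  "left_module (group_ring G) A \<Longrightarrow> subgroup (relations A) (free_on A)"
  unfolding relations_eq
  by (rule group.generate_is_subgroup[OF group_free_Abelian_group relators_carrier])

lemma relations_closed:
  assumes "left_module (group_ring G) A"
  shows "0 \<in> relations A"
    and "u \<in> relations A \<Longrightarrow> Poly_Mapping.keys u \<subseteq> carrier A \<times> carrier M"
    and "u \<in> relations A \<Longrightarrow> v \<in> relations A \<Longrightarrow> u + v \<in> relations A"
    and "u \<in> relations A \<Longrightarrow> - u \<in> relations A"
    and "u \<in> relations A \<Longrightarrow> v \<in> relations A \<Longrightarrow> u - v \<in> relations A"
    and "u \<in> relators A \<Longrightarrow> u \<in> relations A"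
proof -
  note s = subgroup_relations[OF assms]
  show "0 \<in> relations A" using subgroup.one_closed[OF s] by simp
  show k: "Poly_Mapping.keys u \<subseteq> carrier A \<times> carrier M" if "u \<in> relations A" for u
    using subgroup.mem_carrier[OF s that] by simp
  show p: "u + v \<in> relations A" if "u \<in> relations A" "v \<in> relations A" for u v
    using subgroup.m_closed[OF s that] by simp
  show n: "- u \<in> relations A" if "u \<in> relations A" for u
    using subgroup.m_inv_closed[OF s that] k[OF that] by simp
  show "u - v \<in> relations A" if "u \<in> relations A" "v \<in> relations A"
    using p[OF that(1) n[OF that(2)]] by simp
  show "u \<in> relators A \<Longrightarrow> u \<in> relations A" unfolding relations_eq by (rule generate.incl)
qed

text \<open>By additivity it is enough to push relators, and a homomorphism sends each relator to
  one of the same kind.\<close>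

lemma relations_push:
  assumes A: "left_module (group_ring G) A" and B: "left_module (group_ring G) B"
    and f: "f \<in> left_module_hom (group_ring G) A B" and u: "u \<in> relations A"
  shows "tensor_push f u \<in> relations B"
proof -
  note fD = left_module_homD[OF f]
  interpret A: left_module "group_ring G" A by fact
  have gen: "tensor_push f r \<in> relations B" if "r \<in> relators A" for r
  proof (rule relations_closed(6)[OF B])
    have "frag_of (inv g) \<in> carrier (group_ring G)" if "g \<in> carrier G" for g using that by simp
    thus "tensor_push f r \<in> relators B"
      using that fD unfolding relators_def
      by (elim UnE CollectE exE conjE; hypsubst) (simp; blast)+
  qed
  show ?thesis using u unfolding relations_eq[of A]
  proof (induction rule: generate.induct)
    case one
    show ?case using relations_closed(1)[OF B] by simp
  next
    case (incl r)
    thus ?case by (rule gen)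
  next
    case (inv r)
    thus ?case using gen relations_closed(4)[OF B] subsetD[OF relators_carrier[OF A]] by simp
  next
    case (eng r s)
    thus ?case using relations_closed(3)[OF B] by simp
  qed
qed

text \<open>On formal sums \<open>tensor_push\<close> is not additive in the map. The defect on each
  pair is a relator for additivity in the first factor.\<close>

lemma push_add_relations:
  assumes B: "left_module (group_ring G) B"
    and f: "\<And>x. x \<in> A \<Longrightarrow> f x \<in> carrier B" and g: "\<And>x. x \<in> A \<Longrightarrow> g x \<in> carrier B"
    and u: "Poly_Mapping.keys u \<subseteq> A \<times> carrier M"
  shows "tensor_push (\<lambda>x. f x \<oplus>\<^bsub>B\<^esub> g x) u - (tensor_push f u + tensor_push g u) \<in> relations B"
  using u
proof (induction u rule: frag_induction)
  case zero
  show ?case using relations_closed(1)[OF B] by simp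
next
  case (one p)
  then obtain x m where p: "p = (x, m)" "x \<in> A" "m \<in> carrier M" by auto
  have "frag_of (f x \<oplus>\<^bsub>B\<^esub> g x, m) - frag_of (f x, m) - frag_of (g x, m) \<in> relators B"
    unfolding relators_def using f[OF p(2)] g[OF p(2)] p(3) by blast
  thus ?case using relations_closed(6)[OF B] p(1) by (simp add: diff_diff_eq)
next
  case (diff u v)
  have eq: "tensor_push (\<lambda>x. f x \<oplus>\<^bsub>B\<^esub> g x) (u - v) - (tensor_push f (u - v) + tensor_push g (u - v))
    = (tensor_push (\<lambda>x. f x \<oplus>\<^bsub>B\<^esub> g x) u - (tensor_push f u + tensor_push g u))
     - (tensor_push (\<lambda>x. f x \<oplus>\<^bsub>B\<^esub> g x) v - (tensor_push f v + tensor_push g v))"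
    by simp
  show ?case unfolding eq by (rule relations_closed(5)[OF B diff])
qed

text \<open>A pair with first entry zero is not a zero formal sum. Writing zero as zero plus zero in
  \<open>push_add_relations\<close> shows that it is a relation.\<close>

lemma push_zero_relations:
  assumes B: "left_module (group_ring G) B" and f: "\<And>x. x \<in> A \<Longrightarrow> f x = \<zero>\<^bsub>B\<^esub>"
    and u: "Poly_Mapping.keys u \<subseteq> A \<times> carrier M"
  shows "tensor_push f u \<in> relations B"
proof -
  interpret B: left_module "group_ring G" B by fact
  let ?z = "\<lambda>_. \<zero>\<^bsub>B\<^esub>"
  have "tensor_push (\<lambda>x. \<zero>\<^bsub>B\<^esub> \<oplus>\<^bsub>B\<^esub> \<zero>\<^bsub>B\<^esub>) u - (tensor_push ?z u + tensor_push ?z u) \<in> relations B"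
    by (rule push_add_relations[OF B _ _ u]) auto
  hence "- tensor_push ?z u \<in> relations B" by simp
  hence "tensor_push ?z u \<in> relations B" using relations_closed(4)[OF B] by fastforce
  moreover have "tensor_push ?z u = tensor_push f u"
    unfolding tensor_push_def by (rule frag_extend_eq) (use f u in auto)
  ultimately show ?thesis by simp
qed

abbreviation "cls A u \<equiv> relations A #>\<^bsub>free_on A\<^esub> u"

lemma normal_relations:
  assumes "left_module (group_ring G) A" shows "relations A \<lhd> free_on A"
  using comm_group.normal_iff_subgroup[OF abelian_free_Abelian_group] subgroup_relations[OF assms] by blast

lemma cls_eq_iff:
  assumes A: "left_module (group_ring G) A"
    and "Poly_Mapping.keys u \<subseteq> carrier A \<times> carrier M" "Poly_Mapping.keys v \<subseteq> carrier A \<times> carrier M"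
  shows "cls A u = cls A v \<longleftrightarrow> u - v \<in> relations A"
proof
  have mem: "w \<in> cls A v \<longleftrightarrow> w - v \<in> relations A" for v w
    by (auto simp: r_coset_def) (metis diff_add_cancel)
  show "u - v \<in> relations A" if "cls A u = cls A v"
    using mem[of u u] mem[of u v] that relations_closed(1)[OF A] by simp
  assume uv: "u - v \<in> relations A"
  show "cls A u = cls A v"
  proof (rule Set.set_eqI)
    fix w
    have "w - v = (w - u) + (u - v)" "w - u = (w - v) - (u - v)" by simp_all
    thus "w \<in> cls A u \<longleftrightarrow> w \<in> cls A v"
      unfolding mem using relations_closed(3,5)[OF A] uv by metis
  qed
qed

lemma cls_zero: "cls A 0 = relations A"
  by (simp add: r_coset_def)

lemma tensor_carrier:
  "U \<in> carrier (tensor G A M) \<longleftrightarrow> (\<exists>u. Poly_Mapping.keys u \<subseteq> carrier A \<times> carrier M \<and> U = cls A u)"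
  by (simp add: tensor_def FactGroup_def RCOSETS_def Bex_def)

lemma group_tensor: "left_module (group_ring G) A \<Longrightarrow> group (tensor G A M)"
  unfolding tensor_def by (rule normal.factorgroup_is_group[OF normal_relations])

lemma tensor_one: "\<one>\<^bsub>tensor G A M\<^esub> = relations A"
  by (simp add: tensor_def FactGroup_def)

lemma tensor_mult:
  assumes "left_module (group_ring G) A"
    and "Poly_Mapping.keys u \<subseteq> carrier A \<times> carrier M" "Poly_Mapping.keys v \<subseteq> carrier A \<times> carrier M"
  shows "cls A u \<otimes>\<^bsub>tensor G A M\<^esub> cls A v = cls A (u + v)"
  using normal.rcos_sum[OF normal_relations[OF assms(1)], of u v] assms(2,3)
  by (simp add: tensor_def FactGroup_def)

text \<open>The union in \<open>tensor_map\<close> runs over all representatives. By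
  \<open>relations_push\<close> they contribute the same coset, and \<open>u\<close> is one of
  them.\<close>

lemma tensor_map_cls:
  assumes A: "left_module (group_ring G) A" and B: "left_module (group_ring G) B"
    and f: "f \<in> left_module_hom (group_ring G) A B"
    and u: "Poly_Mapping.keys u \<subseteq> carrier A \<times> carrier M"
  shows "tensor_map G B M f (cls A u) = cls B (tensor_push f u)"
proof -
  note push = keys_tensor_push_hom[OF f]
  have "cls B (tensor_push f w) = cls B (tensor_push f u)" if w: "w \<in> cls A u" for w
  proof -
    obtain r where r: "r \<in> relations A" "w = r + u" using w by (auto simp: r_coset_def)
    have rk: "Poly_Mapping.keys r \<subseteq> carrier A \<times> carrier M" by (rule relations_closed(2)[OF A r(1)])
    have "tensor_push f w - tensor_push f u = tensor_push f r" by (simp add: r(2))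
    moreover have "Poly_Mapping.keys w \<subseteq> carrier A \<times> carrier M" unfolding r(2) by (rule keys_add_subset[OF rk u])
    ultimately show ?thesis
      using cls_eq_iff[OF B push push[OF u]] relations_push[OF A B f r(1)] by simp
  qed
  moreover have "u \<in> cls A u" using relations_closed(1)[OF A] by (force simp: r_coset_def)
  ultimately have "(\<Union>w\<in>cls A u. cls B (tensor_push f w)) = cls B (tensor_push f u)" by blast
  thus ?thesis by (simp add: tensor_map_def tensor_push_def)
qed

lemma tensor_map_hom:
  assumes A: "left_module (group_ring G) A" and B: "left_module (group_ring G) B"
    and f: "f \<in> left_module_hom (group_ring G) A B"
  shows "tensor_map G B M f \<in> hom (tensor G A M) (tensor G B M)"
proof (rule homI)
  note push = keys_tensor_push_hom[OF f]
  fix U assume "U \<in> carrier (tensor G A M)"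
  then obtain u where u: "Poly_Mapping.keys u \<subseteq> carrier A \<times> carrier M" "U = cls A u"
    unfolding tensor_carrier by blast
  show "tensor_map G B M f U \<in> carrier (tensor G B M)"
    unfolding u(2) tensor_map_cls[OF A B f u(1)] tensor_carrier using push[OF u(1)] by blast
  fix V assume "V \<in> carrier (tensor G A M)"
  then obtain v where v: "Poly_Mapping.keys v \<subseteq> carrier A \<times> carrier M" "V = cls A v"
    unfolding tensor_carrier by blast
  show "tensor_map G B M f (U \<otimes>\<^bsub>tensor G A M\<^esub> V) = tensor_map G B M f U \<otimes>\<^bsub>tensor G B M\<^esub> tensor_map G B M f V"
    unfolding u(2) v(2) tensor_mult[OF A u(1) v(1)] tensor_map_cls[OF A B f u(1)] tensor_map_cls[OF A B f v(1)]
      tensor_map_cls[OF A B f keys_add_subset[OF u(1) v(1)]] tensor_mult[OF B push[OF u(1)] push[OF v(1)]]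
    by simp
qed

text \<open>Modulo relations, \<open>u\<close> is the sum of its images under \<open>d h\<close> and
  \<open>h d\<close>. If \<open>u\<close> represents a cycle, its image under \<open>d\<close> is a
  relation, hence so is that under \<open>h d\<close>, and \<open>u\<close> is equivalent to a
  boundary.\<close>

lemma homology_vanishes:
  assumes F: "resolution (group_ring G) F d \<epsilon> Z"
    and h: "\<And>i. h i \<in> left_module_hom (group_ring G) (F i) (F (Suc i))"
      "\<And>x. x \<in> carrier (F (Suc i)) \<Longrightarrow> x = d (Suc i) (h (Suc i) x) \<oplus>\<^bsub>F (Suc i)\<^esub> h i (d i x)"
  shows "trivial_group (group_homology G F d M (Suc i))"
proof -
  let ?C = "\<lambda>i. tensor G (F i) M" and ?T = "\<lambda>i. tensor_map G (F i) M (d i)"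
  note f = resolutionD[OF F]
  have grp: "group (?C j)" for j by (rule group_tensor[OF f(2)])
  have hom: "?T j \<in> hom (?C (Suc j)) (?C j)" for j by (rule tensor_map_hom[OF f(2) f(2) f(3)])
  note T = tensor_map_cls[OF f(2) f(2) f(3)]
  note push_d = keys_tensor_push_hom[OF f(3)]
  note push_h = keys_tensor_push_hom[OF h(1)]
  let ?K = "kernel (?C (Suc i)) (?C i) (?T i)"
  have "?T (Suc i) ` carrier (?C (Suc (Suc i))) = ?K"
  proof (intro subset_antisym subsetI)
    fix U assume "U \<in> ?T (Suc i) ` carrier (?C (Suc (Suc i)))"
    then obtain V where V: "V \<in> carrier (?C (Suc (Suc i)))" "U = ?T (Suc i) V" by (elim imageE)
    then obtain v where v: "Poly_Mapping.keys v \<subseteq> carrier (F (Suc (Suc i))) \<times> carrier M"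
      "U = ?T (Suc i) (cls (F (Suc (Suc i))) v)" by (auto simp: tensor_carrier)
    have U: "U = cls (F (Suc i)) (tensor_push (d (Suc i)) v)" unfolding v(2) by (rule T[OF v(1)])
    have "?T i U = cls (F i) (tensor_push (\<lambda>x. d i (d (Suc i) x)) v)"
      unfolding U T[OF push_d[OF v(1)]] tensor_push_push ..
    also have "\<dots> = cls (F i) 0"
      using cls_eq_iff[OF f(2) push_d[OF push_d[OF v(1)]], of 0]
        push_zero_relations[OF f(2) resolution_square_zero[OF F] v(1)]
      by (simp add: tensor_push_push)
    finally have "?T i U = \<one>\<^bsub>?C i\<^esub>" by (simp add: tensor_one cls_zero)
    moreover have "U \<in> carrier (?C (Suc i))" unfolding tensor_carrier U by (rule exI, rule conjI[OF push_d[OF v(1)] refl])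
    ultimately show "U \<in> ?K" by (simp add: kernel_def)
  next
    fix U assume "U \<in> ?K"
    hence "U \<in> carrier (?C (Suc i))" and TU: "?T i U = \<one>\<^bsub>?C i\<^esub>" by (auto simp: kernel_def)
    then obtain u where u: "Poly_Mapping.keys u \<subseteq> carrier (F (Suc i)) \<times> carrier M" "U = cls (F (Suc i)) u"
      unfolding tensor_carrier by blast
    have "cls (F i) (tensor_push (d i) u) = cls (F i) 0"
      using TU T[OF u(1)] u(2) by (simp add: tensor_one cls_zero)
    hence "tensor_push (d i) u \<in> relations (F i)"
      using cls_eq_iff[OF f(2) push_d[OF u(1)], of 0] by simp
    hence r1: "tensor_push (\<lambda>x. h i (d i x)) u \<in> relations (F (Suc i))"
      using relations_push[OF f(2) f(2) h(1)] by (simp add: tensor_push_push[symmetric])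
    let ?dh = "\<lambda>x. d (Suc i) (h (Suc i) x)" and ?hd = "\<lambda>x. h i (d i x)"
    have "tensor_push (\<lambda>x. ?dh x \<oplus>\<^bsub>F (Suc i)\<^esub> ?hd x) u - (tensor_push ?dh u + tensor_push ?hd u) \<in> relations (F (Suc i))"
      using left_module_homD(1)[OF left_module_hom_comp[OF h(1) f(3)]]
        left_module_homD(1)[OF left_module_hom_comp[OF f(3) h(1)]]
      by (intro push_add_relations[OF f(2) _ _ u(1)])
    moreover have "tensor_push (\<lambda>x. ?dh x \<oplus>\<^bsub>F (Suc i)\<^esub> ?hd x) u = u"
      by (rule tensor_push_id) (use h(2)[symmetric] u(1) in auto)
    ultimately have "u - (tensor_push ?dh u + tensor_push ?hd u) \<in> relations (F (Suc i))" by simp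
    from relations_closed(3)[OF f(2) this r1] have "u - tensor_push ?dh u \<in> relations (F (Suc i))" by simp
    hence "U = cls (F (Suc i)) (tensor_push (d (Suc i)) (tensor_push (h (Suc i)) u))"
      using cls_eq_iff[OF f(2) u(1) push_d[OF push_h[OF u(1)]]] u(2) by (simp add: tensor_push_push)
    also have "\<dots> = ?T (Suc i) (cls (F (Suc (Suc i))) (tensor_push (h (Suc i)) u))"
      by (rule T[OF push_h[OF u(1)], symmetric])
    finally have "U = ?T (Suc i) (cls (F (Suc (Suc i))) (tensor_push (h (Suc i)) u))" .
    moreover have "cls (F (Suc (Suc i))) (tensor_push (h (Suc i)) u) \<in> carrier (?C (Suc (Suc i)))"
      unfolding tensor_carrier by (rule exI, rule conjI[OF push_h[OF u(1)] refl])
    ultimately show "U \<in> ?T (Suc i) ` carrier (?C (Suc (Suc i)))" by (rule image_eqI)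
  qed
  moreover have "subgroup ?K (?C (Suc i))"
    using group_hom.subgroup_kernel[of "?C (Suc i)" "?C i" "?T i"] grp hom
    by (simp add: group_hom_def group_hom_axioms_def)
  ultimately show ?thesis
    using trivial_group_self_quotient[OF grp, of ?K "Suc i"]
    by (simp add: group_homology_def chain_homology_def)
qed

end

section \<open>The resolution\<close>

context lattice_submonoid
begin

abbreviation translate :: "'a \<Rightarrow> 'a list \<Rightarrow> 'a list" where
  "translate g \<equiv> map ((\<otimes>) g)"

text \<open>Degree \<open>k\<close> means \<open>k + 1\<close> vertices. The empty chain is not part
  of any of these modules; it accounts for the trivial module at the end.\<close>

definition chain_module :: "nat \<Rightarrow> ('a \<Rightarrow>\<^sub>0 int, 'a list \<Rightarrow>\<^sub>0 int) module" where
  "chain_module k = permutation_module translate (chains (Suc k))"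

lemma chain_module_simps [simp]:
  "c \<in> carrier (chain_module k) \<longleftrightarrow> Poly_Mapping.keys c \<subseteq> chains (Suc k)"
  "\<zero>\<^bsub>chain_module k\<^esub> = 0" "c \<oplus>\<^bsub>chain_module k\<^esub> c' = c + c'"
  "a \<odot>\<^bsub>chain_module k\<^esub> c = frag_bilinear translate a c"
  by (simp_all add: chain_module_def)

lemma group_set_chains: "group_set G translate (chains k)"
proof (unfold_locales)
  show "translate g w \<in> chains k" if "g \<in> carrier G" "w \<in> chains k" for g w
    using map_chains that .
  show "translate \<one> w = w" if "w \<in> chains k" for w
    using that by (auto intro!: map_idI simp: chains_def)
  show "translate (g \<otimes> h) w = translate g (translate h w)"
    if "g \<in> carrier G" "h \<in> carrier G" "w \<in> chains k" for g h w
    using that by (auto simp: chains_def m_assoc subset_iff)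
qed

lemma left_module_chain_module: "left_module (group_ring G) (chain_module k)"
  unfolding chain_module_def by (rule group_set.left_module_permutation_module[OF group_set_chains])

lemma fg_free_chain_module: "fg_free_module (group_ring G) (chain_module k)"
  unfolding chain_module_def
proof (rule group_set.fg_free_permutation_module[OF group_set_chains finite_based_chains])
  show "based_chains (Suc k) \<subseteq> chains (Suc k)" by (auto simp: based_chains_def)
  show "\<exists>g\<in>carrier G. \<exists>w\<in>based_chains (Suc k). x = translate g w" if "x \<in> chains (Suc k)" for x
  proof -
    have "x \<noteq> []" using that by (auto simp: chains_def)
    note o = chain_orbit[OF that this]
    show ?thesis using o(1,2) o(3)[symmetric] by (rule_tac bexI, rule_tac bexI)
  qed
  fix g h v w
  assume gh: "g \<in> carrier G" "h \<in> carrier G"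
    and vw: "v \<in> based_chains (Suc k)" "w \<in> based_chains (Suc k)" and eq: "translate g v = translate h w"
  \<comment> \<open>Based chains start at \<open>\<one>\<close>, so the translating element is the
    first vertex of the translate.\<close>
  have "hd (translate g v) = g" "hd (translate h w) = h"
    using gh vw by (simp_all add: based_chains_def hd_map)
  hence [simp]: "g = h" using eq by simp
  have "set v \<subseteq> carrier G" "set w \<subseteq> carrier G" using vw by (auto simp: based_chains_def chains_def)
  hence "inj_on ((\<otimes>) h) (set v \<union> set w)" using gh by (auto simp: inj_on_def subset_iff)
  thus "g = h \<and> v = w" using eq map_inj_on by fastforce
qed

lemma boundary_bilinear:
  "boundary (frag_bilinear translate a c) = frag_bilinear translate a (boundary c)"
proof (induction a rule: frag_UNIV_induct)
  case (one g)
  have "frag_bilinear translate (frag_of g) c = map_chain ((\<otimes>) g) c" for c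
    by (induction c rule: frag_UNIV_induct) auto
  thus ?case by (simp add: boundary_map_chain)
qed auto

lemma chains_0: "chains 0 = {[]}"
  by (auto simp: chains_def)

lemma augmentation_cmul: "augmentation (frag_cmul n a) = n * augmentation a"
  by (simp add: augmentation_eq frag_extend_cmul)

text \<open>A vertex has boundary \<open>frag_of []\<close>, so the last map is the usual
  augmentation taking every vertex to 1. Exactness at each module is \<open>acyclic\<close>, with
  the index shifted from degrees to numbers of vertices.\<close>

lemma chain_resolution:
  "resolution (group_ring G) chain_module (\<lambda>_. boundary) (\<lambda>c. augmentation (boundary c)) trivial_module"
  unfolding resolution_def
proof (intro conjI allI)
  show "left_module (group_ring G) trivial_module" by (rule left_module_trivial_module)
  show "left_module (group_ring G) (chain_module i)" for i by (rule left_module_chain_module)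
  show "boundary \<in> left_module_hom (group_ring G) (chain_module (Suc i)) (chain_module i)" for i
    by (rule left_module_homI) (simp_all add: boundary_chains boundary_bilinear)
  show "(\<lambda>c. augmentation (boundary c)) \<in> left_module_hom (group_ring G) (chain_module 0) trivial_module"
    by (rule left_module_homI) (simp_all add: boundary_bilinear augmentation_mult)
  have one: "[\<one>] \<in> chains (Suc 0)" using \<Delta>_P one_le_iff by (simp add: chains_def)
  have "n \<in> (\<lambda>c. augmentation (boundary c)) ` carrier (chain_module 0)" for n
    by (rule image_eqI[of _ _ "frag_cmul n (frag_of [\<one>])"])
      (use one in \<open>auto simp: boundary_cmul augmentation_cmul\<close>)
  thus "(\<lambda>c. augmentation (boundary c)) ` carrier (chain_module 0) = carrier trivial_module" by auto
  \<comment> \<open>In degree 0 the boundary is a multiple of \<open>frag_of []\<close>, and its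
    augmentation is that multiple. So the kernel of the last map consists of the cycles to which
    \<open>acyclic\<close> applies.\<close>
  have aug: "boundary c = 0" if "Poly_Mapping.keys c \<subseteq> chains (Suc 0)" "augmentation (boundary c) = 0" for c
  proof -
    have k: "Poly_Mapping.keys (boundary c) \<subseteq> {[]}" using boundary_chains[OF that(1)] chains_0 by simp
    have "augmentation (boundary c) = (\<Sum>g\<in>{[]}. Poly_Mapping.lookup (boundary c) g)"
      unfolding augmentation_def
      by (rule sum.mono_neutral_left[OF _ k]) (auto simp: not_in_keys_iff_lookup_eq_zero[symmetric])
    hence z: "Poly_Mapping.lookup (boundary c) [] = 0" using that(2) by simp
    show ?thesis
    proof (rule poly_mapping_eqI)
      fix w show "Poly_Mapping.lookup (boundary c) w = Poly_Mapping.lookup 0 w"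
        using z k by (cases "w = []") (auto simp: not_in_keys_iff_lookup_eq_zero[symmetric])
    qed
  qed
  show "boundary ` carrier (chain_module 1) =
      {x \<in> carrier (chain_module 0). augmentation (boundary x) = \<zero>\<^bsub>trivial_module\<^esub>}"
  proof (intro subset_antisym subsetI)
    fix x assume "x \<in> boundary ` carrier (chain_module 1)"
    thus "x \<in> {x \<in> carrier (chain_module 0). augmentation (boundary x) = \<zero>\<^bsub>trivial_module\<^esub>}"
      by (auto simp: boundary_boundary dest: subsetD[OF boundary_chains])
  next
    fix x assume "x \<in> {x \<in> carrier (chain_module 0). augmentation (boundary x) = \<zero>\<^bsub>trivial_module\<^esub>}"
    hence "Poly_Mapping.keys x \<subseteq> chains (Suc 0)" "boundary x = 0" using aug by auto
    thus "x \<in> boundary ` carrier (chain_module 1)" using acyclic[of x "Suc 0"] by (auto simp: image_iff)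
  qed
  fix i
  show "boundary ` carrier (chain_module (Suc (Suc i))) =
      {x \<in> carrier (chain_module (Suc i)). boundary x = \<zero>\<^bsub>chain_module i\<^esub>}"
  proof (intro subset_antisym subsetI)
    fix x assume "x \<in> boundary ` carrier (chain_module (Suc (Suc i)))"
    thus "x \<in> {x \<in> carrier (chain_module (Suc i)). boundary x = \<zero>\<^bsub>chain_module i\<^esub>}"
      by (auto simp: boundary_boundary dest: subsetD[OF boundary_chains])
  next
    fix x assume "x \<in> {x \<in> carrier (chain_module (Suc i)). boundary x = \<zero>\<^bsub>chain_module i\<^esub>}"
    thus "x \<in> boundary ` carrier (chain_module (Suc (Suc i)))"
      using acyclic[of x "Suc (Suc i)"] by (auto simp: image_iff)
  qed
qed

lemma chain_module_length: "length_at_most chain_module (card \<Sigma>)"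
  unfolding length_at_most_def
proof (intro allI impI)
  fix i assume "card \<Sigma> < i"
  \<comment> \<open>Degree \<open>i\<close> means \<open>Suc i\<close> vertices, which exceeds the
    bound in \<open>based_chains_empty\<close>; a chain of this length is nonempty and has a based
    translate.\<close>
  hence "chains (Suc i) = {}"
    using based_chains_empty[of "Suc i"] chain_orbit(2)[of _ "Suc i"] by (force simp: chains_def)
  thus "carrier (chain_module i) = {\<zero>\<^bsub>chain_module i\<^esub>}" by auto
qed

end

text \<open>An integer coefficient is stored as that multiple of one fixed basis element. The
  element \<open>undefined\<close> need not belong to the group, since a transported module has the
  image of this map as its ambient set.\<close>

lemma inj_list_chain_bar: "inj (\<lambda>(c :: 'g list \<Rightarrow>\<^sub>0 int) w. frag_cmul (Poly_Mapping.lookup c w) (frag_of (undefined :: 'g)))"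
proof (rule injI, rule poly_mapping_eqI)
  fix c c' :: "'g list \<Rightarrow>\<^sub>0 int" and w
  assume "(\<lambda>w. frag_cmul (Poly_Mapping.lookup c w) (frag_of (undefined :: 'g)))
    = (\<lambda>w. frag_cmul (Poly_Mapping.lookup c' w) (frag_of undefined))"
  from arg_cong[OF fun_cong[OF this, of w], of "\<lambda>a. Poly_Mapping.lookup a undefined"]
  show "Poly_Mapping.lookup c w = Poly_Mapping.lookup c' w" by simp
qed

lemma (in lattice_submonoid) fg_free_resolution_of_length:
  "\<exists>(F :: nat \<Rightarrow> ('a \<Rightarrow>\<^sub>0 int, 'a bar) module) d \<epsilon>.
     resolution (group_ring G) F d \<epsilon> trivial_module \<and>
     (\<forall>i. fg_free_module (group_ring G) (F i)) \<and> length_at_most F (card \<Sigma>)"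
proof -
  define J :: "('a list \<Rightarrow>\<^sub>0 int) \<Rightarrow> 'a bar"
    where "J c w = frag_cmul (Poly_Mapping.lookup c w) (frag_of undefined)" for c w
  have J: "inj J" using inj_list_chain_bar unfolding J_def[abs_def] .
  have "length_at_most (\<lambda>i. transport_module J (chain_module i)) (card \<Sigma>)"
    using chain_module_length by (simp add: length_at_most_def)
  thus ?thesis
    using transport_resolution[OF chain_resolution J] fg_free_transport[OF fg_free_chain_module J] by blast
qed

section \<open>Vanishing above the number of generators\<close>

theorem corollary6p1:
  fixes G :: "('g, 'b) monoid_scheme" (structure)
    and P \<Sigma> :: "'g set"
  assumes "group G"
    and "submonoid P G"
    and "finite \<Sigma>"
    and "P = monoid_generated G \<Sigma>"
    and a: "left_quasi_lattice_ordered G P" "right_Ore G P" "group_of_right_fractions G P"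
    and b: "\<And>x y z s. \<lbrakk>x \<in> carrier G; y \<in> carrier G; z \<in> carrier G;
          (x <# P) \<inter> (y <# P) = z <# P; s \<in> \<Sigma>\<rbrakk>
        \<Longrightarrow> ((x \<otimes> s) <# P) \<inter> (y <# P) = z <# P \<or>
            (\<exists>t\<in>\<Sigma>. ((x \<otimes> s) <# P) \<inter> (y <# P) = (z \<otimes> t) <# P)"
    \<comment> \<open>\<open>P \<inter> (\<Inter>t\<in>F. t <# P)\<close> is \<open>P\<close> for empty \<open>F\<close>, and otherwise \<open>P\<close> can be omitted since \<open>t <# P \<subseteq> P\<close>\<close>
    and c: "\<And>F s. \<lbrakk>finite F; F \<subseteq> \<Sigma>; s \<in> \<Sigma> - F\<rbrakk>
        \<Longrightarrow> (s <# P) \<inter> (P \<inter> (\<Inter>t\<in>F. t <# P)) \<subset> P \<inter> (\<Inter>t\<in>F. t <# P)"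
  shows "type_FL G \<and>
    cohomological_dimension G \<le> enat (card \<Sigma>) \<and>
    (\<forall>(F :: nat \<Rightarrow> ('g \<Rightarrow>\<^sub>0 int, 'f) module) d \<epsilon> (M :: ('g \<Rightarrow>\<^sub>0 int, 'm) module) i.
       projective_resolution (group_ring G) F d \<epsilon> trivial_module \<longrightarrow>
       left_module (group_ring G) M \<longrightarrow>
       i > card \<Sigma> \<longrightarrow>
       trivial_group (group_homology G F d M i) \<and>
       trivial_group (group_cohomology G F d M i))"
proof -
  interpret lattice_submonoid G P \<Sigma>
    by (intro lattice_submonoid.intro lattice_submonoid_axioms.intro) (fact assms)+
  obtain C :: "nat \<Rightarrow> ('g \<Rightarrow>\<^sub>0 int, 'g bar) module" and d' \<epsilon>'
    where C: "resolution (group_ring G) C d' \<epsilon>' trivial_module"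
      "\<forall>i. fg_free_module (group_ring G) (C i)" "length_at_most C (card \<Sigma>)"
    using fg_free_resolution_of_length by (elim exE conjE)
  \<comment> \<open>\<open>frag_of_nonzero\<close> provides the two distinct elements of the ring
    type.\<close>
  have proj: "projective_resolution (group_ring G) C d' \<epsilon>' trivial_module"
    unfolding projective_resolution_def
    using C(1,2) fg_free_imp_projective[OF _ frag_of_nonzero] by blast
  have "type_FL G" unfolding type_FL_def using C by blast
  moreover have "cohomological_dimension G \<le> enat (card \<Sigma>)"
    unfolding cohomological_dimension_def using proj C(3) by (intro Inf_lower) blast
  moreover have "trivial_group (group_homology G F d M i) \<and> trivial_group (group_cohomology G F d M i)"
    if F: "projective_resolution (group_ring G) F d \<epsilon> trivial_module" and M: "left_module (group_ring G) M"
      and i: "i > card \<Sigma>"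
    for F :: "nat \<Rightarrow> ('g \<Rightarrow>\<^sub>0 int, 'f) module" and d \<epsilon> and M :: "('g \<Rightarrow>\<^sub>0 int, 'm) module" and i
  proof -
    \<comment> \<open>The contraction identity holds in degrees \<open>Suc j\<close> with
      \<open>j \<ge> card \<Sigma>\<close>, which are exactly the degrees above
      \<open>card \<Sigma>\<close>.\<close>
    define j where "j = i - 1"
    have j: "i = Suc j" "j \<ge> card \<Sigma>" unfolding j_def using i by linarith+
    obtain h where h: "\<forall>i. h i \<in> left_module_hom (group_ring G) (F i) (F (Suc i))"
      "\<forall>i\<ge>card \<Sigma>. \<forall>x\<in>carrier (F (Suc i)). x = d (Suc i) (h (Suc i) x) \<oplus>\<^bsub>F (Suc i)\<^esub> h i (d i x)"
      using contraction_above_length[OF F proj C(3)] by (elim exE conjE)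
    interpret T: tensor_module G M
      by (rule tensor_module.intro[OF group_axioms tensor_module_axioms.intro[OF M]])
    have F': "resolution (group_ring G) F d \<epsilon> trivial_module"
      using F by (simp add: projective_resolution_def)
    note hj = h(1)[rule_format] h(2)[rule_format, OF j(2)]
    show ?thesis unfolding j(1)
      by (intro conjI T.homology_vanishes[OF F' hj] cohomology_vanishes[OF F' M hj])
  qed
  ultimately show ?thesis by blast
qed

end
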